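(* Let $n\ge2$, and let $\Sigma'$ be the branching semigroup of $A_{n-1}\subset A_n$, where $A_n=\mathfrak{sl}_{n+1}$ and $A_{n-1}$ consists of the matrices in $A_n$ with zero last row and column, defined using any ordering of the positive roots of $A_n$ and any homogeneous monomial order on $\mathbb Z^{n(n+1)/2}$. For $k=1,\dots,n$ let $\sigma_{2k-1}=(\pi_k;0)$ be the signature with highest weight $\pi_k$ and all exponents zero, and let $\sigma_{2k}=(\pi_k;\varepsilon_k-\varepsilon_{n+1})$ be the signature with highest weight $\pi_k$ whose only nonzero exponent is the exponent $1$ at the root $\varepsilon_k-\varepsilon_{n+1}$. Then $\Sigma'$ is a free (commutative) semigroup generated by $\sigma_1,\dots,\sigma_{2n}$.
   Context: Semigroups of signatures contain the zero signature. General definitions. Let $\mathfrak g$ be a simple complex Lie algebra with a triangular decomposition and positive roots $\{\alpha_1,\dots,\alpha_N\}$ in a fixed order, root vectors $e_{\pm\alpha}$; $V(\lambda)$ is the irreducible module with highest weight $\lambda$ and highest weight vector $v_\lambda$. A signature is $\sigma=(\lambda;p_1,\dots,p_N)$ with $\lambda$ dominant and exponents $p_i\in\mathbb Z_{\ge0}$; $v(\sigma)=e_{-\alpha_1}^{p_1}\cdots e_{-\alpha_N}^{p_N}v_\lambda$. Signatures are added componentwise. Fix a monomial order on exponent tuples (a total order compatible with addition, for which $0$ is the least element of $\mathbb Z_{\geq 0}^N$); it compares signatures of the same highest weight. The order is homogeneous if $\sum p_i<\sum q_i$ implies $(p_i)<(q_i)$. For $0\ne\omega\in V(\lambda)^*$,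 $\operatorname{sign}(\omega)$ is the least signature $\sigma$ of highest weight $\lambda$ with $\langle\omega,v(\sigma)\rangle\neq0$. For a subalgebra $\mathfrak h\subset\mathfrak g$ with $U'^-$ the maximal unipotent subgroup (of the connected subgroup $H$ with Lie algebra $\mathfrak h$) corresponding to the negative roots of $\mathfrak h$, the branching semigroup is $\Sigma'=\{\operatorname{sign}(\omega)\mid\lambda\text{ dominant},\ 0\neq\omega\in(V(\lambda)^* )^{U'^-}\}$. The case at hand. The Cartan subalgebra of $A_n$ is the diagonal one, and $\varepsilon_1,\dots,\varepsilon_{n+1}$ are the weights of the standard basis $e_1,\dots,e_{n+1}$ of $\mathbb C^{n+1}$. The simple roots are $\varepsilon_i-\varepsilon_{i+1}$, the positive roots are $\varepsilon_i-\varepsilon_j$ with $i<j$, and the fundamental weights are $\pi_i=\varepsilon_1+\dots+\varepsilon_i$ for $i=1,\dots,n$. The positive roots of $A_{n-1}$ are $\varepsilon_i-\varepsilon_j$ with $i<j\le n$. *)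

theory Defs
  imports
    Complex_Main
    "HOL-Library.Multiset"
    "HOL-Library.Function_Algebras"
    "HOL-Library.Product_Plus"
    "Jordan_Normal_Form.Matrix"
begin

text \<open>Throughout, \<open>n\<close> is the rank of \<open>A\<^sub>n = sl\<^sub>n\<^sub>+\<^sub>1\<close>. Indices of weights and roots run
  from \<open>1\<close>, whereas matrix entries are indexed from \<open>0\<close>.\<close>

definition sl :: "nat \<Rightarrow> complex mat set" where
  "sl n = {X \<in> carrier_mat (n + 1) (n + 1). (\<Sum>i<n + 1. X $$ (i, i)) = 0}"

definition bracket :: "complex mat \<Rightarrow> complex mat \<Rightarrow> complex mat" where
  "bracket X Y = X * Y - Y * X"

definition cartan :: "nat \<Rightarrow> complex mat set" where
  "cartan n = {h \<in> sl n. diagonal_mat h}"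

text \<open>Weights are linear functionals on the Cartan subalgebra. They are extended by \<open>0\<close>, so that
  equality of functions is equality of functionals, and addition is pointwise.\<close>

type_synonym weight = "complex mat \<Rightarrow> complex"

definition cartan_dual :: "nat \<Rightarrow> weight set" where
  "cartan_dual n = {\<Lambda>.
     (\<forall>h. h \<notin> cartan n \<longrightarrow> \<Lambda> h = 0) \<and>
     (\<forall>h\<in>cartan n. \<forall>h'\<in>cartan n. \<Lambda> (h + h') = \<Lambda> h + \<Lambda> h') \<and>
     (\<forall>c. \<forall>h\<in>cartan n. \<Lambda> (c \<cdot>\<^sub>m h) = c * \<Lambda> h)}"

definition eps :: "nat \<Rightarrow> nat \<Rightarrow> weight" where
  "eps n i = (\<lambda>h. if h \<in> cartan n then h $$ (i - 1, i - 1) else 0)"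

definition fund_weight :: "nat \<Rightarrow> nat \<Rightarrow> weight" where
  "fund_weight n k = (\<Sum>i=1..k. eps n i)"

definition pos_roots :: "nat \<Rightarrow> weight set" where
  "pos_roots n = {eps n i - eps n j | i j. 1 \<le> i \<and> i < j \<and> j \<le> n + 1}"

definition simple_coroot :: "nat \<Rightarrow> nat \<Rightarrow> complex mat" where
  "simple_coroot n i = mat (n + 1) (n + 1)
     (\<lambda>(a, b). if a = b \<and> a = i - 1 then 1 else if a = b \<and> a = i then -1 else 0)"

definition dominant :: "nat \<Rightarrow> weight \<Rightarrow> bool" where
  "dominant n \<Lambda> \<longleftrightarrow> \<Lambda> \<in> cartan_dual n \<and> (\<forall>i\<in>{1..n}. \<Lambda> (simple_coroot n i) \<in> \<nat>)"

definition root_space :: "nat \<Rightarrow> weight \<Rightarrow> complex mat set" where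
  "root_space n \<alpha> = {X \<in> sl n. \<forall>h\<in>cartan n. bracket h X = \<alpha> h \<cdot>\<^sub>m X}"


text \<open>A module is a subspace \<open>V\<close> of an ambient complex vector space with scalar multiplication
  \<open>scale\<close>, together with an action \<open>\<rho>\<close> which is only relevant on \<open>sl n\<close> and \<open>V\<close>.\<close>

definition sl_module ::
  "nat \<Rightarrow> (complex \<Rightarrow> 'v::ab_group_add \<Rightarrow> 'v) \<Rightarrow> 'v set \<Rightarrow> (complex mat \<Rightarrow> 'v \<Rightarrow> 'v) \<Rightarrow> bool" where
  "sl_module n scale V \<rho> \<longleftrightarrow>
     module.subspace scale V \<and>
     (\<forall>X\<in>sl n. \<forall>x\<in>V. \<rho> X x \<in> V) \<and>
     (\<forall>X\<in>sl n. \<forall>x\<in>V. \<forall>y\<in>V. \<rho> X (x + y) = \<rho> X x + \<rho> X y) \<and>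
     (\<forall>X\<in>sl n. \<forall>c. \<forall>x\<in>V. \<rho> X (scale c x) = scale c (\<rho> X x)) \<and>
     (\<forall>X\<in>sl n. \<forall>Y\<in>sl n. \<forall>x\<in>V. \<rho> (X + Y) x = \<rho> X x + \<rho> Y x) \<and>
     (\<forall>c. \<forall>X\<in>sl n. \<forall>x\<in>V. \<rho> (c \<cdot>\<^sub>m X) x = scale c (\<rho> X x)) \<and>
     (\<forall>X\<in>sl n. \<forall>Y\<in>sl n. \<forall>x\<in>V. \<rho> (bracket X Y) x = \<rho> X (\<rho> Y x) - \<rho> Y (\<rho> X x))"

definition irreducible_module ::
  "nat \<Rightarrow> (complex \<Rightarrow> 'v::ab_group_add \<Rightarrow> 'v) \<Rightarrow> 'v set \<Rightarrow> (complex mat \<Rightarrow> 'v \<Rightarrow> 'v) \<Rightarrow> bool" where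
  "irreducible_module n scale V \<rho> \<longleftrightarrow>
     sl_module n scale V \<rho> \<and> V \<noteq> {0} \<and>
     (\<forall>W. module.subspace scale W \<and> W \<subseteq> V \<and> (\<forall>X\<in>sl n. \<forall>x\<in>W. \<rho> X x \<in> W)
          \<longrightarrow> W = {0} \<or> W = V)"

definition highest_weight_vector ::
  "nat \<Rightarrow> (complex \<Rightarrow> 'v::ab_group_add \<Rightarrow> 'v) \<Rightarrow> 'v set \<Rightarrow> (complex mat \<Rightarrow> 'v \<Rightarrow> 'v)
     \<Rightarrow> weight \<Rightarrow> 'v \<Rightarrow> bool" where
  "highest_weight_vector n scale V \<rho> \<Lambda> v \<longleftrightarrow>
     v \<in> V \<and> v \<noteq> 0 \<and>
     (\<forall>h\<in>cartan n. \<rho> h v = scale (\<Lambda> h) v) \<and>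
     (\<forall>\<alpha>\<in>pos_roots n. \<forall>X\<in>root_space n \<alpha>. \<rho> X v = 0)"

definition dual :: "(complex \<Rightarrow> 'v::ab_group_add \<Rightarrow> 'v) \<Rightarrow> 'v set \<Rightarrow> ('v \<Rightarrow> complex) set" where
  "dual scale V = {\<omega>.
     (\<forall>x\<in>V. \<forall>y\<in>V. \<omega> (x + y) = \<omega> x + \<omega> y) \<and> (\<forall>c. \<forall>x\<in>V. \<omega> (scale c x) = c * \<omega> x)}"


text \<open>The maximal unipotent subgroup of \<open>SL\<^sub>n\<close> (embedded in \<open>SL\<^sub>n\<^sub>+\<^sub>1\<close> as the upper left block)
  for the negative roots of \<open>A\<^sub>n\<^sub>-\<^sub>1\<close>: unitriangular lower triangular matrices whose last row and
  column are those of the identity.\<close>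

definition U'_minus :: "nat \<Rightarrow> complex mat set" where
  "U'_minus n = {u \<in> carrier_mat (n + 1) (n + 1).
     (\<forall>i\<le>n. u $$ (i, i) = 1) \<and>
     (\<forall>i\<le>n. \<forall>j\<le>n. i \<noteq> j \<and> \<not> (j < i \<and> i < n) \<longrightarrow> u $$ (i, j) = 0)}"

text \<open>The group element \<open>u = exp X\<close>, with \<open>X\<close> nilpotent, acts on a module with action \<open>\<rho>\<close> by
  \<open>exp (\<rho> X)\<close>. For unipotent \<open>u\<close> the logarithm is a finite sum, as \<open>(u - 1)\<^sup>n\<^sup>+\<^sup>1 = 0\<close>. The
  exponential series is a finite sum at each vector because \<open>\<rho> X\<close> is nilpotent on the modules
  \<open>V(\<Lambda>)\<close>.\<close>

definition unipotent_log :: "nat \<Rightarrow> complex mat \<Rightarrow> complex mat" where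
  "unipotent_log n u = mat (n + 1) (n + 1)
     (\<lambda>(i, j). \<Sum>k=1..n. (-1) ^ (k + 1) / of_nat k * ((u - 1\<^sub>m (n + 1)) ^\<^sub>m k) $$ (i, j))"

definition nilpotent_exp ::
  "(complex \<Rightarrow> 'v::ab_group_add \<Rightarrow> 'v) \<Rightarrow> ('v \<Rightarrow> 'v) \<Rightarrow> 'v \<Rightarrow> 'v" where
  "nilpotent_exp scale T x = (\<Sum>k | (T ^^ k) x \<noteq> 0. scale (1 / fact k) ((T ^^ k) x))"

definition group_act ::
  "nat \<Rightarrow> (complex \<Rightarrow> 'v::ab_group_add \<Rightarrow> 'v) \<Rightarrow> (complex mat \<Rightarrow> 'v \<Rightarrow> 'v) \<Rightarrow> complex mat \<Rightarrow> 'v \<Rightarrow> 'v"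
  where "group_act n scale \<rho> u = nilpotent_exp scale (\<rho> (unipotent_log n u))"

definition dual_invariants ::
  "nat \<Rightarrow> (complex \<Rightarrow> 'v::ab_group_add \<Rightarrow> 'v) \<Rightarrow> 'v set \<Rightarrow> (complex mat \<Rightarrow> 'v \<Rightarrow> 'v)
     \<Rightarrow> ('v \<Rightarrow> complex) set" where
  "dual_invariants n scale V \<rho> = {\<omega> \<in> dual scale V.
     \<forall>u\<in>U'_minus n. \<forall>x\<in>V. \<omega> (group_act n scale \<rho> u x) = \<omega> x}"


text \<open>Exponent tuples are indexed by the positive roots themselves. The ordering of the positive
  roots is a list \<open>rs\<close>, and it only affects the order of the factors of \<open>v(\<sigma>)\<close>. Signatures are
  added componentwise through the type class instances for pairs and functions.\<close>

type_synonym exponents = "weight \<Rightarrow> nat"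

type_synonym signature = "weight \<times> exponents"

definition exponent_tuples :: "nat \<Rightarrow> exponents set" where
  "exponent_tuples n = {p. \<forall>\<alpha>. \<alpha> \<notin> pos_roots n \<longrightarrow> p \<alpha> = 0}"

definition unit_exponent :: "weight \<Rightarrow> exponents" where
  "unit_exponent \<alpha> = (\<lambda>\<beta>. if \<beta> = \<alpha> then 1 else 0)"

text \<open>An order is given by the set of pairs \<open>(p, q)\<close> with \<open>p \<le> q\<close>.\<close>

definition monomial_order :: "nat \<Rightarrow> exponents rel \<Rightarrow> bool" where
  "monomial_order n r \<longleftrightarrow>
     linear_order_on (exponent_tuples n) r \<and>
     (\<forall>p\<in>exponent_tuples n. \<forall>q\<in>exponent_tuples n. \<forall>s\<in>exponent_tuples n.
        (p, q) \<in> r \<longrightarrow> (p + s, q + s) \<in> r) \<and>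
     (\<forall>p\<in>exponent_tuples n. (0, p) \<in> r)"

definition homogeneous_order :: "nat \<Rightarrow> exponents rel \<Rightarrow> bool" where
  "homogeneous_order n r \<longleftrightarrow>
     (\<forall>p\<in>exponent_tuples n. \<forall>q\<in>exponent_tuples n.
        (\<Sum>\<alpha>\<in>pos_roots n. p \<alpha>) < (\<Sum>\<alpha>\<in>pos_roots n. q \<alpha>) \<longrightarrow> (p, q) \<in> r)"

text \<open>\<open>e\<close> is the choice of root vectors, and \<open>v\<close> the highest weight vector.\<close>

definition signature_vector ::
  "weight list \<Rightarrow> (weight \<Rightarrow> complex mat) \<Rightarrow> (complex mat \<Rightarrow> 'v \<Rightarrow> 'v) \<Rightarrow> 'v \<Rightarrow> exponents \<Rightarrow> 'v" where
  "signature_vector rs e \<rho> v p = foldr (\<lambda>\<alpha> x. (\<rho> (e (- \<alpha>)) ^^ p \<alpha>) x) rs v"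

definition sign ::
  "nat \<Rightarrow> weight list \<Rightarrow> (weight \<Rightarrow> complex mat) \<Rightarrow> exponents rel
     \<Rightarrow> (complex mat \<Rightarrow> 'v \<Rightarrow> 'v) \<Rightarrow> weight \<Rightarrow> 'v \<Rightarrow> ('v \<Rightarrow> complex) \<Rightarrow> signature" where
  "sign n rs e r \<rho> \<Lambda> v \<omega> = (\<Lambda>, THE p.
     p \<in> exponent_tuples n \<and> \<omega> (signature_vector rs e \<rho> v p) \<noteq> 0 \<and>
     (\<forall>q\<in>exponent_tuples n. \<omega> (signature_vector rs e \<rho> v q) \<noteq> 0 \<longrightarrow> (p, q) \<in> r))"

definition branching_semigroup ::
  "nat \<Rightarrow> weight list \<Rightarrow> (weight \<Rightarrow> complex mat) \<Rightarrow> exponents rel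
     \<Rightarrow> (complex \<Rightarrow> 'v::ab_group_add \<Rightarrow> 'v) \<Rightarrow> (weight \<Rightarrow> 'v set)
     \<Rightarrow> (weight \<Rightarrow> complex mat \<Rightarrow> 'v \<Rightarrow> 'v) \<Rightarrow> (weight \<Rightarrow> 'v) \<Rightarrow> signature set" where
  "branching_semigroup n rs e r scale V \<rho> v =
     {sign n rs e r (\<rho> \<Lambda>) \<Lambda> (v \<Lambda>) \<omega> | \<Lambda> \<omega>.
        dominant n \<Lambda> \<and> \<omega> \<in> dual_invariants n scale (V \<Lambda>) (\<rho> \<Lambda>) \<and> (\<exists>x\<in>V \<Lambda>. \<omega> x \<noteq> 0)}"

text \<open>\<open>S\<close> is the free commutative semigroup, with zero, on the family \<open>(g i)\<close> for \<open>i \<in> I\<close>: every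
  sum of generators is in \<open>S\<close>, and every element of \<open>S\<close> is such a sum in exactly one way.\<close>

definition free_comm_semigroup_on :: "'a::comm_monoid_add set \<Rightarrow> 'i set \<Rightarrow> ('i \<Rightarrow> 'a) \<Rightarrow> bool" where
  "free_comm_semigroup_on S I g \<longleftrightarrow> bij_betw (\<lambda>M. \<Sum>i\<in>#M. g i) {M. set_mset M \<subseteq> I} S"

end

theory Submission
  imports
    Defs
    "HOL-Library.Poly_Mapping"
    "Jordan_Normal_Form.Determinant"
begin

text \<open>Let \<open>\<Lambda> = \<Sum> a\<^sub>k \<pi>\<^sub>k\<close> be a dominant weight and \<open>v\<close> the highest weight vector of \<open>V = V(\<Lambda>)\<close>.
Matrix units \<open>E\<^sub>i\<^sub>j\<close> have indices from \<open>0\<close> to \<open>n\<close>; put \<open>y\<^sub>k = E\<^sub>n\<^sub>,\<^sub>k\<^sub>-\<^sub>1\<close>, the root vector for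
\<open>-(\<epsilon>\<^sub>k - \<epsilon>\<^sub>n\<^sub>+\<^sub>1)\<close>, and \<open>f\<^sub>k = E\<^sub>k\<^sub>,\<^sub>k\<^sub>-\<^sub>1\<close>. The point is that the signatures of weight \<open>\<Lambda>\<close> in the
branching semigroup are exactly the pairs \<open>(\<Lambda>; c)\<close>, where \<open>c\<close> has exponent \<open>c\<^sub>k \<le> a\<^sub>k\<close> at
\<open>\<epsilon>\<^sub>k - \<epsilon>\<^sub>n\<^sub>+\<^sub>1\<close> and \<open>0\<close> elsewhere (\<open>branching_semigroup_eq\<close>). Such a pair is
\<open>\<Sum> (a\<^sub>k - c\<^sub>k) \<sigma>\<^sub>2\<^sub>k\<^sub>-\<^sub>1 + c\<^sub>k \<sigma>\<^sub>2\<^sub>k\<close>, and \<open>a\<close> and \<open>c\<close> can be read off from it, which is freeness.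

A functional \<open>\<omega>\<close> on \<open>V\<close> is invariant under the unipotent group iff it vanishes on the image of every
\<open>E\<^sub>i\<^sub>j\<close> with \<open>j < i < n\<close> (\<open>dual_invariants_imp_kills\<close>, \<open>kills_imp_dual_invariants\<close>).

\<^emph>\<open>No other signatures.\<close> Since the order is homogeneous, the sign of \<open>\<omega>\<close> is found among the words of
least length in lower matrix units on which \<open>\<omega>\<close> does not vanish. The letters of such a word may be
permuted, because a commutator is a shorter word (\<open>word_value_perm\<close>). A letter \<open>E\<^sub>i\<^sub>j\<close> with \<open>i < n\<close>
could be moved to the front, where \<open>\<omega>\<close> kills it; so only the letters \<open>y\<^sub>k\<close> occur. Finally
\<open>f\<^sub>k\<close> raised to the power \<open>a\<^sub>k + 1\<close> kills \<open>v\<close>. Here \<open>f\<^sub>n = y\<^sub>n\<close>, while for \<open>k < n\<close> the commutator of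
\<open>y\<^sub>k\<^sub>+\<^sub>1\<close> and \<open>f\<^sub>k\<close> is \<open>y\<^sub>k\<close>, and \<open>\<omega>\<close> kills the image of \<open>f\<^sub>k\<close>. Moving the
factors \<open>f\<^sub>k\<close> to the front, one at a time, turns factors \<open>y\<^sub>k\<^sub>+\<^sub>1\<close> into factors \<open>y\<^sub>k\<close>, and shows
that \<open>\<omega>\<close> vanishes on every monomial in the \<open>y\<^sub>k\<close>, applied to \<open>v\<close>, whose exponent at \<open>y\<^sub>k\<close> exceeds
\<open>a\<^sub>k\<close> (\<open>last_row_exponent_bound\<close>).

\<^emph>\<open>All of these occur.\<close> The Lie algebra acts by derivations on polynomials in the entries of an
\<open>(n+1) \<times> n\<close> matrix. Let \<open>\<Delta>\<^sub>k\<close> be the leading \<open>k \<times> k\<close> minor and \<open>\<Delta>'\<^sub>k\<close> the one with its last row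
replaced by the last row of the matrix. The polynomial
\<open>w\<^sub>c = \<Prod> \<Delta>\<^sub>k\<^bsup>a\<^sub>k - c\<^sub>k\<^esup> \<Delta>'\<^sub>k\<^bsup>c\<^sub>k\<^esup>\<close> is killed by all \<open>E\<^sub>j\<^sub>i\<close> with \<open>j < i < n\<close>, and \<open>w\<^sub>0\<close> is a
highest weight vector of weight \<open>\<Lambda>\<close>. For the Fock inner product, \<open>E\<^sub>i\<^sub>j\<close> and \<open>E\<^sub>j\<^sub>i\<close> are adjoint, so
\<open>\<langle>\<sqdot>, w\<^sub>c\<rangle>\<close> is an invariant functional. The operators \<open>E\<^sub>k\<^sub>-\<^sub>1\<^sub>,\<^sub>n\<close>, adjoint to the \<open>y\<^sub>k\<close>, turn the factors
\<open>\<Delta>'\<^sub>k\<close> back into \<open>\<Delta>\<^sub>k\<close>; together with a comparison of weights this shows that \<open>\<langle>\<sqdot>, w\<^sub>c\<rangle>\<close> is nonzero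
on the monomial \<open>\<Prod> y\<^sub>k\<^bsup>d\<^sub>k\<^esup> w\<^sub>0\<close> exactly for \<open>d = c\<close> (\<open>fock_last_row_word\<close>, \<open>fock_last_row_word_eq\<close>).

\<^emph>\<open>Transfer to an abstract irreducible module.\<close> The submodule of the product of \<open>V\<close> with the
polynomials that is generated by \<open>(v, w\<^sub>0)\<close> is the graph of an embedding of \<open>V\<close>. It projects onto
\<open>V\<close> by irreducibility. If it contains \<open>(0, P)\<close>, then \<open>P\<close> is orthogonal to \<open>w\<^sub>0\<close> for reasons of weight,
hence orthogonal to the module that \<open>w\<^sub>0\<close> generates, which contains \<open>P\<close>; as the inner product is
definite, \<open>P = 0\<close> (\<open>graph_kernel_trivial\<close>). The embedding also provides \<open>f\<^sub>k\<^bsup>a\<^sub>k + 1\<^esup> v = 0\<close> and the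
local nilpotency that the exponentials in the group action require.\<close>

section \<open>Polynomials and the Fock inner product\<close>

text \<open>Monomials are multisets of variables, so that polynomials inherit a commutative ring structure
  from finitely supported functions on a commutative monoid.\<close>

type_synonym 'x mpoly = "'x multiset \<Rightarrow>\<^sub>0 complex"

definition Var :: "'x \<Rightarrow> 'x mpoly" where
  "Var x = Poly_Mapping.single {#x#} 1"

definition Const :: "complex \<Rightarrow> 'x mpoly" where
  "Const c = Poly_Mapping.single {#} c"

lemma Const_simps [simp]:
  "Const 0 = (0 :: 'x mpoly)" "Const 1 = (1 :: 'x mpoly)"
  by (simp_all add: Const_def)

lemma Const_add: "Const (a + b) = (Const a + Const b :: 'x mpoly)"
  by (simp add: Const_def single_add)

lemma Const_uminus: "Const (- a) = (- Const a :: 'x mpoly)"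
  by (simp add: Const_def single_uminus)

lemma Const_mult: "Const (a * b) = (Const a * Const b :: 'x mpoly)"
  by (simp add: Const_def mult_single)

lemma Const_sum: "Const (sum f A) = (\<Sum>x\<in>A. Const (f x) :: 'x mpoly)"
  by (induction A rule: infinite_finite_induct) (simp_all add: Const_add)

lemma Const_of_nat: "Const (of_nat k) = (of_nat k :: 'x mpoly)"
  by (induction k) (simp_all add: Const_add)

lemma lookup_Const_mult [simp]:
  "Poly_Mapping.lookup (Const c * P) \<alpha> = c * Poly_Mapping.lookup P \<alpha>"
  unfolding Const_def
  by (simp add: map.rep_eq when_def flip: mult_map_scale_conv_mult)

lemma mpoly_induct [case_names single add]:
  fixes P :: "'x mpoly"
  assumes single: "\<And>\<alpha> c. Q (Poly_Mapping.single \<alpha> c)"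
    and add: "\<And>P R. Q P \<Longrightarrow> Q R \<Longrightarrow> Q (P + R)"
  shows "Q P"
proof (induction P rule: Poly_Mapping.update_induct)
  case const
  show ?case using single[of "{#}" 0] by simp
next
  case (update P \<alpha> c)
  have "Poly_Mapping.update \<alpha> c P = P + Poly_Mapping.single \<alpha> c"
    using update(1)
    by (intro poly_mapping_eqI)
       (auto simp: lookup_update lookup_add lookup_single in_keys_iff when_def)
  thus ?case using add[OF update(3) single] by simp
qed

text \<open>The partial derivative, read off on coefficients: the coefficient of \<open>\<alpha>\<close> in the derivative
  stems from the monomial \<open>x \<alpha>\<close>, in which \<open>x\<close> has exponent \<open>count \<alpha> x + 1\<close>.\<close>

lift_definition pd :: "'x \<Rightarrow> 'x mpoly \<Rightarrow> 'x mpoly" is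
  "\<lambda>x P \<alpha>. of_nat (Suc (count \<alpha> x)) * P (add_mset x \<alpha>)"
proof -
  fix x :: 'x and P :: "'x multiset \<Rightarrow> complex"
  assume "finite {k. P k \<noteq> 0}"
  hence "finite (add_mset x -` {k. P k \<noteq> 0})"
    by (rule finite_vimageI) (simp add: inj_def)
  thus "finite {\<alpha>. of_nat (Suc (count \<alpha> x)) * P (add_mset x \<alpha>) \<noteq> 0}"
    by (rule rev_finite_subset) auto
qed

lemma lookup_pd:
  "Poly_Mapping.lookup (pd x P) \<alpha> = of_nat (Suc (count \<alpha> x)) * Poly_Mapping.lookup P (add_mset x \<alpha>)"
  by transfer simp

lemma pd_add: "pd x (P + Q) = pd x P + pd x Q"
  by (intro poly_mapping_eqI) (simp add: lookup_pd lookup_add algebra_simps)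

lemma pd_single:
  "pd x (Poly_Mapping.single \<alpha> c) = Poly_Mapping.single (\<alpha> - {#x#}) (of_nat (count \<alpha> x) * c)"
proof (intro poly_mapping_eqI)
  fix \<beta>
  show "Poly_Mapping.lookup (pd x (Poly_Mapping.single \<alpha> c)) \<beta> =
    Poly_Mapping.lookup (Poly_Mapping.single (\<alpha> - {#x#}) (of_nat (count \<alpha> x) * c)) \<beta>"
  proof (cases "x \<in># \<alpha>")
    case True
    then obtain \<gamma> where "\<alpha> = add_mset x \<gamma>" by (metis multi_member_split)
    thus ?thesis by (auto simp: lookup_pd lookup_single when_def)
  next
    case False
    hence "count \<alpha> x = 0" by (simp add: not_in_iff)
    with False show ?thesis by (auto simp: lookup_pd lookup_single when_def)
  qed
qed

lemma pd_0 [simp]: "pd x 0 = 0"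
  by (intro poly_mapping_eqI) (simp add: lookup_pd)

lemma pd_Const_mult: "pd x (Const c * P) = Const c * pd x P"
  by (intro poly_mapping_eqI) (simp add: lookup_pd)

lemma pd_mult: "pd x (P * Q) = pd x P * Q + P * pd x Q"
proof (induction P rule: mpoly_induct)
  case (add P R)
  thus ?case by (simp add: pd_add algebra_simps)
next
  case (single \<alpha> c)
  show ?case
  proof (induction Q rule: mpoly_induct)
    case (add P R)
    thus ?case by (simp add: pd_add algebra_simps)
  next
    case (single \<beta> d)
    have *: "Poly_Mapping.single (\<alpha> + \<beta> - {#x#}) (of_nat (count \<alpha> x) * u) =
             Poly_Mapping.single (\<alpha> - {#x#} + \<beta>) (of_nat (count \<alpha> x) * u)" for u :: complex and \<alpha> \<beta>
    proof (cases "x \<in># \<alpha>")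
      case True
      then obtain \<gamma> where "\<alpha> = add_mset x \<gamma>" by (metis multi_member_split)
      thus ?thesis by simp
    next
      case False
      hence "count \<alpha> x = 0" by (simp add: not_in_iff)
      thus ?thesis by simp
    qed
    have "Poly_Mapping.single (\<alpha> + \<beta> - {#x#}) (of_nat (count (\<alpha> + \<beta>) x) * (c * d)) =
          Poly_Mapping.single (\<alpha> + \<beta> - {#x#}) (of_nat (count \<alpha> x) * (c * d)) +
          Poly_Mapping.single (\<beta> + \<alpha> - {#x#}) (of_nat (count \<beta> x) * (c * d))"
      by (simp add: algebra_simps flip: single_add)
    also have "\<dots> = Poly_Mapping.single (\<alpha> - {#x#} + \<beta>) (of_nat (count \<alpha> x) * (c * d)) +
          Poly_Mapping.single (\<beta> - {#x#} + \<alpha>) (of_nat (count \<beta> x) * (c * d))"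
      by (simp only: *)
    finally show ?case
      by (simp add: pd_single mult_single ac_simps)
  qed
qed

lemma pd_Var: "pd x (Var y) = (if x = y then 1 else 0)"
  by (auto simp: Var_def pd_single)

lemma pd_commute: "pd x (pd y P) = pd y (pd x P)"
  by (intro poly_mapping_eqI) (auto simp: lookup_pd add_mset_commute)

text \<open>The squared length of a monomial in the Fock inner product, for which monomials are orthogonal.
  These lengths make multiplication by a variable adjoint to the derivative.\<close>

definition mfact :: "'x multiset \<Rightarrow> nat" where
  "mfact \<alpha> = (\<Prod>x\<in>set_mset \<alpha>. fact (count \<alpha> x))"

lemma mfact_pos: "mfact \<alpha> > 0"
  by (simp add: mfact_def prod_pos)

lemma mfact_add_mset: "mfact (add_mset x \<alpha>) = Suc (count \<alpha> x) * mfact \<alpha>"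
proof -
  let ?S = "insert x (set_mset \<alpha>)"
  have "mfact \<alpha> = (\<Prod>y\<in>?S. fact (count \<alpha> y))"
    unfolding mfact_def by (intro prod.mono_neutral_left) (auto simp: not_in_iff)
  also have "\<dots> = fact (count \<alpha> x) * (\<Prod>y\<in>?S - {x}. fact (count \<alpha> y))"
    by (subst prod.remove[of _ x]) auto
  finally have 1: "mfact \<alpha> = fact (count \<alpha> x) * (\<Prod>y\<in>?S - {x}. fact (count \<alpha> y))" .
  have "mfact (add_mset x \<alpha>) = (\<Prod>y\<in>?S. fact (count (add_mset x \<alpha>) y))"
    by (simp add: mfact_def)
  also have "\<dots> = fact (Suc (count \<alpha> x)) * (\<Prod>y\<in>?S - {x}. fact (count (add_mset x \<alpha>) y))"
    by (subst prod.remove[of _ x]) auto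
  also have "(\<Prod>y\<in>?S - {x}. fact (count (add_mset x \<alpha>) y)) = (\<Prod>y\<in>?S - {x}. fact (count \<alpha> y) :: nat)"
    by (intro prod.cong) auto
  finally show ?thesis using 1 by (simp add: algebra_simps)
qed

definition fock :: "'x mpoly \<Rightarrow> 'x mpoly \<Rightarrow> complex" where
  "fock P Q = (\<Sum>\<alpha>\<in>Poly_Mapping.keys P.
     of_nat (mfact \<alpha>) * Poly_Mapping.lookup P \<alpha> * cnj (Poly_Mapping.lookup Q \<alpha>))"

lemma fock_superset:
  assumes "finite S" "Poly_Mapping.keys P \<subseteq> S \<or> Poly_Mapping.keys Q \<subseteq> S"
  shows "fock P Q = (\<Sum>\<alpha>\<in>S. of_nat (mfact \<alpha>) * Poly_Mapping.lookup P \<alpha> * cnj (Poly_Mapping.lookup Q \<alpha>))"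
proof -
  let ?f = "\<lambda>\<alpha>. of_nat (mfact \<alpha>) * Poly_Mapping.lookup P \<alpha> * cnj (Poly_Mapping.lookup Q \<alpha>)"
  have "fock P Q = (\<Sum>\<alpha>\<in>Poly_Mapping.keys P \<inter> S. ?f \<alpha>)"
    unfolding fock_def using assms by (intro sum.mono_neutral_right) (auto simp: in_keys_iff)
  also have "\<dots> = (\<Sum>\<alpha>\<in>S. ?f \<alpha>)"
    using assms by (intro sum.mono_neutral_left) (auto simp: in_keys_iff)
  finally show ?thesis .
qed

lemma fock_add_left: "fock (P + P') Q = fock P Q + fock P' Q"
  by (simp add: fock_superset[of "Poly_Mapping.keys Q"] lookup_add algebra_simps sum.distrib)

lemma fock_add_right: "fock P (Q + Q') = fock P Q + fock P Q'"
  by (simp add: fock_superset[of "Poly_Mapping.keys P"] lookup_add algebra_simps sum.distrib)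

lemma fock_Const_left: "fock (Const c * P) Q = c * fock P Q"
  unfolding fock_superset[of "Poly_Mapping.keys Q" _ Q, OF finite_keys disjI2[OF order_refl]]
  unfolding sum_distrib_left by (intro sum.cong) simp_all

lemma fock_Const_right: "fock P (Const c * Q) = cnj c * fock P Q"
  unfolding fock_superset[of "Poly_Mapping.keys P" P, OF finite_keys disjI1[OF order_refl]]
  unfolding sum_distrib_left by (intro sum.cong) simp_all

lemma fock_0 [simp]: "fock 0 Q = 0" "fock P 0 = 0"
  by (simp_all add: fock_def)

lemma fock_sum_left: "fock (sum f A) Q = (\<Sum>x\<in>A. fock (f x) Q)"
  by (induction A rule: infinite_finite_induct) (auto simp: fock_add_left)

lemma fock_sum_right: "fock Q (sum f A) = (\<Sum>x\<in>A. fock Q (f x))"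
  by (induction A rule: infinite_finite_induct) (auto simp: fock_add_right)

lemma fock_definite:
  assumes "fock P P = 0"
  shows "P = 0"
proof -
  have "fock P P = of_real (\<Sum>\<alpha>\<in>Poly_Mapping.keys P. mfact \<alpha> * (cmod (Poly_Mapping.lookup P \<alpha>))\<^sup>2)"
    by (simp add: fock_def mult.assoc complex_norm_square del: of_real_power)
  hence "(\<Sum>\<alpha>\<in>Poly_Mapping.keys P. mfact \<alpha> * (cmod (Poly_Mapping.lookup P \<alpha>))\<^sup>2) = 0"
    using assms by (metis of_real_eq_0_iff)
  hence "\<forall>\<alpha>\<in>Poly_Mapping.keys P. mfact \<alpha> * (cmod (Poly_Mapping.lookup P \<alpha>))\<^sup>2 = 0"
    by (subst (asm) sum_nonneg_eq_0_iff) auto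
  hence "\<alpha> \<notin> Poly_Mapping.keys P" for \<alpha>
    using mfact_pos[of \<alpha>] by (metis in_keys_iff mult_eq_0_iff norm_eq_zero of_nat_eq_0_iff
      less_irrefl power_eq_0_iff)
  hence "Poly_Mapping.keys P = {}" by blast
  thus ?thesis by simp
qed

lemma lookup_Var_mult_add_mset:
  "Poly_Mapping.lookup (Var x * P) (add_mset x \<alpha>) = Poly_Mapping.lookup P \<alpha>"
  by (induction P rule: mpoly_induct)
     (auto simp: Var_def mult_single lookup_single when_def lookup_add distrib_left)

lemma lookup_Var_mult_notin:
  "x \<notin># \<alpha> \<Longrightarrow> Poly_Mapping.lookup (Var x * P) \<alpha> = 0"
  by (induction P rule: mpoly_induct)
     (auto simp: Var_def mult_single lookup_single when_def lookup_add distrib_left)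

text \<open>On monomials this is the recursion of \<open>mfact\<close>: adding a variable multiplies the squared length by
  the new exponent, and that exponent is also the factor produced by the derivative.\<close>

lemma fock_Var_mult: "fock (Var x * P) Q = fock P (pd x Q)"
proof -
  let ?K = "Poly_Mapping.keys P"
  have keys: "Poly_Mapping.keys (Var x * P) \<subseteq> add_mset x ` ?K"
  proof
    fix \<alpha> assume "\<alpha> \<in> Poly_Mapping.keys (Var x * P)"
    hence ne: "Poly_Mapping.lookup (Var x * P) \<alpha> \<noteq> 0" by (simp add: in_keys_iff)
    hence "x \<in># \<alpha>" using lookup_Var_mult_notin by metis
    then obtain \<beta> where "\<alpha> = add_mset x \<beta>" by (metis multi_member_split)
    with ne show "\<alpha> \<in> add_mset x ` ?K"
      by (auto simp: lookup_Var_mult_add_mset in_keys_iff)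
  qed
  have "fock (Var x * P) Q = (\<Sum>\<alpha>\<in>add_mset x ` ?K. of_nat (mfact \<alpha>) *
     Poly_Mapping.lookup (Var x * P) \<alpha> * cnj (Poly_Mapping.lookup Q \<alpha>))"
    using keys by (intro fock_superset) auto
  also have "\<dots> = (\<Sum>\<alpha>\<in>?K. of_nat (mfact (add_mset x \<alpha>)) *
     Poly_Mapping.lookup P \<alpha> * cnj (Poly_Mapping.lookup Q (add_mset x \<alpha>)))"
    by (subst sum.reindex) (auto simp: inj_on_def lookup_Var_mult_add_mset)
  also have "\<dots> = fock P (pd x Q)"
    unfolding fock_def by (intro sum.cong) (auto simp: lookup_pd mfact_add_mset algebra_simps)
  finally show ?thesis .
qed

lemma fock_sym: "fock Q P = cnj (fock P Q)"
  by (simp add: fock_superset[of "Poly_Mapping.keys P"] mult_ac)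

lemma fock_pd: "fock (pd x P) Q = fock P (Var x * Q)"
  by (metis fock_Var_mult fock_sym)

section \<open>Modules over the special linear Lie algebra\<close>

definition munit :: "nat \<Rightarrow> nat \<Rightarrow> nat \<Rightarrow> complex mat" where
  "munit n i j = mat (n + 1) (n + 1) (\<lambda>(a, b). if a = i \<and> b = j then 1 else 0)"

lemma munit_carrier: "munit n i j \<in> carrier_mat (n + 1) (n + 1)"
  by (simp add: munit_def)

lemmas munit_carrier' [simp] = munit_carrier[simplified]

lemma munit_dim [simp]: "dim_row (munit n i j) = Suc n" "dim_col (munit n i j) = Suc n"
  by (simp_all add: munit_def)

lemma munit_index [simp]:
  "a \<le> n \<Longrightarrow> b \<le> n \<Longrightarrow> munit n i j $$ (a, b) = (if a = i \<and> b = j then 1 else 0)"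
  by (simp add: munit_def)

lemma munit_sl: "i \<noteq> j \<Longrightarrow> munit n i j \<in> sl n"
  by (auto simp: sl_def intro!: sum.neutral simp del: sum.lessThan_Suc)

lemma sl_carrier: "X \<in> sl n \<Longrightarrow> X \<in> carrier_mat (n + 1) (n + 1)"
  by (simp add: sl_def)

lemma sl_smult: "X \<in> sl n \<Longrightarrow> c \<cdot>\<^sub>m X \<in> sl n"
proof -
  assume X: "X \<in> sl n"
  hence "(\<Sum>i<n + 1. (c \<cdot>\<^sub>m X) $$ (i, i)) = c * (\<Sum>i<n + 1. X $$ (i, i))"
    unfolding sum_distrib_left by (intro sum.cong) (auto simp: sl_def)
  with X show ?thesis by (simp add: sl_def)
qed

lemma index_mult_sum:
  fixes X Y :: "'a::semiring_0 mat"
  assumes "X \<in> carrier_mat m m" "Y \<in> carrier_mat m m" "a < m" "b < m"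
  shows "(X * Y) $$ (a, b) = (\<Sum>l<m. X $$ (a, l) * Y $$ (l, b))"
  using assms by (auto simp: scalar_prod_def atLeast0LessThan intro!: sum.cong)

lemma bracket_carrier:
  "X \<in> carrier_mat m m \<Longrightarrow> Y \<in> carrier_mat m m \<Longrightarrow> bracket X Y \<in> carrier_mat m m"
  by (auto simp: bracket_def intro!: minus_carrier_mat mult_carrier_mat)

lemma bracket_index:
  assumes "X \<in> carrier_mat m m" "Y \<in> carrier_mat m m" "a < m" "b < m"
  shows "bracket X Y $$ (a, b) =
    (\<Sum>l<m. X $$ (a, l) * Y $$ (l, b)) - (\<Sum>l<m. Y $$ (a, l) * X $$ (l, b))"
  unfolding bracket_def using assms
  by (subst index_minus_mat(1)) (auto simp del: index_mult_mat(1) simp: index_mult_sum)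

lemma sl_bracket:
  assumes X: "X \<in> sl n" and Y: "Y \<in> sl n"
  shows "bracket X Y \<in> sl n"
proof -
  note c = sl_carrier[OF X] sl_carrier[OF Y]
  have "(\<Sum>i<n + 1. bracket X Y $$ (i, i)) =
    (\<Sum>i<n + 1. \<Sum>l<n + 1. X $$ (i, l) * Y $$ (l, i)) - (\<Sum>i<n + 1. \<Sum>l<n + 1. Y $$ (i, l) * X $$ (l, i))"
    unfolding sum_subtractf[symmetric]
    by (intro sum.cong refl) (simp only: bracket_index[OF c] lessThan_iff sum_subtractf)
  also have "(\<Sum>i<n + 1. \<Sum>l<n + 1. X $$ (i, l) * Y $$ (l, i)) = (\<Sum>i<n + 1. \<Sum>l<n + 1. Y $$ (i, l) * X $$ (l, i))"
    by (subst sum.swap) (simp add: mult.commute)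
  finally show ?thesis
    using bracket_carrier[OF c] by (simp add: sl_def)
qed

lemma bracket_munit:
  assumes "i \<le> n" "j \<le> n" "k \<le> n" "l \<le> n"
  shows "bracket (munit n i j) (munit n k l) =
    (if j = k then munit n i l else 0\<^sub>m (n + 1) (n + 1)) -
    (if l = i then munit n k j else 0\<^sub>m (n + 1) (n + 1))"
proof (rule eq_matI)
  fix a b assume "a < dim_row ((if j = k then munit n i l else 0\<^sub>m (n + 1) (n + 1)) -
    (if l = i then munit n k j else 0\<^sub>m (n + 1) (n + 1)))" "b < dim_col ((if j = k then munit n i l else 0\<^sub>m (n + 1) (n + 1)) -
    (if l = i then munit n k j else 0\<^sub>m (n + 1) (n + 1)))"
  hence ab: "a < n + 1" "b < n + 1" by (auto split: if_splits)
  have entry: "((if P then munit n i l else 0\<^sub>m (n + 1) (n + 1)) -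
    (if Q then munit n k j else 0\<^sub>m (n + 1) (n + 1))) $$ (a, b) =
    (if P then munit n i l $$ (a, b) else 0) - (if Q then munit n k j $$ (a, b) else 0)" for P Q
    using ab by (subst index_minus_mat(1)) auto
  have 1: "(\<Sum>m<n + 1. munit n i j $$ (a, m) * munit n k l $$ (m, b)) =
    (if a = i \<and> b = l \<and> j = k then 1 else 0)" if "j \<le> n" for i j k l
  proof -
    have "(\<Sum>m<n + 1. munit n i j $$ (a, m) * munit n k l $$ (m, b)) =
      (\<Sum>m<n + 1. if m = j then (if a = i \<and> b = l \<and> j = k then 1 else 0) else 0)"
      using ab by (intro sum.cong) auto
    thus ?thesis using that by simp
  qed
  show "bracket (munit n i j) (munit n k l) $$ (a, b) =
    ((if j = k then munit n i l else 0\<^sub>m (n + 1) (n + 1)) -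
    (if l = i then munit n k j else 0\<^sub>m (n + 1) (n + 1))) $$ (a, b)"
    unfolding bracket_index[OF munit_carrier munit_carrier ab] 1[OF assms(2)] 1[OF assms(4)] entry
    using ab by auto
qed (auto simp: munit_def bracket_def)

lemma bracket_diagonal_munit:
  assumes h: "h \<in> cartan n" and "i \<le> n" "j \<le> n"
  shows "bracket h (munit n i j) = (h $$ (i, i) - h $$ (j, j)) \<cdot>\<^sub>m munit n i j"
proof (intro eq_matI)
  have hc: "h \<in> carrier_mat (n + 1) (n + 1)" and hd: "diagonal_mat h"
    using h by (auto simp: cartan_def sl_def)
  fix a b assume "a < dim_row ((h $$ (i, i) - h $$ (j, j)) \<cdot>\<^sub>m munit n i j)"
    "b < dim_col ((h $$ (i, i) - h $$ (j, j)) \<cdot>\<^sub>m munit n i j)"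
  hence ab: "a < n + 1" "b < n + 1" by (auto simp: munit_def)
  have h0: "h $$ (x, y) = 0" if "x < n + 1" "y < n + 1" "x \<noteq> y" for x y
    using hd hc that by (auto simp: diagonal_mat_def)
  have 1: "(\<Sum>m<n + 1. h $$ (a, m) * munit n i j $$ (m, b)) =
    (\<Sum>m<n + 1. if m = a then h $$ (a, a) * munit n i j $$ (a, b) else 0)"
    using ab h0 by (intro sum.cong) auto
  have 2: "(\<Sum>m<n + 1. munit n i j $$ (a, m) * h $$ (m, b)) =
    (\<Sum>m<n + 1. if m = b then h $$ (b, b) * munit n i j $$ (a, b) else 0)"
    using ab h0 by (intro sum.cong) auto
  show "bracket h (munit n i j) $$ (a, b) = ((h $$ (i, i) - h $$ (j, j)) \<cdot>\<^sub>m munit n i j) $$ (a, b)"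
    unfolding bracket_index[OF hc munit_carrier ab] 1 2
    using ab by (auto simp: munit_def)
qed (use h in \<open>auto simp: cartan_def sl_def munit_def bracket_def\<close>)

lemma munit_root_space:
  assumes "i \<le> n" "j \<le> n" "i \<noteq> j"
  shows "munit n i j \<in> root_space n (eps n (i + 1) - eps n (j + 1))"
  using assms by (auto simp: root_space_def munit_sl bracket_diagonal_munit eps_def)

text \<open>A word is a product of matrix units in the enveloping algebra, applied from right to left; in a
  lower word all letters are strictly lower triangular. Matrix units suffice as letters since the
  bracket of two of them is again a matrix unit up to sign, or zero.\<close>

definition word_act :: "nat \<Rightarrow> (complex mat \<Rightarrow> 'v \<Rightarrow> 'v) \<Rightarrow> (nat \<times> nat) list \<Rightarrow> 'v \<Rightarrow> 'v" where
  "word_act n \<rho> ws x = foldr (\<lambda>(i, j). \<rho> (munit n i j)) ws x"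

definition lower_word :: "nat \<Rightarrow> (nat \<times> nat) list \<Rightarrow> bool" where
  "lower_word n ws \<longleftrightarrow> (\<forall>(i, j)\<in>set ws. j < i \<and> i \<le> n)"

lemma word_act_simps [simp]:
  "word_act n \<rho> [] x = x"
  "word_act n \<rho> ((i, j) # ws) x = \<rho> (munit n i j) (word_act n \<rho> ws x)"
  "word_act n \<rho> (ws @ us) x = word_act n \<rho> ws (word_act n \<rho> us x)"
  by (simp_all add: word_act_def)

lemma lower_word_simps [simp]:
  "lower_word n []"
  "lower_word n ((i, j) # ws) \<longleftrightarrow> j < i \<and> i \<le> n \<and> lower_word n ws"
  "lower_word n (ws @ us) \<longleftrightarrow> lower_word n ws \<and> lower_word n us"
  by (auto simp: lower_word_def)

locale sl_mod =
  fixes n :: nat and scale :: "complex \<Rightarrow> 'v::ab_group_add \<Rightarrow> 'v"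
    and V :: "'v set" and \<rho> :: "complex mat \<Rightarrow> 'v \<Rightarrow> 'v"
  assumes vector_space_scale: "vector_space scale" and sl_module: "sl_module n scale V \<rho>"
begin

sublocale vs: vector_space scale
  by (rule vector_space_scale)

lemma subspace_V: "vs.subspace V"
  using sl_module by (simp add: sl_module_def)

lemma act_closed: "X \<in> sl n \<Longrightarrow> x \<in> V \<Longrightarrow> \<rho> X x \<in> V"
  and act_add: "X \<in> sl n \<Longrightarrow> x \<in> V \<Longrightarrow> y \<in> V \<Longrightarrow> \<rho> X (x + y) = \<rho> X x + \<rho> X y"
  and act_scale: "X \<in> sl n \<Longrightarrow> x \<in> V \<Longrightarrow> \<rho> X (scale c x) = scale c (\<rho> X x)"
  and act_add_mat: "X \<in> sl n \<Longrightarrow> Y \<in> sl n \<Longrightarrow> x \<in> V \<Longrightarrow> \<rho> (X + Y) x = \<rho> X x + \<rho> Y x"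
  and act_smult_mat: "X \<in> sl n \<Longrightarrow> x \<in> V \<Longrightarrow> \<rho> (c \<cdot>\<^sub>m X) x = scale c (\<rho> X x)"
  and act_bracket: "X \<in> sl n \<Longrightarrow> Y \<in> sl n \<Longrightarrow> x \<in> V \<Longrightarrow> \<rho> (bracket X Y) x = \<rho> X (\<rho> Y x) - \<rho> Y (\<rho> X x)"
  using sl_module by (simp_all add: sl_module_def)

lemma zero_V: "0 \<in> V"
  using subspace_V by (rule vs.subspace_0)

lemma act_0: "X \<in> sl n \<Longrightarrow> \<rho> X 0 = 0"
  using act_scale[of X 0 0] zero_V by simp

lemma act_zero_mat: "x \<in> V \<Longrightarrow> \<rho> (0\<^sub>m (n + 1) (n + 1)) x = 0"
proof -
  assume x: "x \<in> V"
  have z: "0\<^sub>m (n + 1) (n + 1) \<in> sl n" by (simp add: sl_def)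
  have "0 \<cdot>\<^sub>m 0\<^sub>m (n + 1) (n + 1) = (0\<^sub>m (n + 1) (n + 1) :: complex mat)" by auto
  thus ?thesis using act_smult_mat[OF z x, of 0] by simp
qed

lemma word_act_closed: "lower_word n ws \<Longrightarrow> x \<in> V \<Longrightarrow> word_act n \<rho> ws x \<in> V"
  by (induction ws) (auto intro!: act_closed munit_sl)

lemma word_act_0: "lower_word n ws \<Longrightarrow> word_act n \<rho> ws 0 = 0"
  by (induction ws) (auto simp: act_0 munit_sl)

lemma word_act_add:
  "lower_word n ws \<Longrightarrow> x \<in> V \<Longrightarrow> y \<in> V \<Longrightarrow>
     word_act n \<rho> ws (x + y) = word_act n \<rho> ws x + word_act n \<rho> ws y"
  by (induction ws) (auto simp: act_add munit_sl word_act_closed)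

lemma word_act_scale:
  "lower_word n ws \<Longrightarrow> x \<in> V \<Longrightarrow> word_act n \<rho> ws (scale c x) = scale c (word_act n \<rho> ws x)"
  by (induction ws) (auto simp: act_scale munit_sl word_act_closed)

text \<open>Every traceless matrix is its diagonal part plus a combination of off-diagonal units, so that a
  property of \<open>\<rho> X x\<close> that defines a subspace can be checked on the units that occur in \<open>X\<close>. The
  diagonal part is kept in one piece because highest weight vectors are eigenvectors for it.\<close>

lemma act_mem_of_units:
  assumes X: "X \<in> sl n" and x: "x \<in> V" and W: "vs.subspace W"
    and off: "\<And>i j. i \<le> n \<Longrightarrow> j \<le> n \<Longrightarrow> i \<noteq> j \<Longrightarrow> X $$ (i, j) \<noteq> 0 \<Longrightarrow> \<rho> (munit n i j) x \<in> W"
    and diag: "\<rho> (mat (n + 1) (n + 1) (\<lambda>(a, b). if a = b then X $$ (a, b) else 0)) x \<in> W"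
  shows "\<rho> X x \<in> W"
proof -
  define R where "R S = mat (n + 1) (n + 1) (\<lambda>(a, b). if a = b \<or> (a, b) \<in> S then X $$ (a, b) else 0)" for S
  have R_sl: "R S \<in> sl n" for S
    using X by (simp add: R_def sl_def)
  let ?O = "{(i, j). i \<le> n \<and> j \<le> n \<and> i \<noteq> j}"
  have fin: "finite ?O"
    by (rule finite_subset[of _ "{..n} \<times> {..n}"]) auto
  have "\<rho> (R S) x \<in> W" if "finite S" "S \<subseteq> ?O" for S
    using that
  proof (induction S)
    case empty
    show ?case using diag by (simp add: R_def)
  next
    case (insert p S)
    obtain i j where p: "p = (i, j)" by fastforce
    with insert have ij: "i \<le> n" "j \<le> n" "i \<noteq> j" by auto
    have "R (insert p S) = R S + X $$ (i, j) \<cdot>\<^sub>m munit n i j"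
      using insert p ij by (intro eq_matI) (auto simp: R_def munit_def)
    hence "\<rho> (R (insert p S)) x = \<rho> (R S) x + scale (X $$ (i, j)) (\<rho> (munit n i j) x)"
      using act_add_mat[OF R_sl sl_smult[OF munit_sl[OF ij(3)]] x]
        act_smult_mat[OF munit_sl[OF ij(3)] x] by simp
    moreover have "scale (X $$ (i, j)) (\<rho> (munit n i j) x) \<in> W"
    proof (cases "X $$ (i, j) = 0")
      case True
      thus ?thesis using vs.subspace_0[OF W] by simp
    next
      case False
      thus ?thesis using off ij vs.subspace_scale[OF W] by blast
    qed
    ultimately show ?case
      using insert vs.subspace_add[OF W] by auto
  qed
  from this[OF fin] have "\<rho> (R ?O) x \<in> W" by simp
  moreover have "R ?O = X"
    using sl_carrier[OF X] by (intro eq_matI) (auto simp: R_def)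
  ultimately show ?thesis by simp
qed

lemma act_span_mem:
  assumes X: "X \<in> sl n" and W: "vs.subspace W" and S: "S \<subseteq> V" "\<And>s. s \<in> S \<Longrightarrow> \<rho> X s \<in> W"
    and x: "x \<in> vs.span S"
  shows "\<rho> X x \<in> W"
proof -
  have "vs.subspace {x \<in> V. \<rho> X x \<in> W}"
    using subspace_V W X
    by (auto simp: vs.subspace_def act_add act_scale act_0)
  hence "vs.span S \<subseteq> {x \<in> V. \<rho> X x \<in> W}"
    using S by (intro vs.span_minimal) auto
  with x show ?thesis by auto
qed

end

locale hw_mod = sl_mod n scale V \<rho>
  for n :: nat and scale :: "complex \<Rightarrow> 'v::ab_group_add \<Rightarrow> 'v" and V :: "'v set"
    and \<rho> :: "complex mat \<Rightarrow> 'v \<Rightarrow> 'v" +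
  fixes \<Lambda> :: weight and v :: 'v
  assumes hw: "highest_weight_vector n scale V \<rho> \<Lambda> v"
begin

lemma hw_V: "v \<in> V" and hw_nonzero: "v \<noteq> 0"
  and hw_cartan: "h \<in> cartan n \<Longrightarrow> \<rho> h v = scale (\<Lambda> h) v"
  using hw by (auto simp: highest_weight_vector_def)

lemma hw_raise: "i < j \<Longrightarrow> j \<le> n \<Longrightarrow> \<rho> (munit n i j) v = 0"
proof -
  assume ij: "i < j" "j \<le> n"
  have "eps n (i + 1) - eps n (j + 1) \<in> pos_roots n"
    unfolding pos_roots_def using ij
    by (intro CollectI exI[of _ "i + 1"] exI[of _ "j + 1"]) auto
  moreover have "munit n i j \<in> root_space n (eps n (i + 1) - eps n (j + 1))"
    using ij by (intro munit_root_space) auto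
  ultimately show ?thesis using hw unfolding highest_weight_vector_def by blast
qed

definition words :: "'v set" where
  "words = {word_act n \<rho> ws v | ws. lower_word n ws}"

lemma words_V: "words \<subseteq> V"
  by (auto simp: words_def intro!: word_act_closed hw_V)

lemma span_words_V: "vs.span words \<subseteq> V"
  using words_V subspace_V by (rule vs.span_minimal)

text \<open>Straightening: an operator is commuted past the letters of the word until it reaches the highest
  weight vector, where raising operators vanish and diagonal ones are scalars. The induction is over
  all \<open>X\<close> at once, as the commutator with a letter is applied to the shorter word.\<close>

lemma act_word_span:
  "lower_word n ws \<Longrightarrow> X \<in> sl n \<Longrightarrow> \<rho> X (word_act n \<rho> ws v) \<in> vs.span words"
proof (induction ws arbitrary: X)
  case Nil
  let ?D = "mat (n + 1) (n + 1) (\<lambda>(a, b). if a = b then X $$ (a, b) else 0)"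
  have D: "?D \<in> cartan n"
    using Nil by (auto simp: cartan_def sl_def diagonal_mat_def)
  have v: "v \<in> words"
    unfolding words_def by (intro CollectI exI[of _ "[]"]) simp
  have "\<rho> (munit n i j) v \<in> vs.span words" if "i \<le> n" "j \<le> n" "i \<noteq> j" for i j
  proof (cases "i < j")
    case True
    thus ?thesis using hw_raise that vs.span_zero by simp
  next
    case False
    hence "\<rho> (munit n i j) v \<in> words"
      unfolding words_def using that by (intro CollectI exI[of _ "[(i, j)]"]) auto
    thus ?thesis by (rule vs.span_base)
  qed
  moreover have "\<rho> ?D v \<in> vs.span words"
    unfolding hw_cartan[OF D] by (intro vs.span_scale vs.span_base v)
  ultimately show ?case
    unfolding word_act_simps by (intro act_mem_of_units[OF Nil(2) hw_V vs.subspace_span])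
next
  case (Cons p ws)
  obtain i j where p: "p = (i, j)" by fastforce
  with Cons have ij: "j < i" "i \<le> n" and ws: "lower_word n ws" by auto
  let ?U = "munit n i j" and ?w = "word_act n \<rho> ws v"
  have U: "?U \<in> sl n" using ij by (intro munit_sl) auto
  have w: "?w \<in> V" using ws by (intro word_act_closed hw_V)
  have "\<rho> X (\<rho> ?U ?w) = \<rho> ?U (\<rho> X ?w) + \<rho> (bracket X ?U) ?w"
    using act_bracket[OF Cons.prems(2) U w] by simp
  moreover have "\<rho> (bracket X ?U) ?w \<in> vs.span words"
    using Cons.IH[OF ws] sl_bracket Cons.prems U by blast
  moreover have "\<rho> ?U (\<rho> X ?w) \<in> vs.span words"
  proof (rule act_span_mem[OF U vs.subspace_span words_V])
    show "\<rho> X ?w \<in> vs.span words" using Cons.IH[OF ws] Cons.prems by blast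
    fix s assume "s \<in> words"
    then obtain us where us: "s = word_act n \<rho> us v" "lower_word n us" by (auto simp: words_def)
    hence "\<rho> ?U s \<in> words"
      unfolding words_def using ij by (intro CollectI exI[of _ "(i, j) # us"]) auto
    thus "\<rho> ?U s \<in> vs.span words" by (rule vs.span_base)
  qed
  ultimately show ?case using vs.span_add p by auto
qed

lemma act_span_words:
  assumes "X \<in> sl n" "x \<in> vs.span words"
  shows "\<rho> X x \<in> vs.span words"
  using act_span_mem[OF assms(1) vs.subspace_span words_V _ assms(2)] act_word_span assms(1)
  by (auto simp: words_def)

lemma span_words_eq_V:
  assumes "irreducible_module n scale V \<rho>"
  shows "vs.span words = V"
proof -
  have "v \<in> words"
    unfolding words_def by (intro CollectI exI[of _ "[]"]) simp
  hence "vs.span words \<noteq> {0}" using hw_nonzero vs.span_base by blast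
  thus ?thesis
    using assms act_span_words span_words_V vs.subspace_span
    unfolding irreducible_module_def by blast
qed

text \<open>The element for which all simple roots take the value \<open>1\<close>. It acts on a lower word by a
  scalar which depends on the depth of the word only, and so separates \<open>v\<close> from all nonempty words.\<close>

definition grading :: "complex mat" where
  "grading = mat (n + 1) (n + 1) (\<lambda>(a, b). if a = b then of_nat n / 2 - of_nat a else 0)"

lemma grading_cartan: "grading \<in> cartan n"
proof -
  have "(\<Sum>i<m + 1. of_nat m / 2 - of_nat i) = (0::complex)" for m
  proof -
    have "(\<Sum>i<m + 1. of_nat i) = (of_nat m * (of_nat m + 1) / 2 :: complex)"
      by (induction m) (auto simp: field_simps)
    thus ?thesis unfolding sum_subtractf by simp
  qed
  thus ?thesis by (auto simp: cartan_def sl_def grading_def diagonal_mat_def)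
qed

definition depth :: "(nat \<times> nat) list \<Rightarrow> nat" where
  "depth ws = (\<Sum>(i, j)\<leftarrow>ws. i - j)"

lemma act_grading_word:
  "lower_word n ws \<Longrightarrow>
    \<rho> grading (word_act n \<rho> ws v) = scale (\<Lambda> grading - of_nat (depth ws)) (word_act n \<rho> ws v)"
proof (induction ws)
  case Nil
  show ?case by (simp add: depth_def hw_cartan grading_cartan)
next
  case (Cons p ws)
  obtain i j where p: "p = (i, j)" by fastforce
  with Cons have ij: "j < i" "i \<le> n" and ws: "lower_word n ws" by auto
  let ?U = "munit n i j" and ?w = "word_act n \<rho> ws v"
  have U: "?U \<in> sl n" using ij by (intro munit_sl) auto
  have G: "grading \<in> sl n" using grading_cartan by (simp add: cartan_def)
  have w: "?w \<in> V" using ws by (intro word_act_closed hw_V)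
  have "bracket grading ?U = (of_nat j - of_nat i) \<cdot>\<^sub>m ?U"
    using bracket_diagonal_munit[OF grading_cartan] ij by (simp add: grading_def)
  hence "\<rho> grading (\<rho> ?U ?w) = \<rho> ?U (\<rho> grading ?w) + scale (of_nat j - of_nat i) (\<rho> ?U ?w)"
    using act_bracket[OF G U w] act_smult_mat[OF U w] by (simp add: algebra_simps)
  also have "\<dots> = scale (\<Lambda> grading - of_nat (depth ws) + (of_nat j - of_nat i)) (\<rho> ?U ?w)"
    using Cons.IH[OF ws] act_scale[OF U w] by (simp add: vs.scale_left_distrib)
  also have "\<Lambda> grading - of_nat (depth ws) + (of_nat j - of_nat i) = \<Lambda> grading - of_nat (depth (p # ws))"
    using ij p by (simp add: depth_def of_nat_diff)
  finally show ?case by (simp add: p)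
qed

text \<open>The product of the operators \<open>grading - (\<Lambda> grading - k)\<close> for \<open>k = 1, \<dots>, K\<close>. It annihilates the
  words of depth \<open>1, \<dots>, K\<close> and multiplies the highest weight vector by \<open>K!\<close>.\<close>

primrec strip :: "nat \<Rightarrow> 'v \<Rightarrow> 'v" where
  "strip 0 x = x"
| "strip (Suc K) x = \<rho> grading (strip K x) - scale (\<Lambda> grading - of_nat (Suc K)) (strip K x)"

lemma grading_sl: "grading \<in> sl n"
  using grading_cartan by (simp add: cartan_def)

lemma strip_V: "x \<in> V \<Longrightarrow> strip K x \<in> V"
  by (induction K) (auto intro!: vs.subspace_diff[OF subspace_V] vs.subspace_scale[OF subspace_V]
      act_closed grading_sl)

lemma strip_add: "x \<in> V \<Longrightarrow> y \<in> V \<Longrightarrow> strip K (x + y) = strip K x + strip K y"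
  by (induction K) (auto simp: strip_V act_add grading_sl vs.scale_right_distrib)

lemma strip_scale: "x \<in> V \<Longrightarrow> strip K (scale c x) = scale c (strip K x)"
proof (induction K)
  case (Suc K)
  thus ?case
    using act_scale[OF grading_sl strip_V[of x K]] vs.scale_left_commute
    by (simp only: strip.simps vs.scale_right_diff_distrib)
qed simp

lemma strip_eigen:
  assumes x: "x \<in> V" and eig: "\<rho> grading x = scale (\<Lambda> grading - of_nat k) x"
  shows "strip K x = scale (\<Prod>i=1..K. of_nat i - of_nat k) x"
proof (induction K)
  case (Suc K)
  let ?p = "\<Prod>i=1..K. of_nat i - of_nat k :: complex"
  have "strip (Suc K) x = scale ?p (\<rho> grading x) - scale (\<Lambda> grading - of_nat (Suc K)) (scale ?p x)"
    using Suc x by (simp add: act_scale grading_sl)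
  also have "\<dots> = scale (?p * (\<Lambda> grading - of_nat k) - (\<Lambda> grading - of_nat (Suc K)) * ?p) x"
    unfolding eig vs.scale_scale by (rule vs.scale_left_diff_distrib[symmetric])
  also have "?p * (\<Lambda> grading - of_nat k) - (\<Lambda> grading - of_nat (Suc K)) * ?p = (\<Prod>i=1..Suc K. of_nat i - of_nat k)"
    by (simp add: algebra_simps)
  finally show ?case .
qed simp

text \<open>A substitute for the sum of all weight spaces below \<open>\<Lambda>\<close> that avoids a decomposition into
  eigenvectors.\<close>

definition deep :: "'v set" where
  "deep = {x \<in> V. \<exists>K. \<forall>K'\<ge>K. strip K' x = 0}"

lemma subspace_deep: "vs.subspace deep"
proof (rule vs.subspaceI)
  have "strip K 0 = 0" for K
    using strip_scale[of 0 K 0] zero_V by simp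
  thus "0 \<in> deep" by (auto simp: deep_def zero_V)
  show "x + y \<in> deep" if "x \<in> deep" "y \<in> deep" for x y
  proof -
    from that obtain K L where "\<forall>K'\<ge>K. strip K' x = 0" "\<forall>K'\<ge>L. strip K' y = 0"
      by (auto simp: deep_def)
    hence "\<forall>K'\<ge>max K L. strip K' (x + y) = 0"
      using that by (auto simp: strip_add deep_def)
    hence "\<exists>K. \<forall>K'\<ge>K. strip K' (x + y) = 0" by blast
    moreover have "x + y \<in> V" using that vs.subspace_add[OF subspace_V] by (auto simp: deep_def)
    ultimately show ?thesis by (simp add: deep_def)
  qed
  show "scale c x \<in> deep" if "x \<in> deep" for c x
    using that vs.subspace_scale[OF subspace_V] by (auto simp: deep_def strip_scale)
qed

lemma word_deep:
  assumes "lower_word n ws" "ws \<noteq> []"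
  shows "word_act n \<rho> ws v \<in> deep"
proof -
  let ?w = "word_act n \<rho> ws v"
  have w: "?w \<in> V" using assms by (intro word_act_closed hw_V)
  have "depth ws \<ge> 1"
    using assms by (cases ws) (auto simp: depth_def)
  hence "(\<Prod>i=1..K. of_nat i - of_nat (depth ws)) = (0::complex)" if "K \<ge> depth ws" for K
    using that by (intro prod_zero bexI[of _ "depth ws"]) auto
  hence "strip K ?w = 0" if "K \<ge> depth ws" for K
    using that strip_eigen[OF w act_grading_word[OF assms(1)]] by simp
  thus ?thesis using w by (auto simp: deep_def)
qed

lemma hw_not_deep:
  assumes "scale b v \<in> deep"
  shows "b = 0"
proof -
  from assms obtain K where "strip K (scale b v) = 0" by (auto simp: deep_def)
  moreover have "strip K v = scale (\<Prod>i=1..K. of_nat i - of_nat 0) v"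
    by (rule strip_eigen) (simp_all add: hw_V hw_cartan grading_cartan)
  ultimately have "scale (b * (\<Prod>i=1..K. of_nat i)) v = 0"
    using strip_scale[OF hw_V] by simp
  thus ?thesis using hw_nonzero by simp
qed

end

section \<open>The action by derivations on polynomials in matrix entries\<close>

text \<open>The variable \<open>(r, l)\<close> is the matrix entry in row \<open>r \<le> n\<close> and column \<open>l < n\<close>. A matrix acts on the
  polynomials by the derivation that is determined by its action on the columns; \<open>gl_var\<close> is the
  image of a variable.\<close>

definition gl_var :: "nat \<Rightarrow> complex mat \<Rightarrow> nat \<times> nat \<Rightarrow> (nat \<times> nat) mpoly" where
  "gl_var n X b = (\<Sum>i\<le>n. Const (X $$ (i, fst b)) * Var (i, snd b))"

definition gl_act :: "nat \<Rightarrow> complex mat \<Rightarrow> (nat \<times> nat) mpoly \<Rightarrow> (nat \<times> nat) mpoly" where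
  "gl_act n X P = (\<Sum>b\<in>{..n} \<times> {..<n}. gl_var n X b * pd b P)"

lemma gl_act_add: "gl_act n X (P + Q) = gl_act n X P + gl_act n X Q"
  by (simp add: gl_act_def pd_add algebra_simps sum.distrib)

lemma gl_act_Const_mult: "gl_act n X (Const c * P) = Const c * gl_act n X P"
  unfolding gl_act_def sum_distrib_left
  by (intro sum.cong) (simp_all add: pd_Const_mult mult.left_commute)

lemma gl_act_0 [simp]: "gl_act n X 0 = 0"
  by (simp add: gl_act_def)

lemma gl_act_sum: "gl_act n X (sum f A) = (\<Sum>x\<in>A. gl_act n X (f x))"
  by (induction A rule: infinite_finite_induct) (auto simp: gl_act_add)

lemma gl_act_mult: "gl_act n X (P * Q) = gl_act n X P * Q + P * gl_act n X Q"
  by (simp add: gl_act_def pd_mult algebra_simps sum.distrib sum_distrib_left)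

lemma pd_1 [simp]: "pd x 1 = 0"
  using pd_mult[of x 1 1] by simp

lemma gl_act_1 [simp]: "gl_act n X 1 = 0"
  by (simp add: gl_act_def)

lemma gl_act_uminus: "gl_act n X (- P) = - gl_act n X P"
  using gl_act_add[of n X P "-P"] by (simp add: minus_unique)

lemma gl_act_Var: "fst b \<le> n \<Longrightarrow> snd b < n \<Longrightarrow> gl_act n X (Var b) = gl_var n X b"
  unfolding gl_act_def by (subst sum.remove[of _ b]) (auto simp: pd_Var mem_Times_iff intro!: sum.neutral)

lemma gl_var_add:
  assumes "X \<in> carrier_mat (n + 1) (n + 1)" "Y \<in> carrier_mat (n + 1) (n + 1)" "fst b \<le> n"
  shows "gl_var n (X + Y) b = gl_var n X b + gl_var n Y b"
  unfolding gl_var_def sum.distrib[symmetric] using assms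
  by (intro sum.cong) (auto simp: Const_add algebra_simps)

lemma gl_var_smult:
  assumes "X \<in> carrier_mat (n + 1) (n + 1)" "fst b \<le> n"
  shows "gl_var n (c \<cdot>\<^sub>m X) b = Const c * gl_var n X b"
  unfolding gl_var_def sum_distrib_left using assms
  by (intro sum.cong) (auto simp: Const_mult algebra_simps)

lemma gl_act_gl_var:
  assumes "X \<in> carrier_mat (n + 1) (n + 1)" "Y \<in> carrier_mat (n + 1) (n + 1)"
    and b: "fst b \<le> n" "snd b < n"
  shows "gl_act n X (gl_var n Y b) = gl_var n (X * Y) b"
proof -
  have "gl_act n X (gl_var n Y b) = (\<Sum>i\<le>n. \<Sum>k\<le>n. Const (X $$ (k, i) * Y $$ (i, fst b)) * Var (k, snd b))"
    unfolding gl_var_def gl_act_sum using b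
    by (intro sum.cong refl)
       (simp add: gl_act_Const_mult gl_act_Var gl_var_def sum_distrib_left Const_mult
         mult.assoc mult.left_commute)
  also have "\<dots> = (\<Sum>k\<le>n. Const (\<Sum>i\<le>n. X $$ (k, i) * Y $$ (i, fst b)) * Var (k, snd b))"
    by (subst sum.swap) (simp add: Const_sum sum_distrib_right)
  also have "\<dots> = gl_var n (X * Y) b"
    unfolding gl_var_def using b index_mult_sum[OF assms(1,2)]
    by (intro sum.cong) (auto simp: lessThan_Suc_atMost)
  finally show ?thesis .
qed

text \<open>The composition of two first order operators has a first order part, which belongs to the product
  of the matrices, and a second order part. The latter is symmetric in \<open>X\<close> and \<open>Y\<close>, as partial
  derivatives commute, and so drops out of the commutator.\<close>

lemma gl_act_comp:
  assumes "X \<in> carrier_mat (n + 1) (n + 1)" "Y \<in> carrier_mat (n + 1) (n + 1)"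
  shows "gl_act n X (gl_act n Y P) = gl_act n (X * Y) P +
    (\<Sum>b\<in>{..n} \<times> {..<n}. \<Sum>a\<in>{..n} \<times> {..<n}. gl_var n Y b * gl_var n X a * pd a (pd b P))"
proof -
  have "gl_act n X (gl_act n Y P) =
    (\<Sum>b\<in>{..n} \<times> {..<n}. gl_act n X (gl_var n Y b) * pd b P + gl_var n Y b * gl_act n X (pd b P))"
    by (simp add: gl_act_def[of n Y] gl_act_sum gl_act_mult)
  also have "\<dots> = (\<Sum>b\<in>{..n} \<times> {..<n}. gl_var n (X * Y) b * pd b P) +
    (\<Sum>b\<in>{..n} \<times> {..<n}. gl_var n Y b * gl_act n X (pd b P))"
    unfolding sum.distrib using gl_act_gl_var[OF assms]
    by (intro arg_cong2[of _ _ _ _ "(+)"] sum.cong) auto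
  finally show ?thesis
    by (simp add: gl_act_def sum_distrib_left mult.assoc)
qed

lemma gl_act_add_mat:
  assumes "X \<in> carrier_mat (n + 1) (n + 1)" "Y \<in> carrier_mat (n + 1) (n + 1)"
  shows "gl_act n (X + Y) P = gl_act n X P + gl_act n Y P"
  unfolding gl_act_def sum.distrib[symmetric] using gl_var_add[OF assms]
  by (intro sum.cong) (auto simp: algebra_simps)

lemma gl_act_smult_mat:
  assumes "X \<in> carrier_mat (n + 1) (n + 1)"
  shows "gl_act n (c \<cdot>\<^sub>m X) P = Const c * gl_act n X P"
  unfolding gl_act_def sum_distrib_left using gl_var_smult[OF assms]
  by (intro sum.cong) (auto simp: algebra_simps)

lemma gl_act_bracket:
  assumes X: "X \<in> carrier_mat (n + 1) (n + 1)" and Y: "Y \<in> carrier_mat (n + 1) (n + 1)"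
  shows "gl_act n (bracket X Y) P = gl_act n X (gl_act n Y P) - gl_act n Y (gl_act n X P)"
proof -
  have XY: "X * Y \<in> carrier_mat (n + 1) (n + 1)" "Y * X \<in> carrier_mat (n + 1) (n + 1)"
    using X Y by auto
  have "bracket X Y = X * Y + (-1) \<cdot>\<^sub>m (Y * X)"
    unfolding bracket_def using X Y by (intro eq_matI) auto
  moreover have "Const (-1) = (-1 :: (nat \<times> nat) mpoly)"
    using Const_uminus[of 1] by simp
  ultimately have "gl_act n (bracket X Y) P = gl_act n (X * Y) P - gl_act n (Y * X) P"
    using gl_act_add_mat[OF XY(1) smult_carrier_mat[OF XY(2)]] gl_act_smult_mat[OF XY(2)] by simp
  moreover have "(\<Sum>b\<in>{..n} \<times> {..<n}. \<Sum>a\<in>{..n} \<times> {..<n}. gl_var n Y b * gl_var n X a * pd a (pd b P)) =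
      (\<Sum>b\<in>{..n} \<times> {..<n}. \<Sum>a\<in>{..n} \<times> {..<n}. gl_var n X b * gl_var n Y a * pd a (pd b P))"
    by (subst sum.swap) (intro sum.cong refl, simp add: mult_ac pd_commute)
  ultimately show ?thesis
    unfolding gl_act_comp[OF X Y] gl_act_comp[OF Y X] by simp
qed

lemma vector_space_mpoly: "vector_space (\<lambda>c (P :: 'x mpoly). Const c * P)"
  by unfold_locales (simp_all add: Const_add Const_mult algebra_simps)

lemma sl_mod_mpoly: "sl_mod n (\<lambda>c P. Const c * P) UNIV (gl_act n)"
proof -
  interpret vs: vector_space "\<lambda>c (P :: (nat \<times> nat) mpoly). Const c * P"
    by (rule vector_space_mpoly)
  show ?thesis
    by unfold_locales
       (auto simp: sl_module_def gl_act_add gl_act_Const_mult gl_act_add_mat[OF sl_carrier sl_carrier]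
         gl_act_smult_mat[OF sl_carrier] gl_act_bracket[OF sl_carrier sl_carrier] vs.subspace_UNIV)
qed

lemma gl_act_munit:
  assumes "i \<le> n" "j \<le> n"
  shows "gl_act n (munit n i j) P = (\<Sum>l<n. Var (i, l) * pd (j, l) P)"
proof -
  have var: "gl_var n (munit n i j) b = (if fst b = j then Var (i, snd b) else 0)" if "fst b \<le> n" for b
  proof -
    have "gl_var n (munit n i j) b = (\<Sum>k\<le>n. if k = i then (if fst b = j then Var (i, snd b) else 0) else 0)"
      unfolding gl_var_def using that by (intro sum.cong) auto
    thus ?thesis using assms by simp
  qed
  have "gl_act n (munit n i j) P = (\<Sum>a\<le>n. \<Sum>l<n. gl_var n (munit n i j) (a, l) * pd (a, l) P)"
    by (simp add: gl_act_def sum.cartesian_product)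
  also have "\<dots> = (\<Sum>a\<le>n. if a = j then (\<Sum>l<n. Var (i, l) * pd (j, l) P) else 0)"
    by (intro sum.cong refl) (auto simp: var)
  finally show ?thesis using assms by simp
qed

lemma gl_act_munit_Var:
  assumes "i \<le> n" "j \<le> n" "r \<le> n" "l < n"
  shows "gl_act n (munit n i j) (Var (r, l)) = (if r = j then Var (i, l) else 0)"
proof -
  have "gl_act n (munit n i j) (Var (r, l)) = (\<Sum>l'<n. if l' = l then (if r = j then Var (i, l) else 0) else 0)"
    unfolding gl_act_munit[OF assms(1,2)] by (intro sum.cong) (auto simp: pd_Var)
  thus ?thesis using assms by simp
qed

text \<open>The unit acts as \<open>\<Sum>\<^sub>l z\<^sub>i\<^sub>l \<partial>\<^sub>j\<^sub>l\<close>, and taking adjoints exchanges the variables with the derivatives.\<close>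

lemma fock_munit:
  assumes "i \<le> n" "j \<le> n"
  shows "fock (gl_act n (munit n i j) P) Q = fock P (gl_act n (munit n j i) Q)"
  by (simp add: gl_act_munit assms fock_sum_left fock_sum_right fock_Var_mult fock_pd)

lemma gl_act_eigen_mult:
  assumes "gl_act n X P = Const a * P" "gl_act n X Q = Const b * Q"
  shows "gl_act n X (P * Q) = Const (a + b) * (P * Q)"
  by (simp add: gl_act_mult assms Const_add algebra_simps)

lemma gl_act_eigen_power:
  assumes "gl_act n X P = Const a * P"
  shows "gl_act n X (P ^ m) = Const (of_nat m * a) * P ^ m"
proof (induction m)
  case (Suc m)
  show ?case using gl_act_eigen_mult[OF assms Suc] by (simp add: algebra_simps)
qed simp

lemma gl_act_eigen_prod:
  assumes "\<And>k. k \<in> S \<Longrightarrow> gl_act n X (f k) = Const (a k) * f k"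
  shows "gl_act n X (\<Prod>k\<in>S. f k) = Const (\<Sum>k\<in>S. a k) * (\<Prod>k\<in>S. f k)"
  using assms
  by (induction S rule: infinite_finite_induct) (auto intro!: gl_act_eigen_mult)

lemma gl_act_power_0: "gl_act n X P = 0 \<Longrightarrow> gl_act n X (P ^ m) = 0"
  using gl_act_eigen_power[of n X P 0 m] by simp

lemma gl_act_prod_0: "(\<And>k. k \<in> S \<Longrightarrow> gl_act n X (f k) = 0) \<Longrightarrow> gl_act n X (\<Prod>k\<in>S. f k) = 0"
  using gl_act_eigen_prod[of S n X f "\<lambda>_. 0"] by simp

text \<open>Iterating the Leibniz rule when the derivation takes \<open>P\<close> to \<open>Q\<close> and then to \<open>0\<close>. The product of
  truncated differences is a falling factorial; it vanishes for \<open>p > a\<close>.\<close>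

lemma gl_act_iterate:
  assumes P: "gl_act n X P = Q" "gl_act n X Q = 0" and G: "gl_act n X G = 0"
  shows "(gl_act n X ^^ p) (P ^ a * G) = of_nat (\<Prod>i<p. a - i) * P ^ (a - p) * Q ^ p * G"
proof (induction p)
  case (Suc p)
  have D: "gl_act n X (P ^ m) = of_nat m * P ^ (m - 1) * Q" for m
  proof (induction m)
    case (Suc m)
    thus ?case by (cases m) (auto simp: gl_act_mult P algebra_simps)
  qed simp
  have "(gl_act n X ^^ Suc p) (P ^ a * G) = gl_act n X (Const (of_nat (\<Prod>i<p. a - i)) * (P ^ (a - p) * (Q ^ p * G)))"
    using Suc by (simp add: Const_of_nat mult.assoc del: of_nat_prod)
  also have "\<dots> = of_nat (\<Prod>i<p. a - i) * (of_nat (a - p) * P ^ (a - p - 1) * Q * (Q ^ p * G))"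
    unfolding gl_act_Const_mult
    by (simp add: gl_act_mult D gl_act_power_0 P G Const_of_nat del: of_nat_prod)
  finally show ?case by (simp add: mult_ac)
qed simp

text \<open>The determinant formed from the rows \<open>g 0, \<dots>, g (k - 1)\<close> and the first \<open>k\<close> columns.\<close>

definition minor :: "nat \<Rightarrow> (nat \<Rightarrow> nat) \<Rightarrow> (nat \<times> nat) mpoly" where
  "minor k g = det (mat k k (\<lambda>(a, b). Var (g a, b)))"

lemma minor_sum:
  "minor k g = (\<Sum>p | p permutes {..<k}. signof p * (\<Prod>a<k. Var (g a, p a)))"
  unfolding minor_def det_def atLeast0LessThan
  by (auto intro!: sum.cong prod.cong simp: permutes_in_image[where S = "{..<k}", simplified])

lemma minor_duplicate: "a < k \<Longrightarrow> b < k \<Longrightarrow> a \<noteq> b \<Longrightarrow> g a = g b \<Longrightarrow> minor k g = 0"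
  unfolding minor_def by (rule det_identical_rows[of _ k a b]) (auto simp: row_def)

text \<open>By the Leibniz rule a derivation acts on a determinant row by row.\<close>

lemma gl_act_minor:
  assumes act: "\<And>a b. a < k \<Longrightarrow> b < k \<Longrightarrow> gl_act n X (Var (g a, b)) = Const (q a) * Var (g' a, b)"
  shows "gl_act n X (minor k g) = (\<Sum>a<k. Const (q a) * minor k (g(a := g' a)))"
proof -
  have prod: "gl_act n X (\<Prod>a\<in>S. f a) = (\<Sum>a\<in>S. gl_act n X (f a) * (\<Prod>b\<in>S - {a}. f b))"
    if "finite S" for S and f :: "nat \<Rightarrow> (nat \<times> nat) mpoly"
    using that
  proof (induction S)
    case (insert x S)
    have "(\<Prod>b\<in>insert x S - {a}. f b) = f x * (\<Prod>b\<in>S - {a}. f b)" if "a \<in> S" for a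
    proof -
      have "insert x S - {a} = insert x (S - {a})" using that insert by auto
      thus ?thesis using insert by simp
    qed
    hence "(\<Sum>a\<in>S. gl_act n X (f a) * (\<Prod>b\<in>insert x S - {a}. f b)) =
      f x * (\<Sum>a\<in>S. gl_act n X (f a) * (\<Prod>b\<in>S - {a}. f b))"
      unfolding sum_distrib_left by (intro sum.cong) (simp_all add: mult_ac)
    moreover have "insert x S - {x} = S" using insert by auto
    ultimately show ?case using insert by (simp add: gl_act_mult)
  qed simp
  have sgn: "gl_act n X (signof p * P) = signof p * gl_act n X P" for p :: "nat \<Rightarrow> nat" and P
    by (cases p rule: sign_cases) (simp_all add: gl_act_uminus)
  have "gl_act n X (minor k g) =
    (\<Sum>p | p permutes {..<k}. \<Sum>a<k. Const (q a) * (signof p * (\<Prod>b<k. Var ((g(a := g' a)) b, p b))))"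
    unfolding minor_sum gl_act_sum
  proof (intro sum.cong refl)
    fix p assume p: "p \<in> {p. p permutes {..<k}}"
    have "gl_act n X (signof p * (\<Prod>a<k. Var (g a, p a))) =
      (\<Sum>a<k. signof p * (gl_act n X (Var (g a, p a)) * (\<Prod>b\<in>{..<k} - {a}. Var (g b, p b))))"
      unfolding sgn by (simp add: prod sum_distrib_left)
    also have "\<dots> = (\<Sum>a<k. Const (q a) * (signof p * (\<Prod>b<k. Var ((g(a := g' a)) b, p b))))"
    proof (intro sum.cong refl)
      fix a assume a: "a \<in> {..<k}"
      hence "p a < k" using p permutes_in_image[of p "{..<k}" a] by simp
      hence "gl_act n X (Var (g a, p a)) = Const (q a) * Var (g' a, p a)" using act a by simp
      moreover have "(\<Prod>b<k. Var ((g(a := g' a)) b, p b)) = Var (g' a, p a) * (\<Prod>b\<in>{..<k} - {a}. Var (g b, p b))"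
        using a by (subst prod.remove[of _ a]) (auto intro!: arg_cong2[of _ _ _ _ "(*)"] prod.cong)
      ultimately show "signof p * (gl_act n X (Var (g a, p a)) * (\<Prod>b\<in>{..<k} - {a}. Var (g b, p b))) =
        Const (q a) * (signof p * (\<Prod>b<k. Var ((g(a := g' a)) b, p b)))"
        by (simp add: mult_ac)
    qed
    finally show "gl_act n X (signof p * (\<Prod>a<k. Var (g a, p a))) = \<dots>" .
  qed
  also have "\<dots> = (\<Sum>a<k. Const (q a) * minor k (g(a := g' a)))"
    by (subst sum.swap) (simp add: minor_sum sum_distrib_left)
  finally show ?thesis .
qed

lemma gl_act_munit_minor:
  assumes "i \<le> n" "j \<le> n" "k \<le> n" "\<And>a. a < k \<Longrightarrow> g a \<le> n"
  shows "gl_act n (munit n i j) (minor k g) = (\<Sum>a<k. if g a = j then minor k (g(a := i)) else 0)"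
proof -
  have "gl_act n (munit n i j) (minor k g) =
    (\<Sum>a<k. Const (if g a = j then 1 else 0) * minor k (g(a := (\<lambda>_. i) a)))"
    using assms by (intro gl_act_minor) (auto simp: gl_act_munit_Var)
  also have "\<dots> = (\<Sum>a<k. if g a = j then minor k (g(a := i)) else 0)"
    by (intro sum.cong) auto
  finally show ?thesis .
qed

lemma gl_act_diagonal_minor:
  assumes "\<And>i j. i \<le> n \<Longrightarrow> j \<le> n \<Longrightarrow> i \<noteq> j \<Longrightarrow> X $$ (i, j) = 0" "k \<le> n" "\<And>a. a < k \<Longrightarrow> g a \<le> n"
  shows "gl_act n X (minor k g) = Const (\<Sum>a<k. X $$ (g a, g a)) * minor k g"
proof -
  have "gl_act n X (minor k g) = (\<Sum>a<k. Const (X $$ (g a, g a)) * minor k (g(a := g a)))"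
  proof (rule gl_act_minor)
    fix a b assume ab: "a < k" "b < k"
    have "gl_var n X (g a, b) = (\<Sum>i\<le>n. if i = g a then Const (X $$ (g a, g a)) * Var (g a, b) else 0)"
      unfolding gl_var_def using assms ab by (intro sum.cong) auto
    thus "gl_act n X (Var (g a, b)) = Const (X $$ (g a, g a)) * Var (g a, b)"
      using assms ab by (simp add: gl_act_Var)
  qed
  thus ?thesis by (simp add: Const_sum sum_distrib_right)
qed

definition peval :: "('x \<Rightarrow> complex) \<Rightarrow> 'x mpoly \<Rightarrow> complex" where
  "peval f P = (\<Sum>\<alpha>\<in>Poly_Mapping.keys P. Poly_Mapping.lookup P \<alpha> * (\<Prod>x\<in>#\<alpha>. f x))"

lemma peval_add: "peval f (P + Q) = peval f P + peval f Q"
  unfolding peval_def by (rule setsum_keys_plus_distrib) (simp_all add: algebra_simps)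

lemma peval_single: "peval f (Poly_Mapping.single \<alpha> c) = c * (\<Prod>x\<in>#\<alpha>. f x)"
  by (simp add: peval_def)

lemma peval_mult: "peval f (P * Q) = peval f P * peval f Q"
proof (induction P rule: mpoly_induct)
  case (single \<alpha> c)
  show ?case
    by (induction Q rule: mpoly_induct) (auto simp: peval_single mult_single peval_add algebra_simps)
qed (auto simp: peval_add algebra_simps)

lemma peval_1: "peval f 1 = 1"
  using peval_single[of f "{#}" 1] by simp

lemma peval_Var: "peval f (Var x) = f x"
  by (simp add: Var_def peval_single)

lemma comm_ring_hom_peval: "comm_ring_hom (peval f)"
proof -
  have "peval f 0 = 0" by (simp add: peval_def)
  thus ?thesis by unfold_locales (simp_all add: peval_add peval_mult peval_1)
qed

lemma peval_minor: "peval f (minor k g) = det (mat k k (\<lambda>(a, b). f (g a, b)))"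
proof -
  interpret comm_ring_hom "peval f" by (rule comm_ring_hom_peval)
  show ?thesis unfolding minor_def hom_det[symmetric]
    by (intro arg_cong[of _ _ det] eq_matI) (auto simp: peval_Var)
qed

section \<open>Highest weight vectors made from minors\<close>

text \<open>The leading minors and their variants with the last row of the matrix in place of the last of the
  \<open>k\<close> rows. They represent functionals on the fundamental modules that are invariant under lower
  unipotent matrices in the upper left block.\<close>

definition lead :: "nat \<Rightarrow> (nat \<times> nat) mpoly" where
  "lead k = minor k id"

definition side :: "nat \<Rightarrow> nat \<Rightarrow> (nat \<times> nat) mpoly" where
  "side n k = minor k (id(k - 1 := n))"

text \<open>Raising replaces a row of the minor by one further up, which occurs in it already.\<close>

lemma raise_lead:
  assumes "i < j" "j \<le> n" "k \<le> n"
  shows "gl_act n (munit n i j) (lead k) = 0"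
proof -
  have "minor k (id(a := i)) = 0" if "a < k" "a = j" for a
    using that assms by (intro minor_duplicate[of i _ a]) auto
  thus ?thesis
    unfolding lead_def using assms by (subst gl_act_munit_minor) (auto intro!: sum.neutral)
qed

lemma raise_side:
  assumes "i < j" "j < n" "k \<le> n"
  shows "gl_act n (munit n i j) (side n k) = 0"
proof -
  let ?g = "id(k - 1 := n)"
  have "minor k (?g(a := i)) = 0" if "a < k" "?g a = j" for a
    using that assms by (intro minor_duplicate[of i _ a]) (auto split: if_splits)
  thus ?thesis
    unfolding side_def using assms by (subst gl_act_munit_minor) (auto intro!: sum.neutral)
qed

lemma gl_act_last_side:
  assumes "i < n" "1 \<le> k" "k \<le> n"
  shows "gl_act n (munit n i n) (side n k) = minor k (id(k - 1 := i))"
proof -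
  let ?g = "id(k - 1 := n)"
  have "gl_act n (munit n i n) (side n k) = (\<Sum>a<k. if ?g a = n then minor k (?g(a := i)) else 0)"
    unfolding side_def using assms by (intro gl_act_munit_minor) auto
  also have "\<dots> = (\<Sum>a<k. if a = k - 1 then minor k (id(k - 1 := i)) else 0)"
    using assms by (intro sum.cong refl) auto
  finally show ?thesis using assms by simp
qed

text \<open>Row \<open>k - 1\<close> is the one that distinguishes the two minors; a row further up would occur twice, as in
  \<open>last_side_0\<close>.\<close>

lemma last_side_lead:
  assumes "1 \<le> k" "k \<le> n"
  shows "gl_act n (munit n (k - 1) n) (side n k) = lead k"
  using gl_act_last_side[of "k - 1" n k] assms by (simp add: lead_def fun_upd_idem)

lemma last_side_0:
  assumes "i < k - 1" "k \<le> n"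
  shows "gl_act n (munit n i n) (side n k) = 0"
  using assms gl_act_last_side[of i n k] minor_duplicate[of i k "k - 1" "id(k - 1 := i)"] by simp

text \<open>Only the minor that ends in row \<open>j - 1\<close> feels this operator: a shorter one does not contain the
  row, a longer one contains row \<open>j\<close> already.\<close>

lemma simple_lower_lead:
  assumes "1 \<le> j" "j \<le> n" "k \<le> n"
  shows "gl_act n (munit n j (j - 1)) (lead k) = (if k = j then minor j (id(j - 1 := j)) else 0)"
proof -
  have "gl_act n (munit n j (j - 1)) (lead k) = (\<Sum>a<k. if id a = j - 1 then minor k (id(a := j)) else 0)"
    unfolding lead_def using assms by (intro gl_act_munit_minor) auto
  also have "\<dots> = (\<Sum>a<k. if a = j - 1 then minor k (id(j - 1 := j)) else 0)"
    by (intro sum.cong) auto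
  also have "\<dots> = (if j - 1 < k then minor k (id(j - 1 := j)) else 0)"
    by simp
  also have "\<dots> = (if k = j then minor j (id(j - 1 := j)) else 0)"
    using assms minor_duplicate[of "j - 1" k j "id(j - 1 := j)"] by auto
  finally show ?thesis .
qed

lemma simple_lower_twice:
  assumes "1 \<le> j" "j \<le> n"
  shows "gl_act n (munit n j (j - 1)) (minor j (id(j - 1 := j))) = 0"
proof -
  have "gl_act n (munit n j (j - 1)) (minor j (id(j - 1 := j))) =
    (\<Sum>a<j. if (id(j - 1 := j)) a = j - 1 then minor j ((id(j - 1 := j))(a := j)) else 0)"
    using assms by (intro gl_act_munit_minor) auto
  also have "\<dots> = 0" using assms by (intro sum.neutral) auto
  finally show ?thesis .
qed

definition model_vec :: "nat \<Rightarrow> (nat \<Rightarrow> nat) \<Rightarrow> (nat \<Rightarrow> nat) \<Rightarrow> (nat \<times> nat) mpoly" where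
  "model_vec n a c = (\<Prod>k=1..n. lead k ^ (a k - c k) * side n k ^ c k)"

lemma model_vec_0: "model_vec n a (\<lambda>_. 0) = (\<Prod>k=1..n. lead k ^ a k)"
  by (simp add: model_vec_def)

lemma raise_model_vec:
  assumes "i < j" "j < n"
  shows "gl_act n (munit n i j) (model_vec n a c) = 0"
  unfolding model_vec_def using assms
  by (intro gl_act_prod_0) (simp add: gl_act_mult gl_act_power_0 raise_lead raise_side)

lemma raise_model_top:
  assumes "i < j" "j \<le> n"
  shows "gl_act n (munit n i j) (model_vec n a (\<lambda>_. 0)) = 0"
  unfolding model_vec_0 using assms
  by (intro gl_act_prod_0) (simp add: gl_act_power_0 raise_lead)

lemma diagonal_model_vec:
  assumes X: "\<And>i j. i \<le> n \<Longrightarrow> j \<le> n \<Longrightarrow> i \<noteq> j \<Longrightarrow> X $$ (i, j) = 0"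
  shows "gl_act n X (model_vec n a c) =
    Const (\<Sum>k=1..n. of_nat (a k - c k) * (\<Sum>i<k. X $$ (i, i)) +
      of_nat (c k) * ((\<Sum>i<k - 1. X $$ (i, i)) + X $$ (n, n))) * model_vec n a c"
  unfolding model_vec_def
proof (intro gl_act_eigen_prod gl_act_eigen_mult gl_act_eigen_power)
  fix k assume k: "k \<in> {1..n}"
  show "gl_act n X (lead k) = Const (\<Sum>i<k. X $$ (i, i)) * lead k"
    unfolding lead_def using gl_act_diagonal_minor[OF X, where k = k and g = id] k by simp
  obtain k' where k': "k = Suc k'" using k by (cases k) auto
  have "(\<Sum>a<k. X $$ ((id(k - 1 := n)) a, (id(k - 1 := n)) a)) = (\<Sum>i<k - 1. X $$ (i, i)) + X $$ (n, n)"
    unfolding k' by simp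
  thus "gl_act n X (side n k) = Const ((\<Sum>i<k - 1. X $$ (i, i)) + X $$ (n, n)) * side n k"
    unfolding side_def using k by (subst gl_act_diagonal_minor[OF X]) auto
qed

text \<open>At the matrix with ones on the diagonal and zeros elsewhere all leading minors are \<open>1\<close>.\<close>

lemma model_top_nonzero: "model_vec n a (\<lambda>_. 0) \<noteq> 0"
proof -
  let ?f = "\<lambda>(r, l). if r = l then 1 else 0 :: complex"
  interpret comm_ring_hom "peval ?f" by (rule comm_ring_hom_peval)
  have "peval ?f (lead k) = 1" for k
  proof -
    have "mat k k (\<lambda>(a, b). ?f (id a, b)) = 1\<^sub>m k" by (intro eq_matI) auto
    thus ?thesis unfolding lead_def peval_minor by simp
  qed
  hence "peval ?f (model_vec n a (\<lambda>_. 0)) = 1"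
    by (simp add: model_vec_0 hom_prod hom_power)
  thus ?thesis by auto
qed

text \<open>The operator acts on one of the minors only, and its square kills that minor; so one more
  application than the exponent \<open>a j\<close> of the minor gives zero.\<close>

lemma simple_lower_model_top:
  assumes j: "1 \<le> j" "j \<le> n"
  shows "(gl_act n (munit n j (j - 1)) ^^ (a j + 1)) (model_vec n a (\<lambda>_. 0)) = 0"
proof -
  let ?D = "gl_act n (munit n j (j - 1))"
  have m: "model_vec n a (\<lambda>_. 0) = lead j ^ a j * (\<Prod>k\<in>{1..n} - {j}. lead k ^ a k)"
    unfolding model_vec_0 using j by (intro prod.remove) auto
  have "(\<Prod>i<a j + 1. a j - i) = 0" by simp
  moreover have "(?D ^^ (a j + 1)) (model_vec n a (\<lambda>_. 0)) =
    of_nat (\<Prod>i<a j + 1. a j - i) * lead j ^ (a j - (a j + 1)) * (minor j (id(j - 1 := j))) ^ (a j + 1) *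
      (\<Prod>k\<in>{1..n} - {j}. lead k ^ a k)"
    unfolding m using j
    by (intro gl_act_iterate gl_act_prod_0 gl_act_power_0) (auto simp: simple_lower_lead[OF j] simple_lower_twice[OF j]
      simp del: One_nat_def)
  ultimately show ?thesis by (simp only: of_nat_0 mult_zero_left)
qed

definition last_row_word :: "nat \<Rightarrow> (nat \<Rightarrow> nat) \<Rightarrow> (nat \<times> nat) list" where
  "last_row_word n c = concat (map (\<lambda>k. replicate (c k) (n, k - 1)) [1..<n + 1])"

lemma word_act_replicate: "word_act n \<rho> (replicate m (i, j)) x = (\<rho> (munit n i j) ^^ m) x"
  by (induction m) auto

lemma fock_munit_power:
  assumes "i \<le> n" "j \<le> n"
  shows "fock ((gl_act n (munit n i j) ^^ m) P) Q = fock P ((gl_act n (munit n j i) ^^ m) Q)"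
proof (induction m arbitrary: Q)
  case (Suc m)
  show ?case by (simp add: fock_munit[OF assms] Suc funpow_swap1[of "gl_act n (munit n j i)" m Q])
qed simp

lemma prod_falling: "(\<Prod>i<m. m - i) = (fact m :: nat)"
proof (induction m)
  case (Suc m)
  have "(\<Prod>i<Suc m. Suc m - i) = (\<Prod>i<m. m - i) * Suc m"
    by (subst prod.lessThan_Suc_shift) simp
  thus ?case using Suc by simp
qed simp

text \<open>The adjoints of the letters are applied to \<open>model_vec n a c\<close> in the order \<open>k = 1, \<dots>, n\<close>. At step \<open>k\<close>
  the factors \<open>side n j\<close> with \<open>j < k\<close> are gone and those with \<open>j > k\<close> are killed, so each application
  converts one \<open>side n k\<close> into \<open>lead k\<close>. In the end a positive multiple of the squared norm of the
  highest weight vector remains.\<close>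

lemma fock_last_row_word:
  assumes c: "\<And>k. k \<in> {1..n} \<Longrightarrow> c k \<le> a k"
  shows "fock (word_act n (gl_act n) (last_row_word n c) (model_vec n a (\<lambda>_. 0))) (model_vec n a c) \<noteq> 0"
proof -
  let ?m = "model_vec n a (\<lambda>_. 0)"
  define W where "W t = word_act n (gl_act n) (concat (map (\<lambda>k. replicate (c k) (n, k - 1)) [t..<n + 1])) ?m" for t
  define w where "w t = model_vec n a (\<lambda>k. if k < t then 0 else c k)" for t
  \<comment> \<open>\<open>W t\<close> consists of the steps that are left, and in \<open>w t\<close> the first \<open>t - 1\<close> have been carried out.\<close>
  have "fock (W t) (w t) \<noteq> 0" if "1 \<le> t" "t \<le> n + 1" for t
    using that(2,1)
  proof (induction t rule: inc_induct)
    case base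
    have "w (n + 1) = ?m" unfolding w_def model_vec_def by (intro prod.cong) auto
    thus ?case using fock_definite model_top_nonzero by (auto simp: W_def)
  next
    case (step t)
    let ?D = "gl_act n (munit n (t - 1) n)"
    let ?c = "\<lambda>k. if k < t then 0 else c k"
    let ?c' = "\<lambda>k. if k < Suc t then 0 else c k"
    let ?G = "lead t ^ (a t - c t) * (\<Prod>k\<in>{1..n} - {t}. lead k ^ (a k - ?c k) * side n k ^ ?c k)"
    have t: "1 \<le> t" "t \<le> n" using step by auto
    have "W t = (gl_act n (munit n n (t - 1)) ^^ c t) (W (Suc t))"
      unfolding W_def using t by (simp add: upt_rec word_act_replicate)
    hence 1: "fock (W t) (w t) = fock (W (Suc t)) ((?D ^^ c t) (w t))"
      using t by (simp add: fock_munit_power)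
    have "w t = side n t ^ c t * ?G"
      unfolding w_def model_vec_def using t by (subst prod.remove[of _ t]) (auto simp: mult_ac)
    hence "(?D ^^ c t) (w t) = (?D ^^ c t) (side n t ^ c t * ?G)"
      by (simp only:)
    also have "\<dots> = of_nat (\<Prod>i<c t. c t - i) * side n t ^ (c t - c t) * lead t ^ c t * ?G"
    proof (rule gl_act_iterate)
      show "?D (side n t) = lead t" using t by (rule last_side_lead)
      show lead: "?D (lead t) = 0" using t by (intro raise_lead) auto
      have "?D (\<Prod>k\<in>{1..n} - {t}. lead k ^ (a k - ?c k) * side n k ^ ?c k) = 0"
      proof (rule gl_act_prod_0)
        fix k assume k: "k \<in> {1..n} - {t}"
        have "?D (lead k) = 0" using k t by (intro raise_lead) auto
        moreover have "?D (side n k ^ ?c k) = 0"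
        proof (cases "k < t")
          case False
          hence "?D (side n k) = 0" using k t by (intro last_side_0) auto
          thus ?thesis by (rule gl_act_power_0)
        qed simp
        ultimately show "?D (lead k ^ (a k - ?c k) * side n k ^ ?c k) = 0"
          by (simp add: gl_act_mult gl_act_power_0)
      qed
      thus "?D ?G = 0" using lead by (simp add: gl_act_mult gl_act_power_0)
    qed
    also have "\<dots> = of_nat (fact (c t)) * (lead t ^ c t * ?G)"
      by (simp add: prod_falling mult.assoc del: of_nat_prod)
    also have "lead t ^ c t * ?G = w (Suc t)"
    proof -
      have "w (Suc t) = lead t ^ a t * (\<Prod>k\<in>{1..n} - {t}. lead k ^ (a k - ?c' k) * side n k ^ ?c' k)"
        unfolding w_def model_vec_def using t by (subst prod.remove[of _ t]) auto
      also have "(\<Prod>k\<in>{1..n} - {t}. lead k ^ (a k - ?c' k) * side n k ^ ?c' k) =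
        (\<Prod>k\<in>{1..n} - {t}. lead k ^ (a k - ?c k) * side n k ^ ?c k)"
        by (intro prod.cong) auto
      also have "lead t ^ a t = lead t ^ c t * lead t ^ (a t - c t)"
        using c[of t] t by (simp flip: power_add)
      finally show ?thesis by (simp add: mult.assoc)
    qed
    also have "of_nat (fact (c t)) * w (Suc t) = Const (of_nat (fact (c t))) * w (Suc t)"
      by (simp only: Const_of_nat)
    finally have "fock (W t) (w t) = of_nat (fact (c t)) * fock (W (Suc t)) (w (Suc t))"
      using 1 by (simp add: fock_Const_right)
    thus ?case using step by simp
  qed
  from this[of 1] have "fock (W 1) (w 1) \<noteq> 0" by simp
  moreover have "w 1 = model_vec n a c" unfolding w_def model_vec_def by (intro prod.cong) auto
  ultimately show ?thesis by (simp add: W_def last_row_word_def)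
qed

text \<open>The letter \<open>(n, j)\<close> turns a row index \<open>j\<close> into \<open>n\<close>, which lowers the eigenvalue of \<open>E\<^sub>j\<^sub>j\<close> by one.\<close>

lemma row_weight_word:
  assumes i: "i < n" and P: "gl_act n (munit n i i) P = Const \<mu> * P"
    and ws: "set ws \<subseteq> {n} \<times> {..<n}"
  shows "gl_act n (munit n i i) (word_act n (gl_act n) ws P) =
    Const (\<mu> - of_nat (count (mset ws) (n, i))) * word_act n (gl_act n) ws P"
  using ws
proof (induction ws)
  case Nil
  show ?case by (simp add: P)
next
  case (Cons p ws)
  then obtain j where p: "p = (n, j)" "j < n" by auto
  let ?Q = "word_act n (gl_act n) ws P"
  have "gl_act n (bracket (munit n i i) (munit n n j)) ?Q =
    gl_act n (munit n i i) (gl_act n (munit n n j) ?Q) - gl_act n (munit n n j) (gl_act n (munit n i i) ?Q)"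
    by (rule gl_act_bracket) (rule munit_carrier)+
  moreover have "gl_act n (bracket (munit n i i) (munit n n j)) ?Q =
    Const (if j = i then - 1 else 0) * gl_act n (munit n n j) ?Q"
  proof (cases "j = i")
    case True
    have "bracket (munit n i i) (munit n n j) = (-1) \<cdot>\<^sub>m munit n n j"
      using i p True by (subst bracket_munit) (auto intro!: eq_matI)
    thus ?thesis using True gl_act_smult_mat[OF munit_carrier] by simp
  next
    case False
    have "bracket (munit n i i) (munit n n j) = 0 \<cdot>\<^sub>m munit n n j"
      using i p False by (subst bracket_munit) (auto intro!: eq_matI)
    thus ?thesis using False gl_act_smult_mat[OF munit_carrier, of n 0] by simp
  qed
  moreover have "gl_act n (munit n n j) (gl_act n (munit n i i) ?Q) =
    Const (\<mu> - of_nat (count (mset ws) (n, i))) * gl_act n (munit n n j) ?Q"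
    using Cons by (simp add: gl_act_Const_mult)
  ultimately have "gl_act n (munit n i i) (gl_act n (munit n n j) ?Q) =
    Const (\<mu> - of_nat (count (mset ws) (n, i)) + (if j = i then - 1 else 0)) * gl_act n (munit n n j) ?Q"
    unfolding Const_add distrib_right by simp
  also have "\<mu> - of_nat (count (mset ws) (n, i)) + (if j = i then - 1 else 0) =
    \<mu> - of_nat (count (mset (p # ws)) (n, i))"
    using p by auto
  finally show ?case using p by simp
qed

lemma count_last_row_word:
  "k \<in> {1..n} \<Longrightarrow> count (mset (last_row_word n c)) (n, k - 1) = c k"
proof -
  assume k: "k \<in> {1..n}"
  have "count (mset (last_row_word n c)) (n, k - 1) =
    (\<Sum>j\<leftarrow>[1..<n + 1]. if j = k then c k else 0)"
    unfolding last_row_word_def mset_concat map_map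
  proof -
    have *: "count (sum_list (map (mset \<circ> (\<lambda>k. replicate (c k) (n, k - 1))) js)) (n, k - 1) =
      (\<Sum>j\<leftarrow>js. if j = k then c k else 0)" if "0 \<notin> set js" for js
      using that k by (induction js) auto
    show "count (sum_list (map (mset \<circ> (\<lambda>k. replicate (c k) (n, k - 1))) [1..<n + 1])) (n, k - 1) =
      (\<Sum>j\<leftarrow>[1..<n + 1]. if j = k then c k else 0)"
      by (rule *) auto
  qed
  also have "\<dots> = (\<Sum>j\<in>{1..<n + 1}. if j = k then c k else 0)"
    by (subst sum_list_distinct_conv_sum_set) auto
  also have "\<dots> = c k" using k by simp
  finally show ?thesis .
qed

lemma last_row_word_set: "set (last_row_word n c) \<subseteq> {n} \<times> {..<n}"
  by (auto simp: last_row_word_def)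

text \<open>Both arguments are eigenvectors of the self-adjoint operators \<open>E\<^sub>i\<^sub>i\<close>, so they are orthogonal unless the
  eigenvalues agree, and for \<open>i = k - 1\<close> these recover the exponent at \<open>k\<close>.\<close>

lemma fock_last_row_word_eq:
  assumes c: "\<And>k. k \<in> {1..n} \<Longrightarrow> c k \<le> a k"
    and ne: "fock (word_act n (gl_act n) (last_row_word n d) (model_vec n a (\<lambda>_. 0))) (model_vec n a c) \<noteq> 0"
    and k: "k \<in> {1..n}"
  shows "d k = c k"
proof -
  let ?i = "k - 1" and ?m = "model_vec n a (\<lambda>_. 0)"
  let ?P = "word_act n (gl_act n) (last_row_word n d) ?m"
  define \<mu> :: complex where "\<mu> = (\<Sum>l=1..n. if k \<le> l then of_nat (a l) else 0)"
  have i: "?i < n" using k by auto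
  have w: "gl_act n (munit n ?i ?i) (model_vec n a c) = Const (\<mu> - of_nat (c k)) * model_vec n a c"
    if c: "\<And>k. k \<in> {1..n} \<Longrightarrow> c k \<le> a k" for c
  proof -
    have sum: "(\<Sum>i<l. munit n ?i ?i $$ (i, i)) = (if k \<le> l then 1 else 0)" if "l \<le> n" for l
    proof -
      have "(\<Sum>i<l. munit n ?i ?i $$ (i, i)) = (\<Sum>i<l. if i = ?i then 1 else 0)"
        using that by (intro sum.cong) auto
      thus ?thesis using k by auto
    qed
    have "(\<Sum>l=1..n. of_nat (a l - c l) * (\<Sum>i<l. munit n ?i ?i $$ (i, i)) +
      of_nat (c l) * ((\<Sum>i<l - 1. munit n ?i ?i $$ (i, i)) + munit n ?i ?i $$ (n, n))) =
      (\<Sum>l=1..n. (if k \<le> l then of_nat (a l) else 0) - (if l = k then of_nat (c k) else 0))"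
      using i k c by (intro sum.cong refl) (auto simp: sum of_nat_diff)
    also have "\<dots> = \<mu> - of_nat (c k)"
      using k by (simp add: \<mu>_def sum_subtractf)
    finally show ?thesis
      by (subst diagonal_model_vec) auto
  qed
  have top: "gl_act n (munit n ?i ?i) ?m = Const \<mu> * ?m"
    using w[of "\<lambda>_. 0"] by simp
  have "(\<mu> - of_nat (d k)) * fock ?P (model_vec n a c) =
    fock (gl_act n (munit n ?i ?i) ?P) (model_vec n a c)"
    unfolding row_weight_word[OF i top last_row_word_set] count_last_row_word[OF k]
    by (rule fock_Const_left[symmetric])
  also have "\<dots> = fock ?P (gl_act n (munit n ?i ?i) (model_vec n a c))"
    using i by (intro fock_munit) auto
  also have "\<dots> = cnj (\<mu> - of_nat (c k)) * fock ?P (model_vec n a c)"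
    by (subst w[of c]) (simp_all add: c fock_Const_right)
  also have "cnj (\<mu> - of_nat (c k)) = \<mu> - of_nat (c k)"
    by (auto simp: \<mu>_def intro!: sum.cong)
  finally show ?thesis using ne by simp
qed

text \<open>Strictly lower triangular matrices turn variables into variables of rows further down. The height
  measures the room that is left for this.\<close>

definition height :: "nat \<Rightarrow> (nat \<times> nat) multiset \<Rightarrow> nat" where
  "height n \<alpha> = (\<Sum>(r, l)\<in>#\<alpha>. n - r)"

lemma keys_gl_act_lower:
  assumes low: "\<And>i j. i \<le> n \<Longrightarrow> j \<le> n \<Longrightarrow> X $$ (i, j) \<noteq> 0 \<Longrightarrow> j < i"
    and \<alpha>: "\<alpha> \<in> Poly_Mapping.keys (gl_act n X P)"
  shows "\<exists>\<beta>\<in>Poly_Mapping.keys P. height n \<alpha> < height n \<beta>"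
proof -
  have "gl_act n X P = (\<Sum>b\<in>{..n} \<times> {..<n}. \<Sum>i\<le>n. Const (X $$ (i, fst b)) * (Var (i, snd b) * pd b P))"
    by (simp add: gl_act_def gl_var_def sum_distrib_right mult.assoc)
  hence "(\<Sum>b\<in>{..n} \<times> {..<n}. \<Sum>i\<le>n. X $$ (i, fst b) * Poly_Mapping.lookup (Var (i, snd b) * pd b P) \<alpha>) \<noteq> 0"
    using \<alpha> by (simp add: in_keys_iff lookup_sum)
  then obtain b where b: "b \<in> {..n} \<times> {..<n}"
    and "(\<Sum>i\<le>n. X $$ (i, fst b) * Poly_Mapping.lookup (Var (i, snd b) * pd b P) \<alpha>) \<noteq> 0"
    by (meson sum.neutral)
  then obtain i where i: "i \<in> {..n}" and ne: "X $$ (i, fst b) * Poly_Mapping.lookup (Var (i, snd b) * pd b P) \<alpha> \<noteq> 0"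
    by (meson sum.neutral)
  obtain j l where jl: "b = (j, l)" by (cases b)
  have ji: "j < i" using low[of i j] i b ne jl by auto
  have ne': "Poly_Mapping.lookup (Var (i, l) * pd (j, l) P) \<alpha> \<noteq> 0" using ne jl by auto
  hence "(i, l) \<in># \<alpha>" using lookup_Var_mult_notin by metis
  then obtain \<beta> where \<beta>: "\<alpha> = add_mset (i, l) \<beta>" by (metis multi_member_split)
  with ne' have "add_mset (j, l) \<beta> \<in> Poly_Mapping.keys P"
    by (auto simp: lookup_Var_mult_add_mset lookup_pd in_keys_iff)
  moreover have "height n \<alpha> < height n (add_mset (j, l) \<beta>)"
    using \<beta> i ji by (simp add: height_def)
  ultimately show ?thesis by blast
qed

lemma gl_act_lower_nilpotent:
  assumes low: "\<And>i j. i \<le> n \<Longrightarrow> j \<le> n \<Longrightarrow> X $$ (i, j) \<noteq> 0 \<Longrightarrow> j < i"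
  shows "\<exists>K. \<forall>k\<ge>K. (gl_act n X ^^ k) P = 0"
proof -
  have keys: "\<exists>\<beta>\<in>Poly_Mapping.keys P. height n \<alpha> + k \<le> height n \<beta>"
    if "\<alpha> \<in> Poly_Mapping.keys ((gl_act n X ^^ k) P)" for \<alpha> k
    using that
  proof (induction k arbitrary: \<alpha>)
    case (Suc k)
    then obtain \<beta> where "\<beta> \<in> Poly_Mapping.keys ((gl_act n X ^^ k) P)" "height n \<alpha> < height n \<beta>"
      using keys_gl_act_lower[OF low] by fastforce
    moreover from this obtain \<gamma> where "\<gamma> \<in> Poly_Mapping.keys P" "height n \<beta> + k \<le> height n \<gamma>"
      using Suc.IH by blast
    ultimately show ?case by (intro bexI[of _ \<gamma>]) auto
  qed auto
  define K where "K = Suc (Max (insert 0 (height n ` Poly_Mapping.keys P)))"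
  have "(gl_act n X ^^ k) P = 0" if k: "k \<ge> K" for k
  proof (rule ccontr)
    assume "(gl_act n X ^^ k) P \<noteq> 0"
    then obtain \<alpha> where "\<alpha> \<in> Poly_Mapping.keys ((gl_act n X ^^ k) P)"
      by (meson equals0I keys_eq_empty)
    then obtain \<beta> where \<beta>: "\<beta> \<in> Poly_Mapping.keys P" "k \<le> height n \<beta>" using keys by fastforce
    have "height n \<beta> \<le> Max (insert 0 (height n ` Poly_Mapping.keys P))"
      using \<beta> by (intro Max_ge) auto
    thus False using k \<beta>(2) unfolding K_def by linarith
  qed
  thus ?thesis by blast
qed

section \<open>Root spaces\<close>

text \<open>A Cartan element on which all roots take different values: the differences of two distinct powers
  of \<open>2\<close> determine the exponents. The subtracted mean makes the trace zero.\<close>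

definition powers :: "nat \<Rightarrow> complex mat" where
  "powers n = mat (n + 1) (n + 1) (\<lambda>(a, b). if a = b then 2 ^ a - (\<Sum>i\<le>n. 2 ^ i) / of_nat (n + 1) else 0)"

lemma powers_cartan: "powers n \<in> cartan n"
proof -
  have "(\<Sum>i<n + 1. powers n $$ (i, i)) = (\<Sum>i\<le>n. 2 ^ i - (\<Sum>i\<le>n. 2 ^ i) / of_nat (n + 1))"
    by (intro sum.cong) (auto simp: powers_def)
  also have "\<dots> = (0::complex)" unfolding sum_subtractf by (simp del: of_nat_Suc)
  finally show ?thesis by (simp add: cartan_def sl_def powers_def diagonal_mat_def)
qed

lemma powers_diff: "i \<le> n \<Longrightarrow> j \<le> n \<Longrightarrow> powers n $$ (i, i) - powers n $$ (j, j) = 2 ^ i - 2 ^ j"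
  by (simp add: powers_def)

lemma powers_of_two_sum_eq:
  fixes i j k l :: nat
  assumes "(2::nat) ^ i + 2 ^ j = 2 ^ k + 2 ^ l" "i < j" "k < l"
  shows "i = k" "j = l"
proof -
  have odd: "\<exists>q. (2::nat) ^ s + 2 ^ t = 2 ^ s * (2 * q + 1)" if st: "s < t" for s t
  proof -
    obtain u where "t = s + Suc u" using less_imp_Suc_add[OF st] by auto
    hence "(2::nat) ^ s + 2 ^ t = 2 ^ s * (2 * 2 ^ u + 1)" by (simp add: power_add)
    thus ?thesis by blast
  qed
  have *: "s \<le> s'" if "(2::nat) ^ s * (2 * q + 1) = 2 ^ s' * (2 * q' + 1)" for s s' q q'
  proof (rule ccontr)
    assume "\<not> s \<le> s'"
    then obtain u where "s = s' + Suc u" using less_imp_Suc_add[of s' s] by auto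
    hence "2 ^ s' * (2 * (2 ^ u * (2 * q + 1))) = 2 ^ s' * (2 * q' + 1)"
      using that by (simp add: power_add algebra_simps)
    hence "2 * (2 ^ u * (2 * q + 1)) = 2 * q' + 1" by (subst (asm) mult_cancel1) simp
    thus False by presburger
  qed
  show "i = k" using odd[OF assms(2)] odd[OF assms(3)] assms(1) * by (metis le_antisym)
  thus "j = l" using assms by simp
qed

lemma powers_diff_inj_less:
  assumes "(2::complex) ^ i - 2 ^ j = 2 ^ k - 2 ^ l" "k < l" "i \<noteq> j"
  shows "i = k \<and> j = l"
proof -
  have "(of_nat (2 ^ i + 2 ^ l) :: complex) = of_nat (2 ^ k + 2 ^ j)"
    using assms(1) by (simp add: algebra_simps)
  hence eq: "(2::nat) ^ i + 2 ^ l = 2 ^ k + 2 ^ j" by (simp only: of_nat_eq_iff)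
  have "(2::nat) ^ k < 2 ^ l" using assms(2) by simp
  hence "(2::nat) ^ i < 2 ^ j" using eq by linarith
  hence "i < j" by simp
  show ?thesis
  proof (cases "i < l \<and> k < j")
    case True
    thus ?thesis using powers_of_two_sum_eq[OF eq] by auto
  next
    case False
    hence "k < l \<and> l \<le> i \<and> i < j \<or> i < j \<and> j \<le> k \<and> k < l" using \<open>i < j\<close> assms by auto
    thus ?thesis
    proof
      assume *: "k < l \<and> l \<le> i \<and> i < j"
      hence "(2::nat) ^ l \<le> 2 ^ i" "2 * (2::nat) ^ i \<le> 2 ^ j"
        using power_increasing[of "Suc i" j "2::nat"] by auto
      hence "(2::nat) ^ i + 2 ^ l \<le> 2 ^ j" by linarith
      moreover have "(2::nat) ^ k > 0" by simp
      ultimately show ?thesis using eq by linarith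
    next
      assume *: "i < j \<and> j \<le> k \<and> k < l"
      hence "(2::nat) ^ j \<le> 2 ^ k" "2 * (2::nat) ^ k \<le> 2 ^ l"
        using power_increasing[of "Suc k" l "2::nat"] by auto
      hence "(2::nat) ^ k + 2 ^ j \<le> 2 ^ l" by linarith
      moreover have "(2::nat) ^ i > 0" by simp
      ultimately show ?thesis using eq by linarith
    qed
  qed
qed

lemma powers_diff_inj:
  assumes eq: "(2::complex) ^ i - 2 ^ j = 2 ^ k - 2 ^ l" and "k \<noteq> l"
  shows "(i, j) = (k, l)"
proof -
  have "(2::complex) ^ k \<noteq> 2 ^ l"
  proof
    assume "(2::complex) ^ k = 2 ^ l"
    hence "(of_nat (2 ^ k) :: complex) = of_nat (2 ^ l)" by simp
    hence "(2::nat) ^ k = 2 ^ l" by (simp only: of_nat_eq_iff)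
    thus False using \<open>k \<noteq> l\<close> by simp
  qed
  hence "i \<noteq> j" using eq by auto
  show ?thesis
  proof (cases "k < l")
    case True
    thus ?thesis using powers_diff_inj_less[OF eq] \<open>i \<noteq> j\<close> by simp
  next
    case False
    have "(2::complex) ^ j - 2 ^ i = 2 ^ l - 2 ^ k" using eq by (simp add: algebra_simps)
    thus ?thesis using powers_diff_inj_less[of j i l k] False \<open>k \<noteq> l\<close> \<open>i \<noteq> j\<close> by simp
  qed
qed

text \<open>Bracketing with \<open>powers n\<close> multiplies the entry at \<open>(a, b)\<close> by \<open>2\<^sup>a - 2\<^sup>b\<close>, so a single entry can survive.
  Thus the chosen root vectors are multiples of matrix units.\<close>

lemma root_space_unit:
  assumes ij: "i \<noteq> j" "i \<le> n" "j \<le> n" and X: "X \<in> root_space n (eps n (i + 1) - eps n (j + 1))"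
  shows "X = X $$ (i, j) \<cdot>\<^sub>m munit n i j"
proof -
  have Xsl: "X \<in> sl n" and Xc: "X \<in> carrier_mat (n + 1) (n + 1)"
    using X by (auto simp: root_space_def sl_def)
  let ?h = "powers n"
  have hc: "?h \<in> carrier_mat (n + 1) (n + 1)" by (simp add: powers_def)
  have br: "bracket ?h X = (2 ^ i - 2 ^ j) \<cdot>\<^sub>m X"
    using X powers_cartan[of n] powers_diff[of i n j] ij by (simp add: root_space_def eps_def)
  have "X $$ (a, b) = 0" if ab: "a < n + 1" "b < n + 1" "(a, b) \<noteq> (i, j)" for a b
  proof -
    have 1: "(\<Sum>m<n + 1. ?h $$ (a, m) * X $$ (m, b)) = (\<Sum>m<n + 1. if m = a then ?h $$ (a, a) * X $$ (a, b) else 0)"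
      using ab by (intro sum.cong) (auto simp: powers_def)
    have 2: "(\<Sum>m<n + 1. X $$ (a, m) * ?h $$ (m, b)) = (\<Sum>m<n + 1. if m = b then ?h $$ (b, b) * X $$ (a, b) else 0)"
      using ab by (intro sum.cong) (auto simp: powers_def)
    have "(?h $$ (a, a) - ?h $$ (b, b)) * X $$ (a, b) = bracket ?h X $$ (a, b)"
      unfolding bracket_index[OF hc Xc ab(1,2)] 1 2 using ab by (simp add: algebra_simps)
    also have "\<dots> = (2 ^ i - 2 ^ j) * X $$ (a, b)"
      unfolding br using Xc ab by simp
    finally have "(2 ^ a - 2 ^ b - (2 ^ i - 2 ^ j)) * X $$ (a, b) = 0"
      using powers_diff[of a n b] ab by (simp add: algebra_simps)
    moreover have "(2::complex) ^ a - 2 ^ b \<noteq> 2 ^ i - 2 ^ j"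
      using powers_diff_inj ij(1) ab(3) by blast
    ultimately show ?thesis by simp
  qed
  thus ?thesis
    using Xc ij by (intro eq_matI) auto
qed

section \<open>Embedding an irreducible module into the polynomials\<close>

text \<open>The second condition says \<open>\<Lambda> = \<Sum> a\<^sub>k \<pi>\<^sub>k\<close> on the Cartan subalgebra.\<close>

locale irr_hw_mod = hw_mod n scale V \<rho> \<Lambda> v
  for n :: nat and scale :: "complex \<Rightarrow> 'v::ab_group_add \<Rightarrow> 'v" and V :: "'v set"
    and \<rho> :: "complex mat \<Rightarrow> 'v \<Rightarrow> 'v" and \<Lambda> :: weight and v :: 'v +
  fixes a :: "nat \<Rightarrow> nat"
  assumes irreducible: "irreducible_module n scale V \<rho>"
    and weight: "\<And>h. h \<in> cartan n \<Longrightarrow> \<Lambda> h = (\<Sum>k=1..n. of_nat (a k) * (\<Sum>i<k. h $$ (i, i)))"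
begin

abbreviation model_top :: "(nat \<times> nat) mpoly" where
  "model_top \<equiv> model_vec n a (\<lambda>_. 0)"

definition scale2 :: "complex \<Rightarrow> 'v \<times> (nat \<times> nat) mpoly \<Rightarrow> 'v \<times> (nat \<times> nat) mpoly" where
  "scale2 c = (\<lambda>(x, P). (scale c x, Const c * P))"

definition act2 :: "complex mat \<Rightarrow> 'v \<times> (nat \<times> nat) mpoly \<Rightarrow> 'v \<times> (nat \<times> nat) mpoly" where
  "act2 X = (\<lambda>(x, P). (\<rho> X x, gl_act n X P))"

lemma scale2_Pair [simp]: "scale2 c (x, P) = (scale c x, Const c * P)"
  and act2_Pair [simp]: "act2 X (x, P) = (\<rho> X x, gl_act n X P)"
  by (simp_all add: scale2_def act2_def)

lemma gl_act_cartan_top: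
  assumes "h \<in> cartan n"
  shows "gl_act n h model_top = Const (\<Lambda> h) * model_top"
proof -
  have "h $$ (i, j) = 0" if "i \<le> n" "j \<le> n" "i \<noteq> j" for i j
    using assms that by (auto simp: cartan_def sl_def diagonal_mat_def)
  thus ?thesis by (subst diagonal_model_vec) (simp_all add: weight[OF assms])
qed


lemma vector_space_scale2: "vector_space scale2"
proof
  fix c d :: complex and x y :: "'v \<times> (nat \<times> nat) mpoly"
  show "scale2 c (x + y) = scale2 c x + scale2 c y"
    "scale2 (c + d) x = scale2 c x + scale2 d x"
    "scale2 c (scale2 d x) = scale2 (c * d) x" "scale2 1 x = x"
    by (cases x; cases y; simp add: vs.scale_right_distrib vs.scale_left_distrib Const_add Const_mult algebra_simps)+
qed

lemma sl_module2: "sl_module n scale2 (V \<times> UNIV) act2"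
proof -
  interpret s2: vector_space scale2 by (rule vector_space_scale2)
  interpret F: sl_mod n "\<lambda>c P. Const c * P" UNIV "gl_act n" by (rule sl_mod_mpoly)
  have "s2.subspace (V \<times> UNIV)"
    using subspace_V by (auto simp: s2.subspace_def vs.subspace_def zero_prod_def)
  thus ?thesis
    unfolding sl_module_def
    by (auto simp: act_closed act_add act_scale act_add_mat act_smult_mat act_bracket
      F.act_add F.act_scale F.act_add_mat F.act_smult_mat F.act_bracket)
qed

lemma root_act_top:
  assumes "\<alpha> \<in> pos_roots n" "X \<in> root_space n \<alpha>"
  shows "gl_act n X model_top = 0"
proof -
  from assms obtain i j where ij: "1 \<le> i" "i < j" "j \<le> n + 1" "X \<in> root_space n (eps n i - eps n j)"
    by (auto simp: pos_roots_def)
  hence "X = X $$ (i - 1, j - 1) \<cdot>\<^sub>m munit n (i - 1) (j - 1)"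
    using root_space_unit[of "i - 1" "j - 1" n X] by simp
  moreover have "gl_act n (munit n (i - 1) (j - 1)) model_top = 0"
    using ij by (intro raise_model_top) auto
  ultimately show ?thesis
    using gl_act_smult_mat[OF munit_carrier] by (metis mult_zero_right)
qed

text \<open>The pair of highest weight vectors is again one of the same weight, so the facts about words apply
  to the submodule of the product that it generates.\<close>

sublocale pair: hw_mod n scale2 "V \<times> UNIV" act2 \<Lambda> "(v, model_top)"
proof (intro hw_mod.intro sl_mod.intro hw_mod_axioms.intro)
  show "vector_space scale2" by (rule vector_space_scale2)
  show "sl_module n scale2 (V \<times> UNIV) act2" by (rule sl_module2)
  show "highest_weight_vector n scale2 (V \<times> UNIV) act2 \<Lambda> (v, model_top)"
    using hw by (auto simp: highest_weight_vector_def gl_act_cartan_top root_act_top zero_prod_def)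
qed

lemma word_act2:
  "word_act n act2 ws (x, P) = (word_act n \<rho> ws x, word_act n (gl_act n) ws P)"
  by (induction ws) auto

text \<open>The generated submodule will turn out to be the graph of the embedding.\<close>

definition graph :: "('v \<times> (nat \<times> nat) mpoly) set" where
  "graph = pair.vs.span pair.words"

lemma graph_add: "(x, P) \<in> graph \<Longrightarrow> (y, Q) \<in> graph \<Longrightarrow> (x + y, P + Q) \<in> graph"
  unfolding graph_def using pair.vs.span_add by fastforce

lemma graph_scale: "(x, P) \<in> graph \<Longrightarrow> (scale c x, Const c * P) \<in> graph"
  unfolding graph_def using pair.vs.span_scale by fastforce

lemma graph_act: "X \<in> sl n \<Longrightarrow> (x, P) \<in> graph \<Longrightarrow> (\<rho> X x, gl_act n X P) \<in> graph"
  unfolding graph_def using pair.act_span_words by fastforce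

lemma graph_zero: "(0, 0) \<in> graph"
  unfolding graph_def using pair.vs.span_zero by (simp add: zero_prod_def)

lemma graph_word:
  "lower_word n ws \<Longrightarrow> (word_act n \<rho> ws v, word_act n (gl_act n) ws model_top) \<in> graph"
  unfolding graph_def pair.words_def by (rule pair.vs.span_base) (auto simp flip: word_act2)

lemma graph_V: "(x, P) \<in> graph \<Longrightarrow> x \<in> V"
  using pair.span_words_V by (auto simp: graph_def)

text \<open>The projection of the graph to \<open>V\<close> is a nonzero submodule of an irreducible module.\<close>

lemma graph_total:
  assumes "x \<in> V"
  shows "\<exists>P. (x, P) \<in> graph"
proof -
  let ?W = "{x. \<exists>P. (x, P) \<in> graph}"
  have "vs.subspace ?W"
    unfolding vs.subspace_def using graph_zero graph_add graph_scale by blast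
  moreover have "v \<in> ?W" using graph_word[of "[]"] by auto
  hence "?W \<noteq> {0}" using hw_nonzero by blast
  moreover have "?W \<subseteq> V" using graph_V by blast
  moreover have "\<forall>X\<in>sl n. \<forall>x\<in>?W. \<rho> X x \<in> ?W" using graph_act by blast
  ultimately have "?W = V" using irreducible unfolding irreducible_module_def by blast
  thus ?thesis using assms by blast
qed

text \<open>The two components have the same coefficient at the respective highest weight vector. Nonempty
  words contribute nothing to either side: in \<open>V\<close> they are deep, and in the model they are orthogonal
  to \<open>model_top\<close>, which the adjoint of their first letter annihilates.\<close>

lemma graph_top_component:
  assumes "(x, P) \<in> graph"
  shows "\<exists>b. x - scale b v \<in> deep \<and> fock P model_top = b * fock model_top model_top"
proof -
  let ?W = "{(x, P). \<exists>b. x - scale b v \<in> deep \<and> fock P model_top = b * fock model_top model_top}"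
  have "pair.vs.subspace ?W"
  proof (rule pair.vs.subspaceI)
    show "0 \<in> ?W" using vs.subspace_0[OF subspace_deep]
      by (auto simp: zero_prod_def intro!: exI[of _ 0])
    show "p + q \<in> ?W" if pq: "p \<in> ?W" "q \<in> ?W" for p q
    proof -
      obtain x P y Q where p: "p = (x, P)" "q = (y, Q)" by (cases p; cases q)
      with pq obtain b c where "x - scale b v \<in> deep" "fock P model_top = b * fock model_top model_top"
        "y - scale c v \<in> deep" "fock Q model_top = c * fock model_top model_top" by auto
      hence "x + y - scale (b + c) v \<in> deep \<and> fock (P + Q) model_top = (b + c) * fock model_top model_top"
        using vs.subspace_add[OF subspace_deep, of "x - scale b v" "y - scale c v"]
        by (simp add: vs.scale_left_distrib fock_add_left algebra_simps)
      thus ?thesis using p by auto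
    qed
    show "scale2 c p \<in> ?W" if pW: "p \<in> ?W" for c p
    proof -
      obtain x P where p: "p = (x, P)" by (cases p)
      with pW obtain b where "x - scale b v \<in> deep" "fock P model_top = b * fock model_top model_top" by auto
      hence "scale c x - scale (c * b) v \<in> deep \<and> fock (Const c * P) model_top = (c * b) * fock model_top model_top"
        using vs.subspace_scale[OF subspace_deep, of "x - scale b v" c]
        by (simp add: vs.scale_right_diff_distrib fock_Const_left)
      thus ?thesis using p by auto
    qed
  qed
  moreover have "pair.words \<subseteq> ?W"
  proof
    fix p assume "p \<in> pair.words"
    then obtain ws where ws: "lower_word n ws"
      and p: "p = (word_act n \<rho> ws v, word_act n (gl_act n) ws model_top)"
      by (auto simp: pair.words_def word_act2)
    show "p \<in> ?W"
    proof (cases ws)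
      case Nil
      thus ?thesis using p vs.subspace_0[OF subspace_deep] by (auto intro!: exI[of _ 1])
    next
      case (Cons q us)
      obtain i j where q: "q = (i, j)" by fastforce
      have "fock (word_act n (gl_act n) ws model_top) model_top =
        fock (word_act n (gl_act n) us model_top) (gl_act n (munit n j i) model_top)"
        using Cons q ws by (simp add: fock_munit)
      also have "gl_act n (munit n j i) model_top = 0"
        using Cons q ws by (intro raise_model_top) auto
      finally show ?thesis using p word_deep[OF ws] Cons by (auto intro!: exI[of _ 0])
    qed
  qed
  ultimately have "graph \<subseteq> ?W" unfolding graph_def by (intro pair.vs.span_minimal)
  with assms show ?thesis by blast
qed

lemma graph_kernel_orthogonal_top:
  assumes "(0, P) \<in> graph"
  shows "fock P model_top = 0"
proof -
  obtain b where b: "0 - scale b v \<in> deep" "fock P model_top = b * fock model_top model_top"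
    using graph_top_component[OF assms] by blast
  have "scale b v \<in> deep" using vs.subspace_neg[OF subspace_deep b(1)] by simp
  thus ?thesis using hw_not_deep b by simp
qed

lemma graph_kernel_orthogonal_word:
  "lower_word n ws \<Longrightarrow> (0, P) \<in> graph \<Longrightarrow> fock P (word_act n (gl_act n) ws model_top) = 0"
proof (induction ws arbitrary: P)
  case Nil
  thus ?case by (simp add: graph_kernel_orthogonal_top)
next
  case (Cons p ws)
  obtain i j where p: "p = (i, j)" by fastforce
  hence ij: "j < i" "i \<le> n" and ws: "lower_word n ws" using Cons by auto
  have "(0, gl_act n (munit n j i) P) \<in> graph"
    using graph_act[OF munit_sl Cons.prems(2), of j i] ij act_0[OF munit_sl] by simp
  hence "fock (gl_act n (munit n j i) P) (word_act n (gl_act n) ws model_top) = 0"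
    using Cons.IH ws by blast
  thus ?case using fock_munit[of j n i P] ij p by simp
qed

text \<open>The kernel is invariant and orthogonal to \<open>model_top\<close>, hence to everything that \<open>model_top\<close>
  generates. But it is contained in that, and the inner product is definite.\<close>

lemma graph_kernel_trivial:
  assumes "(0, P) \<in> graph"
  shows "P = 0"
proof -
  have "pair.vs.subspace {(x, Q). fock P Q = 0}"
    by (rule pair.vs.subspaceI) (auto simp: zero_prod_def fock_add_right fock_Const_right)
  moreover have "pair.words \<subseteq> {(x, Q). fock P Q = 0}"
    using graph_kernel_orthogonal_word assms by (auto simp: pair.words_def word_act2)
  ultimately have "graph \<subseteq> {(x, Q). fock P Q = 0}"
    unfolding graph_def by (intro pair.vs.span_minimal)
  with assms show ?thesis using fock_definite by blast
qed

lemma graph_unique: "(x, P) \<in> graph \<Longrightarrow> (x, Q) \<in> graph \<Longrightarrow> P = Q"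
  using graph_add[OF _ graph_scale[of x Q "-1"], of x P] graph_kernel_trivial[of "P - Q"]
  by (simp add: Const_uminus)

definition to_model :: "'v \<Rightarrow> (nat \<times> nat) mpoly" where
  "to_model x = (THE P. (x, P) \<in> graph)"

lemma to_model_eq: "(x, P) \<in> graph \<Longrightarrow> to_model x = P"
  unfolding to_model_def using graph_unique by blast

lemma to_model_graph: "x \<in> V \<Longrightarrow> (x, to_model x) \<in> graph"
  using graph_total to_model_eq by metis

lemma to_model_add: "x \<in> V \<Longrightarrow> y \<in> V \<Longrightarrow> to_model (x + y) = to_model x + to_model y"
  and to_model_scale: "x \<in> V \<Longrightarrow> to_model (scale c x) = Const c * to_model x"
  and to_model_act: "X \<in> sl n \<Longrightarrow> x \<in> V \<Longrightarrow> to_model (\<rho> X x) = gl_act n X (to_model x)"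
  and to_model_word: "lower_word n ws \<Longrightarrow> to_model (word_act n \<rho> ws v) = word_act n (gl_act n) ws model_top"
  by (intro to_model_eq graph_add graph_scale graph_act graph_word to_model_graph; assumption)+

lemma to_model_0: "to_model 0 = 0"
  by (rule to_model_eq[OF graph_zero])

lemma to_model_funpow:
  assumes "X \<in> sl n" "x \<in> V"
  shows "to_model ((\<rho> X ^^ k) x) = (gl_act n X ^^ k) (to_model x) \<and> (\<rho> X ^^ k) x \<in> V"
  using assms by (induction k) (auto simp: to_model_act act_closed)

lemma to_model_inj:
  assumes "x \<in> V" "to_model x = 0"
  shows "x = 0"
proof -
  let ?W = "{x \<in> V. to_model x = 0}"
  have "vs.subspace ?W"
    using subspace_V by (auto simp: vs.subspace_def to_model_0 to_model_add to_model_scale)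
  moreover have "\<forall>X\<in>sl n. \<forall>x\<in>?W. \<rho> X x \<in> ?W" by (auto simp: to_model_act act_closed)
  moreover have "v \<notin> ?W" using to_model_word[of "[]"] model_top_nonzero by simp
  hence "?W \<noteq> V" using hw_V by blast
  moreover have "?W \<subseteq> V" by blast
  ultimately have "?W = {0}" using irreducible unfolding irreducible_module_def by blast
  thus ?thesis using assms by blast
qed

end

section \<open>Invariance under the group and under its Lie algebra\<close>

lemma unipotent_minus_one_support:
  assumes u: "u \<in> U'_minus n" and ij: "i \<le> n" "j \<le> n" and ne: "(u - 1\<^sub>m (n + 1)) $$ (i, j) \<noteq> 0"
  shows "j < i \<and> i < n"
proof (rule ccontr)
  assume *: "\<not> (j < i \<and> i < n)"
  have "(u - 1\<^sub>m (n + 1)) $$ (i, j) = u $$ (i, j) - (if i = j then 1 else 0)"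
    using ij by simp
  also have "\<dots> = 0" using u ij * by (cases "i = j") (auto simp: U'_minus_def)
  finally show False using ne by simp
qed

lemma unipotent_minus_one_power:
  assumes u: "u \<in> U'_minus n" and "i \<le> n" "j \<le> n"
    and "((u - 1\<^sub>m (n + 1)) ^\<^sub>m Suc k) $$ (i, j) \<noteq> 0"
  shows "j < i \<and> i < n"
  using assms(2-4)
proof (induction k arbitrary: j)
  case 0
  have "u \<in> carrier_mat (n + 1) (n + 1)" using u by (simp add: U'_minus_def)
  hence "(u - 1\<^sub>m (n + 1)) ^\<^sub>m Suc 0 = u - 1\<^sub>m (n + 1)" by auto
  with 0 show ?case using unipotent_minus_one_support[OF u] by metis
next
  case (Suc k)
  let ?N = "u - 1\<^sub>m (n + 1)"
  have N: "?N \<in> carrier_mat (n + 1) (n + 1)" by auto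
  have "(?N ^\<^sub>m Suc (Suc k)) $$ (i, j) = (\<Sum>l<n + 1. (?N ^\<^sub>m Suc k) $$ (i, l) * ?N $$ (l, j))"
    using Suc.prems index_mult_sum[OF pow_carrier_mat[OF N, of "Suc k"] N, of i j] by simp
  with Suc.prems obtain l where l: "l < n + 1" "(?N ^\<^sub>m Suc k) $$ (i, l) * ?N $$ (l, j) \<noteq> 0"
    by (metis (no_types, lifting) lessThan_iff sum.neutral)
  have "(?N ^\<^sub>m Suc k) $$ (i, l) \<noteq> 0" "?N $$ (l, j) \<noteq> 0" using l(2) by (metis mult_zero_left, metis mult_zero_right)
  hence "l < i \<and> i < n" "j < l"
    using Suc.IH[of l] Suc.prems l(1) unipotent_minus_one_support[OF u, of l j] by simp_all
  moreover have "j < l" by fact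
  ultimately show ?case by simp
qed

lemma unipotent_log_support:
  assumes u: "u \<in> U'_minus n" and "i \<le> n" "j \<le> n" and ne: "unipotent_log n u $$ (i, j) \<noteq> 0"
  shows "j < i \<and> i < n"
proof -
  have "unipotent_log n u $$ (i, j) =
    (\<Sum>k=1..n. (-1) ^ (k + 1) / of_nat k * ((u - 1\<^sub>m (n + 1)) ^\<^sub>m k) $$ (i, j))"
    using assms by (simp add: unipotent_log_def)
  with ne obtain k where "k \<in> {1..n}" "((u - 1\<^sub>m (n + 1)) ^\<^sub>m k) $$ (i, j) \<noteq> 0"
    by (metis (no_types, lifting) mult_zero_right sum.neutral)
  thus ?thesis
    using unipotent_minus_one_power[OF u assms(2,3), of "k - 1"] by simp
qed

lemma unipotent_log_sl:
  assumes "u \<in> U'_minus n"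
  shows "unipotent_log n u \<in> sl n"
proof -
  have "(\<Sum>i<n + 1. unipotent_log n u $$ (i, i)) = 0"
    using unipotent_log_support[OF assms] by (intro sum.neutral ballI) (metis Suc_eq_plus1 less_Suc_eq_le
      less_irrefl lessThan_iff)
  thus ?thesis by (simp add: sl_def unipotent_log_def)
qed

text \<open>For a square zero matrix the logarithm series stops after its first term.\<close>

lemma one_parameter_unipotent:
  assumes ij: "j < i" "i < n"
  shows "1\<^sub>m (n + 1) + t \<cdot>\<^sub>m munit n i j \<in> U'_minus n"
    and "unipotent_log n (1\<^sub>m (n + 1) + t \<cdot>\<^sub>m munit n i j) = t \<cdot>\<^sub>m munit n i j"
proof -
  let ?N = "t \<cdot>\<^sub>m munit n i j" and ?u = "1\<^sub>m (n + 1) + t \<cdot>\<^sub>m munit n i j"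
  show "?u \<in> U'_minus n" using ij by (auto simp: U'_minus_def)
  have N: "?N \<in> carrier_mat (n + 1) (n + 1)" by simp
  have uN: "?u - 1\<^sub>m (n + 1) = ?N" by (intro eq_matI) auto
  have sq: "?N * ?N = 0\<^sub>m (n + 1) (n + 1)"
  proof (rule eq_matI)
    fix a b assume "a < dim_row (0\<^sub>m (n + 1) (n + 1) :: complex mat)" "b < dim_col (0\<^sub>m (n + 1) (n + 1) :: complex mat)"
    hence ab: "a < n + 1" "b < n + 1" by auto
    have "(\<Sum>l<n + 1. ?N $$ (a, l) * ?N $$ (l, b)) = 0"
      using ab ij by (intro sum.neutral) auto
    thus "(?N * ?N) $$ (a, b) = 0\<^sub>m (n + 1) (n + 1) $$ (a, b)"
      using index_mult_sum[OF N N ab] ab by simp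
  qed (use N in auto)
  have pow: "?N ^\<^sub>m Suc k = (if k = 0 then ?N else 0\<^sub>m (n + 1) (n + 1))" for k
  proof (induction k)
    case 0
    show ?case using N by auto
  next
    case (Suc k)
    have "?N ^\<^sub>m Suc (Suc k) = ?N ^\<^sub>m Suc k * ?N" by simp
    thus ?case using Suc sq N by (auto simp: left_mult_zero_mat[OF N])
  qed
  show "unipotent_log n ?u = ?N"
  proof (rule eq_matI)
    fix a b assume "a < dim_row ?N" "b < dim_col ?N"
    hence ab: "a < n + 1" "b < n + 1" by auto
    have "(\<Sum>k=1..n. (-1) ^ (k + 1) / of_nat k * (?N ^\<^sub>m k) $$ (a, b)) =
      (\<Sum>k=1..n. if k = 1 then ?N $$ (a, b) else 0)"
    proof (intro sum.cong refl)
      fix k assume "k \<in> {1..n}"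
      then obtain k' where "k = Suc k'" by (cases k) auto
      thus "(-1) ^ (k + 1) / of_nat k * (?N ^\<^sub>m k) $$ (a, b) = (if k = 1 then ?N $$ (a, b) else 0)"
        using pow[of k'] ab by (auto simp del: index_smult_mat)
    qed
    also have "\<dots> = ?N $$ (a, b)" using ij by simp
    finally show "unipotent_log n ?u $$ (a, b) = ?N $$ (a, b)"
      unfolding unipotent_log_def uN using ab by simp
  qed (auto simp: unipotent_log_def)
qed

context irr_hw_mod
begin

text \<open>Pulled back from the model, where the height of monomials bounds the number of steps.\<close>

lemma lower_nilpotent:
  assumes X: "X \<in> sl n" and low: "\<And>i j. i \<le> n \<Longrightarrow> j \<le> n \<Longrightarrow> X $$ (i, j) \<noteq> 0 \<Longrightarrow> j < i" and x: "x \<in> V"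
  obtains K where "\<And>k. k \<ge> K \<Longrightarrow> (\<rho> X ^^ k) x = 0"
proof -
  obtain K where K: "\<forall>k\<ge>K. (gl_act n X ^^ k) (to_model x) = 0"
    using gl_act_lower_nilpotent[OF low] by blast
  hence "(\<rho> X ^^ k) x = 0" if "k \<ge> K" for k
    using to_model_funpow[OF X x, of k] to_model_inj that by simp
  thus ?thesis by (rule that)
qed

lemma dual_add: "\<omega> \<in> dual scale V \<Longrightarrow> x \<in> V \<Longrightarrow> y \<in> V \<Longrightarrow> \<omega> (x + y) = \<omega> x + \<omega> y"
  and dual_scale: "\<omega> \<in> dual scale V \<Longrightarrow> x \<in> V \<Longrightarrow> \<omega> (scale c x) = c * \<omega> x"
  by (auto simp: dual_def)

lemma dual_0: "\<omega> \<in> dual scale V \<Longrightarrow> \<omega> 0 = 0"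
  using dual_scale[of \<omega> 0 0] zero_V by simp

lemma dual_sum:
  assumes "\<omega> \<in> dual scale V" "\<And>k. k \<in> A \<Longrightarrow> f k \<in> V"
  shows "\<omega> (sum f A) = (\<Sum>k\<in>A. \<omega> (f k))"
  using assms
proof (induction A rule: infinite_finite_induct)
  case (insert k A)
  have "sum f A \<in> V" using insert vs.subspace_sum[OF subspace_V] by blast
  thus ?case using insert by (simp add: dual_add)
qed (auto simp: dual_0)

text \<open>Invariance under the Lie algebra of \<open>U'_minus n\<close>, expressed on its basis of matrix units.\<close>

definition kills_lower_block :: "('v \<Rightarrow> complex) \<Rightarrow> bool" where
  "kills_lower_block \<omega> \<longleftrightarrow> (\<forall>i j. j < i \<longrightarrow> i < n \<longrightarrow> (\<forall>x\<in>V. \<omega> (\<rho> (munit n i j) x) = 0))"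

text \<open>The definition sums over the exponents with nonzero terms. Nilpotency makes this a finite set, and
  then the sum may be extended by zero terms.\<close>

lemma dual_nilpotent_exp:
  assumes \<omega>: "\<omega> \<in> dual scale V" and X: "X \<in> sl n" and x: "x \<in> V"
    and K: "\<And>k. k > K \<Longrightarrow> (\<rho> X ^^ k) x = 0"
  shows "\<omega> (nilpotent_exp scale (\<rho> X) x) = (\<Sum>k\<le>K. 1 / fact k * \<omega> ((\<rho> X ^^ k) x))"
proof -
  have mem: "(\<rho> X ^^ k) x \<in> V" for k using to_model_funpow[OF X x] by blast
  have "nilpotent_exp scale (\<rho> X) x = (\<Sum>k\<le>K. scale (1 / fact k) ((\<rho> X ^^ k) x))"
    unfolding nilpotent_exp_def using K
    by (intro sum.mono_neutral_left) (auto simp: not_less[symmetric])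
  thus ?thesis
    using mem vs.subspace_scale[OF subspace_V] by (simp add: dual_sum[OF \<omega>] dual_scale[OF \<omega>])
qed

text \<open>Along a one-parameter subgroup, invariance says that a polynomial in the parameter is constant. Its
  linear coefficient is the claim.\<close>

lemma dual_invariants_imp_kills:
  assumes \<omega>: "\<omega> \<in> dual_invariants n scale V \<rho>"
  shows "kills_lower_block \<omega>"
  unfolding kills_lower_block_def
proof (intro allI impI ballI)
  fix i j x assume ij: "j < i" "i < n" and x: "x \<in> V"
  have d: "\<omega> \<in> dual scale V" using \<omega> by (simp add: dual_invariants_def)
  let ?U = "munit n i j"
  have U: "?U \<in> sl n" using ij by (intro munit_sl) auto
  have mem: "(\<rho> ?U ^^ k) x \<in> V" for k using to_model_funpow[OF U x] by blast
  obtain K0 where K0: "\<And>k. k \<ge> K0 \<Longrightarrow> (\<rho> ?U ^^ k) x = 0"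
    by (rule lower_nilpotent[OF U _ x]) (use ij in \<open>auto split: if_splits\<close>)
  define K where "K = Suc K0"
  have pow: "(\<rho> (t \<cdot>\<^sub>m ?U) ^^ k) x = scale (t ^ k) ((\<rho> ?U ^^ k) x)" for t k
  proof (induction k)
    case (Suc k)
    show ?case
      using Suc mem[of k] vs.subspace_scale[OF subspace_V mem[of k]]
      by (simp add: act_smult_mat[OF U] act_scale[OF U] mult.commute)
  qed simp
  have eq: "(\<Sum>k\<le>K. (if k = 0 then 0 else 1 / fact k * \<omega> ((\<rho> ?U ^^ k) x)) * t ^ k) = 0" for t
  proof -
    have "\<omega> x = \<omega> (nilpotent_exp scale (\<rho> (t \<cdot>\<^sub>m ?U)) x)"
      using \<omega> one_parameter_unipotent[OF ij, of t] x by (auto simp: dual_invariants_def group_act_def)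
    also have "\<dots> = (\<Sum>k\<le>K. 1 / fact k * \<omega> ((\<rho> (t \<cdot>\<^sub>m ?U) ^^ k) x))"
      using sl_smult[OF U] K0 by (intro dual_nilpotent_exp[OF d _ x]) (auto simp: pow K_def)
    also have "\<dots> = (\<Sum>k\<le>K. 1 / fact k * \<omega> ((\<rho> ?U ^^ k) x) * t ^ k)"
      by (intro sum.cong) (auto simp: pow dual_scale[OF d mem])
    also have "\<dots> = (\<Sum>k\<le>K. (if k = 0 then \<omega> x else 0) +
       (if k = 0 then 0 else 1 / fact k * \<omega> ((\<rho> ?U ^^ k) x)) * t ^ k)"
      by (intro sum.cong) auto
    finally show ?thesis by (simp add: sum.distrib)
  qed
  have "(if (1::nat) = 0 then 0 else 1 / fact 1 * \<omega> ((\<rho> ?U ^^ 1) x)) = 0"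
    by (rule zero_polynom_imp_zero_coeffs[of _ K]) (use eq in \<open>auto simp: K_def\<close>)
  thus "\<omega> (\<rho> ?U x) = 0" by simp
qed

text \<open>The logarithm of a group element is a combination of units of the lower block, so \<open>\<omega>\<close> kills all terms
  of the exponential series except the first.\<close>

lemma kills_imp_dual_invariants:
  assumes \<omega>: "\<omega> \<in> dual scale V" and kills: "kills_lower_block \<omega>"
  shows "\<omega> \<in> dual_invariants n scale V \<rho>"
proof -
  have "\<omega> (group_act n scale \<rho> u x) = \<omega> x" if u: "u \<in> U'_minus n" and x: "x \<in> V" for u x
  proof -
    let ?X = "unipotent_log n u"
    have X: "?X \<in> sl n" using u by (rule unipotent_log_sl)
    have mem: "(\<rho> ?X ^^ k) x \<in> V" for k using to_model_funpow[OF X x] by blast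
    have sub: "vs.subspace {y \<in> V. \<omega> y = 0}"
      using subspace_V by (auto simp: vs.subspace_def dual_0[OF \<omega>] dual_add[OF \<omega>] dual_scale[OF \<omega>])
    have zero: "\<omega> (\<rho> ?X y) = 0" if y: "y \<in> V" for y
    proof -
      have diag: "mat (n + 1) (n + 1) (\<lambda>(a, b). if a = b then ?X $$ (a, b) else 0) = 0\<^sub>m (n + 1) (n + 1)"
      proof (rule eq_matI)
        fix a b assume "a < dim_row (0\<^sub>m (n + 1) (n + 1) :: complex mat)" "b < dim_col (0\<^sub>m (n + 1) (n + 1) :: complex mat)"
        thus "mat (n + 1) (n + 1) (\<lambda>(a, b). if a = b then ?X $$ (a, b) else 0) $$ (a, b) = 0\<^sub>m (n + 1) (n + 1) $$ (a, b)"
          using unipotent_log_support[OF u, of a a] by auto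
      qed auto
      have "\<rho> ?X y \<in> {y \<in> V. \<omega> y = 0}"
      proof (rule act_mem_of_units[OF X y sub])
        show "\<rho> (munit n i j) y \<in> {y \<in> V. \<omega> y = 0}"
          if "i \<le> n" "j \<le> n" "i \<noteq> j" "?X $$ (i, j) \<noteq> 0" for i j
          using unipotent_log_support[OF u that(1,2,4)] kills y act_closed[OF munit_sl[OF that(3)] y]
          by (auto simp: kills_lower_block_def)
        show "\<rho> (mat (n + 1) (n + 1) (\<lambda>(a, b). if a = b then ?X $$ (a, b) else 0)) y \<in> {y \<in> V. \<omega> y = 0}"
          unfolding diag using act_zero_mat[OF y] zero_V by (simp add: dual_0[OF \<omega>])
      qed
      thus ?thesis by simp
    qed
    obtain K where K: "\<And>k. k \<ge> K \<Longrightarrow> (\<rho> ?X ^^ k) x = 0"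
      using lower_nilpotent[OF X _ x] unipotent_log_support[OF u] by blast
    have "\<omega> (nilpotent_exp scale (\<rho> ?X) x) = (\<Sum>k\<le>K. 1 / fact k * \<omega> ((\<rho> ?X ^^ k) x))"
      using K by (intro dual_nilpotent_exp[OF \<omega> X x]) auto
    also have "\<dots> = (\<Sum>k\<le>K. if k = 0 then \<omega> x else 0)"
    proof (intro sum.cong refl)
      fix k
      show "1 / fact k * \<omega> ((\<rho> ?X ^^ k) x) = (if k = 0 then \<omega> x else 0)"
        using zero[OF mem[of "k - 1"]] by (cases k) auto
    qed
    finally show ?thesis by (simp add: group_act_def)
  qed
  thus ?thesis using \<omega> by (simp add: dual_invariants_def)
qed

end

section \<open>Exponent tuples and words\<close>

text \<open>Lower matrix units correspond to positive roots \<open>\<alpha>\<close>, as root vectors for \<open>-\<alpha>\<close>.\<close>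

definition letters :: "nat \<Rightarrow> (nat \<times> nat) set" where
  "letters n = {(i, j). j < i \<and> i \<le> n}"

definition letter_root :: "nat \<Rightarrow> nat \<times> nat \<Rightarrow> weight" where
  "letter_root n p = eps n (snd p + 1) - eps n (fst p + 1)"

lemma letter_root_powers:
  "p \<in> letters n \<Longrightarrow> letter_root n p (powers n) = 2 ^ snd p - 2 ^ fst p"
  using powers_cartan[of n] powers_diff[of "snd p" n "fst p"]
  by (auto simp: letter_root_def letters_def eps_def)

lemma letter_root_bij: "bij_betw (letter_root n) (letters n) (pos_roots n)"
proof (rule bij_betw_imageI)
  show "inj_on (letter_root n) (letters n)"
  proof (rule inj_onI)
    fix p q assume pq: "p \<in> letters n" "q \<in> letters n" "letter_root n p = letter_root n q"
    hence "(2::complex) ^ snd p - 2 ^ fst p = 2 ^ snd q - 2 ^ fst q"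
      using letter_root_powers by metis
    moreover have "snd q \<noteq> fst q" using pq by (auto simp: letters_def)
    ultimately show "p = q" using powers_diff_inj by (metis prod.inject prod.collapse)
  qed
  show "letter_root n ` letters n = pos_roots n"
  proof (intro equalityI subsetI)
    fix \<alpha> assume "\<alpha> \<in> letter_root n ` letters n"
    then obtain i j where "j < i" "i \<le> n" "\<alpha> = eps n (j + 1) - eps n (i + 1)"
      by (auto simp: letters_def letter_root_def)
    thus "\<alpha> \<in> pos_roots n"
      unfolding pos_roots_def by (intro CollectI exI[of _ "j + 1"] exI[of _ "i + 1"]) auto
  next
    fix \<alpha> assume "\<alpha> \<in> pos_roots n"
    then obtain i j where ij: "1 \<le> i" "i < j" "j \<le> n + 1" "\<alpha> = eps n i - eps n j"
      by (auto simp: pos_roots_def)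
    thus "\<alpha> \<in> letter_root n ` letters n"
      by (intro image_eqI[of _ _ "(j - 1, i - 1)"]) (auto simp: letters_def letter_root_def)
  qed
qed

lemma finite_letters: "finite (letters n)"
  by (rule finite_subset[of _ "{..n} \<times> {..n}"]) (auto simp: letters_def)

lemma finite_pos_roots: "finite (pos_roots n)"
  using letter_root_bij finite_letters bij_betw_finite by blast

definition root_letter :: "nat \<Rightarrow> weight \<Rightarrow> nat \<times> nat" where
  "root_letter n = inv_into (letters n) (letter_root n)"

lemma root_letter_mem: "\<alpha> \<in> pos_roots n \<Longrightarrow> root_letter n \<alpha> \<in> letters n"
  and letter_root_letter: "\<alpha> \<in> pos_roots n \<Longrightarrow> letter_root n (root_letter n \<alpha>) = \<alpha>"
  and root_letter_root: "p \<in> letters n \<Longrightarrow> root_letter n (letter_root n p) = p"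
  using bij_betw_inv_into_right[OF letter_root_bij] bij_betw_inv_into_left[OF letter_root_bij]
    bij_betwE[OF bij_betw_inv_into[OF letter_root_bij]]
  by (auto simp: root_letter_def)

lemma letter_root_mem: "p \<in> letters n \<Longrightarrow> letter_root n p \<in> pos_roots n"
  using bij_betwE[OF letter_root_bij] by blast

lemma lower_word_letters: "lower_word n ws \<longleftrightarrow> set ws \<subseteq> letters n"
  by (auto simp: lower_word_def letters_def)

text \<open>The word whose letters are the root vectors in \<open>signature_vector\<close>, up to scalars.\<close>

definition root_word :: "nat \<Rightarrow> weight list \<Rightarrow> exponents \<Rightarrow> (nat \<times> nat) list" where
  "root_word n rs p = concat (map (\<lambda>\<alpha>. replicate (p \<alpha>) (root_letter n \<alpha>)) rs)"

lemma lower_root_word: "set rs \<subseteq> pos_roots n \<Longrightarrow> lower_word n (root_word n rs p)"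
  using root_letter_mem by (auto simp: lower_word_letters root_word_def)

lemma count_root_word:
  assumes "distinct rs" "set rs = pos_roots n" "q \<in> letters n"
  shows "count (mset (root_word n rs p)) q = p (letter_root n q)"
proof -
  have "count (mset (root_word n rs' p)) q = (if letter_root n q \<in> set rs' then p (letter_root n q) else 0)"
    if "distinct rs'" "set rs' \<subseteq> pos_roots n" for rs'
    using that
  proof (induction rs')
    case (Cons \<alpha> rs')
    have "root_letter n \<alpha> = q \<longleftrightarrow> \<alpha> = letter_root n q"
      using Cons.prems letter_root_letter[of \<alpha> n] root_letter_root[OF assms(3)] by auto
    thus ?case using Cons by (auto simp: root_word_def)
  qed (simp add: root_word_def)
  thus ?thesis using assms letter_root_mem by auto
qed

lemma length_root_word:
  assumes "distinct rs" "set rs = pos_roots n"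
  shows "length (root_word n rs p) = (\<Sum>\<alpha>\<in>pos_roots n. p \<alpha>)"
  using assms by (simp add: root_word_def length_concat comp_def sum_list_distinct_conv_sum_set)

text \<open>The exponents of \<open>last_row_word n c\<close>, that is \<open>c k\<close> at \<open>\<epsilon>\<^sub>k - \<epsilon>\<^sub>n\<^sub>+\<^sub>1\<close>.\<close>

definition last_row_exponents :: "nat \<Rightarrow> (nat \<Rightarrow> nat) \<Rightarrow> exponents" where
  "last_row_exponents n c = (\<lambda>\<beta>. \<Sum>k=1..n. c k * unit_exponent (eps n k - eps n (n + 1)) \<beta>)"

lemma last_row_root: "k \<in> {1..n} \<Longrightarrow> eps n k - eps n (n + 1) = letter_root n (n, k - 1) \<and> (n, k - 1) \<in> letters n"
  by (auto simp: letter_root_def letters_def)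

lemma last_row_exponents_root:
  assumes "q \<in> letters n"
  shows "last_row_exponents n c (letter_root n q) = (if fst q = n then c (snd q + 1) else 0)"
proof -
  have "last_row_exponents n c (letter_root n q) =
    (\<Sum>k=1..n. if k = snd q + 1 then (if fst q = n then c (snd q + 1) else 0) else 0)"
    unfolding last_row_exponents_def
  proof (intro sum.cong refl)
    fix k assume k: "k \<in> {1..n}"
    have "letter_root n q = eps n k - eps n (n + 1) \<longleftrightarrow> q = (n, k - 1)"
      using last_row_root[OF k] assms root_letter_root by metis
    thus "c k * unit_exponent (eps n k - eps n (n + 1)) (letter_root n q) =
      (if k = snd q + 1 then (if fst q = n then c (snd q + 1) else 0) else 0)"
      using k by (cases q) (auto simp: unit_exponent_def)
  qed
  also have "\<dots> = (if fst q = n then c (snd q + 1) else 0)"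
    using assms by (auto simp: letters_def)
  finally show ?thesis .
qed

lemma last_row_exponents_outside:
  assumes "\<beta> \<notin> pos_roots n"
  shows "last_row_exponents n c \<beta> = 0"
  unfolding last_row_exponents_def
proof (intro sum.neutral ballI)
  fix k assume "k \<in> {1..n}"
  hence "eps n k - eps n (n + 1) \<in> pos_roots n" using last_row_root letter_root_mem by metis
  thus "c k * unit_exponent (eps n k - eps n (n + 1)) \<beta> = 0"
    using assms by (auto simp: unit_exponent_def)
qed

lemma count_mset_notin: "q \<notin> set ws \<Longrightarrow> count (mset ws) q = 0"
  by (metis count_eq_zero_iff set_mset_mset)

lemma mset_last_row_word_eqI:
  assumes "set ws \<subseteq> {n} \<times> {..<n}" "\<And>k. k \<in> {1..n} \<Longrightarrow> count (mset ws) (n, k - 1) = c k"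
  shows "mset ws = mset (last_row_word n c)"
proof (rule multiset_eqI)
  fix q
  show "count (mset ws) q = count (mset (last_row_word n c)) q"
  proof (cases "q \<in> {n} \<times> {..<n}")
    case True
    then obtain l where "q = (n, l)" "l < n" by auto
    thus ?thesis
      using assms(2)[of "l + 1"] count_last_row_word[of "l + 1" n c] by simp
  next
    case False
    hence "q \<notin> set ws" "q \<notin> set (last_row_word n c)" using assms(1) last_row_word_set by blast+
    thus ?thesis by (metis count_mset_notin)
  qed
qed

lemma linear_order_finite_least:
  assumes r: "linear_order_on A r" and "finite S" "S \<noteq> {}" "S \<subseteq> A"
  shows "\<exists>m\<in>S. \<forall>s\<in>S. (m, s) \<in> r"
  using assms(2-4)
proof (induction S rule: finite_ne_induct)
  case (singleton x)
  thus ?case using r by (auto simp: order_on_defs refl_on_def)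
next
  case (insert x S)
  then obtain m where m: "m \<in> S" "\<forall>s\<in>S. (m, s) \<in> r" by auto
  have refl: "(x, x) \<in> r" using insert r by (auto simp: order_on_defs refl_on_def)
  have "x \<noteq> m" using m insert by auto
  hence "(x, m) \<in> r \<or> (m, x) \<in> r"
    using insert m r by (auto simp: order_on_defs total_on_def)
  thus ?case
  proof
    assume xm: "(x, m) \<in> r"
    have "trans r" using r by (auto simp: order_on_defs)
    hence "\<forall>s\<in>S. (x, s) \<in> r" using m xm by (meson transD)
    thus ?thesis using refl by auto
  next
    assume "(m, x) \<in> r"
    thus ?thesis using m by auto
  qed
qed

context sl_mod
begin

lemma act_lower_commute:
  assumes "j < i" "i \<le> n" "l < k" "k \<le> n" and x: "x \<in> V"
  shows "\<rho> (munit n i j) (\<rho> (munit n k l) x) = \<rho> (munit n k l) (\<rho> (munit n i j) x) +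
    (if j = k then \<rho> (munit n i l) x else if l = i then - \<rho> (munit n k j) x else 0)"
proof -
  have sl: "munit n i j \<in> sl n" "munit n k l \<in> sl n" using assms by (auto intro!: munit_sl)
  have eq: "\<rho> (munit n i j) (\<rho> (munit n k l) x) =
    \<rho> (munit n k l) (\<rho> (munit n i j) x) + \<rho> (bracket (munit n i j) (munit n k l)) x"
    using act_bracket[OF sl x] by simp
  consider "j = k" | "j \<noteq> k" "l = i" | "j \<noteq> k" "l \<noteq> i" by blast
  hence "\<rho> (bracket (munit n i j) (munit n k l)) x =
    (if j = k then \<rho> (munit n i l) x else if l = i then - \<rho> (munit n k j) x else 0)"
  proof cases
    case 1
    have "bracket (munit n i j) (munit n k l) = munit n i l"
      using 1 assms by (subst bracket_munit) (auto intro!: eq_matI)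
    thus ?thesis using 1 by simp
  next
    case 2
    have "bracket (munit n i j) (munit n k l) = (-1) \<cdot>\<^sub>m munit n k j"
      using 2 assms by (subst bracket_munit) (auto intro!: eq_matI)
    moreover have "munit n k j \<in> sl n" using 2 assms by (intro munit_sl) auto
    ultimately show ?thesis using 2 act_smult_mat[OF _ x, of "munit n k j" "-1"] by simp
  next
    case 3
    have "bracket (munit n i j) (munit n k l) = 0\<^sub>m (n + 1) (n + 1)"
      using 3 assms by (subst bracket_munit) (auto intro!: eq_matI)
    thus ?thesis using 3 act_zero_mat[OF x] by simp
  qed
  with eq show ?thesis by simp
qed

lemma signature_vector_root_word:
  assumes e: "\<And>\<alpha>. \<alpha> \<in> pos_roots n \<Longrightarrow> e (- \<alpha>) \<in> root_space n (- \<alpha>) - {0\<^sub>m (n + 1) (n + 1)}"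
    and rs: "set rs \<subseteq> pos_roots n" and x: "x \<in> V"
  shows "\<exists>t. t \<noteq> 0 \<and> signature_vector rs e \<rho> x p = scale t (word_act n \<rho> (root_word n rs p) x)"
  using rs
proof (induction rs)
  case Nil
  show ?case by (auto simp: signature_vector_def root_word_def intro!: exI[of _ 1])
next
  case (Cons \<alpha> rs)
  then obtain t where t: "t \<noteq> 0" "signature_vector rs e \<rho> x p = scale t (word_act n \<rho> (root_word n rs p) x)"
    by auto
  obtain i j where ij: "root_letter n \<alpha> = (i, j)" by fastforce
  have \<alpha>: "\<alpha> \<in> pos_roots n" using Cons by simp
  hence l: "j < i" "i \<le> n" using root_letter_mem[of \<alpha> n] ij by (auto simp: letters_def)
  have "\<alpha> = eps n (j + 1) - eps n (i + 1)"
    using letter_root_letter[OF \<alpha>] ij by (simp add: letter_root_def)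
  hence "e (- \<alpha>) = e (- \<alpha>) $$ (i, j) \<cdot>\<^sub>m munit n i j"
    using e[OF \<alpha>] l by (intro root_space_unit) auto
  moreover define s where "s = e (- \<alpha>) $$ (i, j)"
  ultimately have es: "e (- \<alpha>) = s \<cdot>\<^sub>m munit n i j" by (simp only:)
  have "s \<noteq> 0"
  proof
    assume "s = 0"
    hence "e (- \<alpha>) = 0\<^sub>m (n + 1) (n + 1)" unfolding es by (intro eq_matI) auto
    thus False using e[OF \<alpha>] by simp
  qed
  have U: "munit n i j \<in> sl n" using l by (intro munit_sl) auto
  let ?w = "word_act n \<rho> (root_word n rs p) x"
  have w: "?w \<in> V" using Cons x by (intro word_act_closed lower_root_word) auto
  have mem: "word_act n \<rho> (replicate m (i, j)) ?w \<in> V" for m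
    using l by (intro word_act_closed[OF _ w]) (auto simp: lower_word_def)
  have pow: "(\<rho> (e (- \<alpha>)) ^^ m) (scale t ?w) = scale (s ^ m * t) (word_act n \<rho> (replicate m (i, j)) ?w)" for m
    unfolding es
  proof (induction m)
    case (Suc m)
    thus ?case
      using mem[of m] vs.subspace_scale[OF subspace_V mem[of m]] act_smult_mat[OF U] act_scale[OF U]
      by (simp add: mult_ac)
  qed simp
  have "signature_vector (\<alpha> # rs) e \<rho> x p = (\<rho> (e (- \<alpha>)) ^^ p \<alpha>) (signature_vector rs e \<rho> x p)"
    by (simp add: signature_vector_def)
  also have "\<dots> = scale (s ^ p \<alpha> * t) (word_act n \<rho> (root_word n (\<alpha> # rs) p) x)"
    unfolding t(2) pow by (simp add: root_word_def ij)
  finally show ?case using \<open>s \<noteq> 0\<close> t(1) by (intro exI[of _ "s ^ p \<alpha> * t"]) simp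
qed

end

context irr_hw_mod
begin

text \<open>The familiar relation for an integrable highest weight module, read off in the model.\<close>

lemma simple_lower_power_hw:
  assumes "1 \<le> k" "k \<le> n"
  shows "(\<rho> (munit n k (k - 1)) ^^ (a k + 1)) v = 0"
proof (rule to_model_inj)
  have U: "munit n k (k - 1) \<in> sl n" using assms by (intro munit_sl) auto
  note * = to_model_funpow[OF U hw_V, of "a k + 1"]
  thus "(\<rho> (munit n k (k - 1)) ^^ (a k + 1)) v \<in> V" by blast
  have "to_model v = model_top" using to_model_word[of "[]"] by simp
  thus "to_model ((\<rho> (munit n k (k - 1)) ^^ (a k + 1)) v) = 0"
    using * simple_lower_model_top[OF assms] by simp
qed

end

section \<open>The sign of an invariant functional\<close>

locale invariant_functional = irr_hw_mod n scale V \<rho> \<Lambda> v a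
  for n :: nat and scale :: "complex \<Rightarrow> 'v::ab_group_add \<Rightarrow> 'v" and V :: "'v set"
    and \<rho> :: "complex mat \<Rightarrow> 'v \<Rightarrow> 'v" and \<Lambda> :: weight and v :: 'v and a :: "nat \<Rightarrow> nat" +
  fixes \<omega> :: "'v \<Rightarrow> complex"
  assumes dual: "\<omega> \<in> dual scale V" and kills: "kills_lower_block \<omega>"
    and nonzero: "\<exists>x\<in>V. \<omega> x \<noteq> 0"
begin

lemma kill: "j < i \<Longrightarrow> i < n \<Longrightarrow> x \<in> V \<Longrightarrow> \<omega> (\<rho> (munit n i j) x) = 0"
  using kills by (simp add: kills_lower_block_def)

definition word_value :: "(nat \<times> nat) list \<Rightarrow> complex" where
  "word_value ws = \<omega> (word_act n \<rho> ws v)"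

lemma word_value_nonzero: "\<exists>ws. lower_word n ws \<and> word_value ws \<noteq> 0"
proof (rule ccontr)
  assume "\<nexists>ws. lower_word n ws \<and> word_value ws \<noteq> 0"
  hence "words \<subseteq> {x \<in> V. \<omega> x = 0}"
    using words_V by (auto simp: words_def word_value_def)
  moreover have "vs.subspace {x \<in> V. \<omega> x = 0}"
    using subspace_V by (auto simp: vs.subspace_def dual_0[OF dual] dual_add[OF dual] dual_scale[OF dual])
  ultimately have "vs.span words \<subseteq> {x \<in> V. \<omega> x = 0}" by (intro vs.span_minimal)
  thus False using nonzero span_words_eq_V[OF irreducible] by auto
qed

text \<open>The degree at which the sign has to be sought: a homogeneous order compares degrees first, and
  \<open>\<omega>\<close> vanishes on all words that are shorter.\<close>

definition low_degree :: nat where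
  "low_degree = (LEAST d. \<exists>ws. lower_word n ws \<and> length ws = d \<and> word_value ws \<noteq> 0)"

lemma low_degree_attained: "\<exists>ws. lower_word n ws \<and> length ws = low_degree \<and> word_value ws \<noteq> 0"
proof -
  have "\<exists>d ws. lower_word n ws \<and> length ws = d \<and> word_value ws \<noteq> 0"
    using word_value_nonzero by blast
  from LeastI_ex[OF this] show ?thesis unfolding low_degree_def .
qed

lemma word_value_short: "lower_word n ws \<Longrightarrow> length ws < low_degree \<Longrightarrow> word_value ws = 0"
  unfolding low_degree_def using not_less_Least by blast

text \<open>The commutator of the two letters is a single letter up to sign, or zero, and \<open>\<omega>\<close> vanishes on the
  resulting shorter word.\<close>

lemma word_value_swap:
  assumes "lower_word n (us @ [p, q] @ zs)" "length (us @ [p, q] @ zs) = low_degree"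
  shows "word_value (us @ [p, q] @ zs) = word_value (us @ [q, p] @ zs)"
proof -
  obtain i j k l where pq: "p = (i, j)" "q = (k, l)" by (cases p; cases q)
  with assms have lt: "j < i" "i \<le> n" "l < k" "k \<le> n" and low: "lower_word n us" "lower_word n zs" by auto
  let ?z = "word_act n \<rho> zs v"
  have z: "?z \<in> V" using low by (intro word_act_closed hw_V)
  have mem: "\<rho> (munit n b c) x \<in> V" if "c < b" "x \<in> V" for b c x
    using that by (intro act_closed munit_sl) auto
  let ?r = "if j = k then \<rho> (munit n i l) ?z else if l = i then - \<rho> (munit n k j) ?z else 0"
  have r: "?r \<in> V"
    using lt z mem zero_V vs.subspace_neg[OF subspace_V] by auto
  have "word_value (us @ [p, q] @ zs) = \<omega> (word_act n \<rho> us (\<rho> (munit n k l) (\<rho> (munit n i j) ?z) + ?r))"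
    using act_lower_commute[OF lt z] by (simp add: word_value_def pq)
  also have "\<dots> = \<omega> (word_act n \<rho> us (\<rho> (munit n k l) (\<rho> (munit n i j) ?z))) + \<omega> (word_act n \<rho> us ?r)"
    using low lt z r mem by (simp add: word_act_add dual_add[OF dual] word_act_closed)
  also have "\<omega> (word_act n \<rho> us ?r) = 0"
  proof -
    have short: "\<omega> (word_act n \<rho> us (\<rho> (munit n b c) ?z)) = 0" if "c < b" "b \<le> n" for b c
      using word_value_short[of "us @ (b, c) # zs"] that low assms(2) by (simp add: word_value_def)
    have "\<omega> (word_act n \<rho> us (- \<rho> (munit n k j) ?z)) = 0" if "l = i"
    proof -
      have kj: "j < k" using that lt by simp
      have "word_act n \<rho> us (scale (-1) (\<rho> (munit n k j) ?z)) = scale (-1) (word_act n \<rho> us (\<rho> (munit n k j) ?z))"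
        using low mem[OF kj z] by (intro word_act_scale)
      thus ?thesis
        using short[OF kj lt(4)] low word_act_closed[OF low(1) mem[OF kj z]]
          dual_scale[OF dual, of "word_act n \<rho> us (\<rho> (munit n k j) ?z)" "-1"] by simp
    qed
    thus ?thesis using short[of l i] lt low by (auto simp: word_act_0 dual_0[OF dual])
  qed
  finally show ?thesis by (simp add: word_value_def pq)
qed

lemma word_value_move:
  assumes "lower_word n (us @ ys @ x # zs)" "length (us @ ys @ x # zs) = low_degree"
  shows "word_value (us @ ys @ x # zs) = word_value (us @ x # ys @ zs)"
  using assms
proof (induction ys arbitrary: us)
  case (Cons y ys)
  have "word_value (us @ (y # ys) @ x # zs) = word_value ((us @ [y]) @ x # ys @ zs)"
    using Cons.IH[of "us @ [y]"] Cons.prems by simp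
  also have "\<dots> = word_value (us @ [y, x] @ (ys @ zs))" by simp
  also have "\<dots> = word_value (us @ [x, y] @ (ys @ zs))"
    using Cons.prems by (intro word_value_swap) (auto simp: lower_word_letters)
  finally show ?case by simp
qed simp

lemma word_value_perm:
  assumes "lower_word n (us @ ws)" "length (us @ ws) = low_degree" "mset ws = mset ws'"
  shows "word_value (us @ ws) = word_value (us @ ws')"
  using assms
proof (induction ws arbitrary: us ws')
  case (Cons x ws)
  have "x \<in> set ws'" using Cons.prems(3) by (metis list.set_intros(1) set_mset_mset)
  then obtain ys zs where ws': "ws' = ys @ x # zs" by (meson split_list)
  have eq: "mset ws = mset (ys @ zs)" using Cons.prems(3) ws' by simp
  have set: "set ws = set (ys @ zs)" using eq by (metis set_mset_mset)
  have len: "length ws = length (ys @ zs)" using eq by (metis size_mset)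
  have "word_value (us @ x # ws) = word_value ((us @ [x]) @ ys @ zs)"
    using Cons.IH[of "us @ [x]" "ys @ zs"] Cons.prems eq by simp
  also have "\<dots> = word_value (us @ ys @ x # zs)"
    using word_value_move[of us ys x zs] Cons.prems set len by (simp add: lower_word_letters)
  finally show ?case using ws' by simp
qed simp

text \<open>A letter of the block could be moved to the front, where \<open>\<omega>\<close> kills its image.\<close>

lemma word_value_letter_last_row:
  assumes "lower_word n ws" "length ws = low_degree" "word_value ws \<noteq> 0"
  shows "set ws \<subseteq> {n} \<times> {..<n}"
proof
  fix p assume p: "p \<in> set ws"
  then obtain ys zs where ws: "ws = ys @ p # zs" by (meson split_list)
  obtain i j where ij: "p = (i, j)" by fastforce
  hence l: "j < i" "i \<le> n" using assms(1) ws by auto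
  have "word_value ws = word_value (p # ys @ zs)"
    using word_value_move[of "[]" ys p zs] assms ws by simp
  hence "\<omega> (\<rho> (munit n i j) (word_act n \<rho> (ys @ zs) v)) \<noteq> 0"
    using assms(3) ij by (simp add: word_value_def)
  moreover have "word_act n \<rho> (ys @ zs) v \<in> V"
    using assms(1) ws by (intro word_act_closed hw_V) (auto simp: lower_word_letters)
  ultimately have "\<not> i < n" using kill l by blast
  thus "p \<in> {n} \<times> {..<n}" using l ij by auto
qed

text \<open>The commutator of \<open>y = E\<^sub>n\<^sub>k\<close> and \<open>f = E\<^sub>k\<^sub>,\<^sub>k\<^sub>-\<^sub>1\<close> is \<open>z = E\<^sub>n\<^sub>,\<^sub>k\<^sub>-\<^sub>1\<close>, which commutes with \<open>y\<close>; so \<open>f\<close> acts on powers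
  of \<open>y\<close> as a derivation that takes \<open>y\<close> to \<open>z\<close>.\<close>

lemma act_last_row_power:
  assumes k: "1 \<le> k" "k < n" and x: "x \<in> V"
  shows "(\<rho> (munit n n k) ^^ m) (\<rho> (munit n k (k - 1)) x) =
    \<rho> (munit n k (k - 1)) ((\<rho> (munit n n k) ^^ m) x) +
    scale (of_nat m) ((\<rho> (munit n n k) ^^ (m - 1)) (\<rho> (munit n n (k - 1)) x))"
proof (induction m)
  case (Suc m)
  let ?y = "\<rho> (munit n n k)" and ?z = "\<rho> (munit n n (k - 1))" and ?f = "\<rho> (munit n k (k - 1))"
  have sl: "munit n n k \<in> sl n" "munit n n (k - 1) \<in> sl n" "munit n k (k - 1) \<in> sl n"
    using k by (auto intro!: munit_sl)
  have mem: "(?y ^^ m) u \<in> V" if "u \<in> V" for u m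
    using that sl(1) by (induction m) (auto intro: act_closed)
  have zx: "?z x \<in> V" using sl x by (intro act_closed)
  have yz: "?y (?z u) = ?z (?y u)" if "u \<in> V" for u
    using act_lower_commute[of k n "k - 1" n u] k that by simp
  have yf: "?y (?f u) = ?f (?y u) + ?z u" if "u \<in> V" for u
    using act_lower_commute[of k n "k - 1" k u] k that by simp
  have zy: "?z ((?y ^^ m) u) = (?y ^^ m) (?z u)" if "u \<in> V" for u m
  proof (induction m)
    case (Suc m)
    show ?case using yz[OF mem[OF that, of m]] Suc by simp
  qed simp
  have "(?y ^^ Suc m) (?f x) = ?y (?f ((?y ^^ m) x)) + scale (of_nat m) (?y ((?y ^^ (m - 1)) (?z x)))"
    using Suc mem x zx sl
    by (simp add: act_add[OF sl(1)] act_scale[OF sl(1)] act_closed vs.subspace_scale[OF subspace_V])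
  also have "?y (?f ((?y ^^ m) x)) = ?f ((?y ^^ Suc m) x) + (?y ^^ m) (?z x)"
    using yf[OF mem[OF x, of m]] zy[OF x] by simp
  also have "scale (of_nat m) (?y ((?y ^^ (m - 1)) (?z x))) = scale (of_nat m) ((?y ^^ m) (?z x))"
    by (cases m) auto
  finally show ?case by (simp add: vs.scale_left_distrib)
qed simp

lemma act_word_commute:
  assumes k: "1 \<le> k" "k < n" and ws: "set ws \<subseteq> {n} \<times> ({..<n} - {k})" and x: "x \<in> V"
  shows "word_act n \<rho> ws (\<rho> (munit n k (k - 1)) x) = \<rho> (munit n k (k - 1)) (word_act n \<rho> ws x)"
  using ws
proof (induction ws)
  case (Cons p ws)
  then obtain j where p: "p = (n, j)" "j < n" "j \<noteq> k" by auto
  have "word_act n \<rho> ws x \<in> V"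
    using Cons x by (intro word_act_closed) (auto simp: lower_word_def)
  thus ?case
    using Cons p k act_lower_commute[of j n "k - 1" k "word_act n \<rho> ws x"] by auto
qed simp

text \<open>Each factor \<open>f\<close> on the right is moved to the front, where \<open>\<omega>\<close> kills its image, at the price of
  converting one letter \<open>(n, k)\<close> into \<open>(n, k - 1)\<close>. The constant \<open>C\<close> is a product of positive exponents.\<close>

lemma transfer_exponent:
  assumes k: "1 \<le> k" "k < n" and R: "set R \<subseteq> {n} \<times> ({..<n} - {k})"
  shows "\<exists>C. C \<noteq> 0 \<and>
    \<omega> (word_act n \<rho> (replicate (j + s) (n, k) @ replicate t (n, k - 1) @ R) ((\<rho> (munit n k (k - 1)) ^^ s) v)) =
    C * word_value (replicate j (n, k) @ replicate (t + s) (n, k - 1) @ R)"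
proof (induction s arbitrary: t)
  case 0
  show ?case by (auto simp: word_value_def intro!: exI[of _ 1])
next
  case (Suc s)
  let ?f = "\<rho> (munit n k (k - 1))" and ?y = "\<rho> (munit n n k)" and ?z = "\<rho> (munit n n (k - 1))"
  let ?x = "(?f ^^ s) v" and ?W = "replicate t (n, k - 1) @ R"
  have sl: "munit n n k \<in> sl n" "munit n n (k - 1) \<in> sl n" "munit n k (k - 1) \<in> sl n"
    using k by (auto intro!: munit_sl)
  have x: "?x \<in> V" using to_model_funpow[OF sl(3) hw_V] by blast
  have W: "lower_word n ?W" using k R by (auto simp: lower_word_def)
  have Wset: "set ?W \<subseteq> {n} \<times> ({..<n} - {k})" using k R by auto
  have w: "word_act n \<rho> ?W ?x \<in> V" using W x by (rule word_act_closed)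
  have mem: "(?y ^^ m) u \<in> V" if "u \<in> V" for u m
    using that sl(1) by (induction m) (auto intro: act_closed)
  obtain C where C: "C \<noteq> 0"
    "\<omega> (word_act n \<rho> (replicate (j + s) (n, k) @ replicate (Suc t) (n, k - 1) @ R) ?x) =
      C * word_value (replicate j (n, k) @ replicate (Suc t + s) (n, k - 1) @ R)"
    using Suc by blast
  have "word_act n \<rho> (replicate (j + Suc s) (n, k) @ ?W) ((?f ^^ Suc s) v) =
    (?y ^^ (j + Suc s)) (word_act n \<rho> ?W (?f ?x))"
    by (simp only: word_act_simps(3) word_act_replicate funpow.simps(2) o_apply)
  also have "\<dots> = (?y ^^ (j + Suc s)) (?f (word_act n \<rho> ?W ?x))"
    by (simp only: act_word_commute[OF k Wset x])
  also have "\<dots> = ?f ((?y ^^ (j + Suc s)) (word_act n \<rho> ?W ?x)) +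
     scale (of_nat (j + Suc s)) ((?y ^^ (j + s)) (?z (word_act n \<rho> ?W ?x)))"
    unfolding act_last_row_power[OF k w] by simp
  finally have eq: "word_act n \<rho> (replicate (j + Suc s) (n, k) @ ?W) ((?f ^^ Suc s) v) =
    ?f ((?y ^^ (j + Suc s)) (word_act n \<rho> ?W ?x)) +
    scale (of_nat (j + Suc s)) ((?y ^^ (j + s)) (?z (word_act n \<rho> ?W ?x)))" .
  have mem1: "(?y ^^ (j + Suc s)) (word_act n \<rho> ?W ?x) \<in> V" using w by (rule mem)
  have mem2: "(?y ^^ (j + s)) (?z (word_act n \<rho> ?W ?x)) \<in> V"
    by (intro mem act_closed[OF sl(2)] w)
  have "\<omega> (?f ((?y ^^ (j + Suc s)) (word_act n \<rho> ?W ?x))) = 0"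
    using k by (intro kill mem1) auto
  hence "\<omega> (word_act n \<rho> (replicate (j + Suc s) (n, k) @ ?W) ((?f ^^ Suc s) v)) =
    of_nat (j + Suc s) * \<omega> ((?y ^^ (j + s)) (?z (word_act n \<rho> ?W ?x)))"
    unfolding eq dual_add[OF dual act_closed[OF sl(3) mem1] vs.subspace_scale[OF subspace_V mem2]]
      dual_scale[OF dual mem2] by simp
  also have "(?y ^^ (j + s)) (?z (word_act n \<rho> ?W ?x)) =
    word_act n \<rho> (replicate (j + s) (n, k) @ replicate (Suc t) (n, k - 1) @ R) ?x"
    by (simp add: word_act_replicate)
  finally show ?case
    using C by (intro exI[of _ "of_nat (j + Suc s) * C"]) (simp del: of_nat_add of_nat_Suc)
qed

text \<open>If \<open>c k\<close> were larger than \<open>a k\<close>, the letters \<open>(n, k - 1)\<close> in excess could be produced by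
  \<open>transfer_exponent\<close> from a power of the simple root vector that kills \<open>v\<close>. For \<open>k = n\<close> the letter
  \<open>(n, k - 1)\<close> is that simple root vector itself, and it is enough to move it to the end of the word.\<close>

lemma last_row_exponent_bound:
  assumes ne: "word_value (last_row_word n c) \<noteq> 0" and len: "length (last_row_word n c) = low_degree"
    and k: "k \<in> {1..n}"
  shows "c k \<le> a k"
proof (rule ccontr)
  assume *: "\<not> c k \<le> a k"
  define q where "q = a k + 1"
  have q: "q \<le> c k" using * by (simp add: q_def)
  have low: "lower_word n (last_row_word n c)" for c
    using last_row_word_set[of n c] by (auto simp: lower_word_def)
  show False
  proof (cases "k = n")
    case True
    let ?ws = "last_row_word n (c(n := c n - q)) @ replicate q (n, n - 1)"
    have "mset ?ws = mset (last_row_word n c)"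
    proof (rule mset_last_row_word_eqI)
      show "set ?ws \<subseteq> {n} \<times> {..<n}" using last_row_word_set k by fastforce
      show "count (mset ?ws) (n, l - 1) = c l" if "l \<in> {1..n}" for l
        using count_last_row_word[OF that, of "c(n := c n - q)"] that q True by auto
    qed
    hence "word_value (last_row_word n c) = word_value ?ws"
      using word_value_perm[of "[]" "last_row_word n c" ?ws] low len by simp
    also have "\<dots> = \<omega> (word_act n \<rho> (last_row_word n (c(n := c n - q))) ((\<rho> (munit n n (n - 1)) ^^ q) v))"
      by (simp add: word_value_def word_act_replicate)
    also have "(\<rho> (munit n n (n - 1)) ^^ q) v = 0"
      using simple_lower_power_hw[of n] k True by (simp add: q_def)
    also have "\<omega> (word_act n \<rho> (last_row_word n (c(n := c n - q))) 0) = 0"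
      by (simp add: word_act_0[OF low] dual_0[OF dual])
    finally show False using ne by simp
  next
    case False
    hence k: "1 \<le> k" "k < n" using k by auto
    \<comment> \<open>All letters \<open>(n, k)\<close> are collected in front, as the remaining ones have to commute with the simple root vector.\<close>
    let ?R = "last_row_word n (c(k := c k - q, k + 1 := 0))"
    let ?ws = "replicate (c (k + 1)) (n, k) @ replicate q (n, k - 1) @ ?R"
    have R: "set ?R \<subseteq> {n} \<times> ({..<n} - {k})"
    proof
      fix p assume p: "p \<in> set ?R"
      have "(n, k) \<notin> set ?R"
        using count_last_row_word[of "k + 1" n "c(k := c k - q, k + 1 := 0)"] k
        by (simp add: count_eq_zero_iff)
      thus "p \<in> {n} \<times> ({..<n} - {k})" using p last_row_word_set by fastforce
    qed
    have "mset ?ws = mset (last_row_word n c)"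
    proof (rule mset_last_row_word_eqI)
      show "set ?ws \<subseteq> {n} \<times> {..<n}" using R k by auto
      show "count (mset ?ws) (n, l - 1) = c l" if "l \<in> {1..n}" for l
        using count_last_row_word[OF that, of "c(k := c k - q, k + 1 := 0)"] that q k by auto
    qed
    hence "word_value (last_row_word n c) = word_value ?ws"
      using word_value_perm[of "[]" "last_row_word n c" ?ws] low len by simp
    moreover obtain C where "C \<noteq> 0"
      "\<omega> (word_act n \<rho> (replicate (c (k + 1) + q) (n, k) @ replicate 0 (n, k - 1) @ ?R)
        ((\<rho> (munit n k (k - 1)) ^^ q) v)) = C * word_value ?ws"
      using transfer_exponent[OF k R, of "c (k + 1)" q 0] by auto
    moreover have "(\<rho> (munit n k (k - 1)) ^^ q) v = 0"
      unfolding q_def using k by (intro simple_lower_power_hw) auto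
    moreover have "lower_word n (replicate (c (k + 1) + q) (n, k) @ replicate 0 (n, k - 1) @ ?R)"
      using k low by (auto simp: lower_word_def)
    ultimately show False using ne by (simp add: word_act_0 dual_0[OF dual] del: word_act_simps)
  qed
qed

text \<open>Only finitely many tuples have degree \<open>low_degree\<close>, so the order has a least one among those with a
  nonzero value; by homogeneity it is least among all tuples with a nonzero value. What its word looks
  like is known from the two preceding facts on letters and exponents.\<close>

lemma sign_last_row:
  assumes e: "\<And>\<alpha>. \<alpha> \<in> pos_roots n \<Longrightarrow> e (- \<alpha>) \<in> root_space n (- \<alpha>) - {0\<^sub>m (n + 1) (n + 1)}"
    and rs: "distinct rs" "set rs = pos_roots n"
    and r: "monomial_order n r" "homogeneous_order n r"
  shows "\<exists>c. (\<forall>k\<in>{1..n}. c k \<le> a k) \<and> sign n rs e r \<rho> \<Lambda> v \<omega> = (\<Lambda>, last_row_exponents n c) \<and>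
    word_value (last_row_word n c) \<noteq> 0"
proof -
  let ?val = "\<lambda>p. \<omega> (signature_vector rs e \<rho> v p)"
  let ?deg = "\<lambda>p. \<Sum>\<alpha>\<in>pos_roots n. p \<alpha>"
  have lin: "linear_order_on (exponent_tuples n) r" using r by (simp add: monomial_order_def)
  have low: "lower_word n (root_word n rs p)" for p using rs by (intro lower_root_word) simp
  have len: "length (root_word n rs p) = ?deg p" for p using rs by (rule length_root_word)
  have val: "?val p \<noteq> 0 \<longleftrightarrow> word_value (root_word n rs p) \<noteq> 0" for p
  proof -
    obtain t where t: "t \<noteq> 0" "signature_vector rs e \<rho> v p = scale t (word_act n \<rho> (root_word n rs p) v)"
      using signature_vector_root_word[OF e _ hw_V, where rs = rs and p = p] rs by auto
    show ?thesis
      unfolding t(2) using t(1) low by (simp add: dual_scale[OF dual] word_act_closed hw_V word_value_def)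
  qed
  define S where "S = {p \<in> exponent_tuples n. ?deg p = low_degree \<and> ?val p \<noteq> 0}"
  have "finite S"
  proof (rule finite_subset)
    show "S \<subseteq> {p. \<forall>\<alpha>. (\<alpha> \<in> pos_roots n \<longrightarrow> p \<alpha> \<in> {..low_degree}) \<and> (\<alpha> \<notin> pos_roots n \<longrightarrow> p \<alpha> = 0)}"
    proof
      fix p assume p: "p \<in> S"
      have "p \<alpha> \<le> ?deg p" if "\<alpha> \<in> pos_roots n" for \<alpha>
        using that by (intro member_le_sum finite_pos_roots) auto
      thus "p \<in> {p. \<forall>\<alpha>. (\<alpha> \<in> pos_roots n \<longrightarrow> p \<alpha> \<in> {..low_degree}) \<and> (\<alpha> \<notin> pos_roots n \<longrightarrow> p \<alpha> = 0)}"
        using p by (auto simp: S_def exponent_tuples_def)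
    qed
    show "finite {p. \<forall>\<alpha>. (\<alpha> \<in> pos_roots n \<longrightarrow> p \<alpha> \<in> {..low_degree}) \<and> (\<alpha> \<notin> pos_roots n \<longrightarrow> p \<alpha> = (0::nat))}"
      by (intro finite_set_of_finite_funs finite_pos_roots) simp
  qed
  moreover have "S \<noteq> {}"
  proof -
    obtain ws where ws: "lower_word n ws" "length ws = low_degree" "word_value ws \<noteq> 0"
      using low_degree_attained by blast
    define p where "p = (\<lambda>\<alpha>. if \<alpha> \<in> pos_roots n then count (mset ws) (root_letter n \<alpha>) else 0)"
    have "mset ws = mset (root_word n rs p)"
    proof (rule multiset_eqI)
      fix q
      show "count (mset ws) q = count (mset (root_word n rs p)) q"
      proof (cases "q \<in> letters n")
        case True
        thus ?thesis
          using count_root_word[OF rs True, of p] letter_root_mem[OF True]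
          by (simp add: p_def root_letter_root)
      next
        case False
        hence "q \<notin> set ws" "q \<notin> set (root_word n rs p)"
          using ws(1) low[of p] unfolding lower_word_letters by blast+
        thus ?thesis by (metis count_mset_notin)
      qed
    qed
    hence "word_value ws = word_value (root_word n rs p)" "length ws = length (root_word n rs p)"
      using word_value_perm[of "[]" ws "root_word n rs p"] ws by (simp, metis size_mset)
    moreover have "p \<in> exponent_tuples n" by (simp add: p_def exponent_tuples_def)
    ultimately have "p \<in> S"
      using ws len[of p] val[of p] by (simp add: S_def)
    thus ?thesis by blast
  qed
  moreover have "S \<subseteq> exponent_tuples n" by (auto simp: S_def)
  ultimately have "\<exists>p\<in>S. \<forall>q\<in>S. (p, q) \<in> r"
    by (rule linear_order_finite_least[OF lin])
  then obtain p where p: "p \<in> S" "\<And>q. q \<in> S \<Longrightarrow> (p, q) \<in> r" by blast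
  have p': "p \<in> exponent_tuples n" "?deg p = low_degree" "?val p \<noteq> 0" using p by (auto simp: S_def)
  have least: "(p, q) \<in> r" if q: "q \<in> exponent_tuples n" "?val q \<noteq> 0" for q
  proof (cases "?deg q = low_degree")
    case True
    thus ?thesis using p q by (auto simp: S_def)
  next
    case False
    have "\<not> ?deg q < low_degree" using word_value_short[OF low[of q]] val[of q] q len[of q] by auto
    hence "?deg p < ?deg q" using False p' by simp
    thus ?thesis using r(2) p' q unfolding homogeneous_order_def by blast
  qed
  have "(THE p. p \<in> exponent_tuples n \<and> ?val p \<noteq> 0 \<and>
     (\<forall>q\<in>exponent_tuples n. ?val q \<noteq> 0 \<longrightarrow> (p, q) \<in> r)) = p"
  proof (rule the_equality)
    show "p \<in> exponent_tuples n \<and> ?val p \<noteq> 0 \<and> (\<forall>q\<in>exponent_tuples n. ?val q \<noteq> 0 \<longrightarrow> (p, q) \<in> r)"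
      using p' least by blast
    fix p2 assume "p2 \<in> exponent_tuples n \<and> ?val p2 \<noteq> 0 \<and> (\<forall>q\<in>exponent_tuples n. ?val q \<noteq> 0 \<longrightarrow> (p2, q) \<in> r)"
    hence "(p2, p) \<in> r" "(p, p2) \<in> r" using p' least by auto
    moreover have "antisym r" using lin by (simp add: order_on_defs)
    ultimately show "p2 = p" by (simp add: antisymD)
  qed
  hence sign: "sign n rs e r \<rho> \<Lambda> v \<omega> = (\<Lambda>, p)" by (simp add: sign_def)
  have wp: "word_value (root_word n rs p) \<noteq> 0" "length (root_word n rs p) = low_degree"
    using val p' len by auto
  have last: "set (root_word n rs p) \<subseteq> {n} \<times> {..<n}"
    using word_value_letter_last_row low wp by blast
  define c where "c k = p (letter_root n (n, k - 1))" for k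
  have p_eq: "p = last_row_exponents n c"
  proof
    fix \<beta>
    show "p \<beta> = last_row_exponents n c \<beta>"
    proof (cases "\<beta> \<in> pos_roots n")
      case True
      define q where "q = root_letter n \<beta>"
      have q: "q \<in> letters n" "letter_root n q = \<beta>"
        using True root_letter_mem letter_root_letter by (auto simp: q_def)
      obtain i j where ij: "q = (i, j)" by (cases q)
      show ?thesis
      proof (cases "i = n")
        case True
        thus ?thesis using last_row_exponents_root[OF q(1), of c] q ij by (simp add: c_def)
      next
        case False
        hence "q \<notin> set (root_word n rs p)" using last ij by auto
        hence "p \<beta> = 0" using count_root_word[OF rs q(1), of p] q count_mset_notin by metis
        thus ?thesis using last_row_exponents_root[OF q(1), of c] q ij False by simp
      qed
    next
      case False
      thus ?thesis using p'(1) last_row_exponents_outside by (simp add: exponent_tuples_def)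
    qed
  qed
  have mset: "mset (root_word n rs p) = mset (last_row_word n c)"
  proof (rule mset_last_row_word_eqI[OF last])
    fix k assume "k \<in> {1..n}"
    thus "count (mset (root_word n rs p)) (n, k - 1) = c k"
      using count_root_word[OF rs, of "(n, k - 1)" p] last_row_root by (simp add: c_def)
  qed
  have wc: "word_value (last_row_word n c) \<noteq> 0"
    using word_value_perm[of "[]", OF _ _ mset] wp low by simp
  have "length (last_row_word n c) = low_degree"
    using arg_cong[OF mset, of size] wp by simp
  hence "\<forall>k\<in>{1..n}. c k \<le> a k" using last_row_exponent_bound[OF wc] by simp
  thus ?thesis using sign wc unfolding p_eq by (intro exI[of _ c] conjI)
qed

end

context irr_hw_mod
begin

section \<open>The signs that occur\<close>

text \<open>The functional represented by \<open>model_vec n a c\<close>. It is invariant because taking adjoints turns the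
  operators of the lower block into raising operators, which kill that vector.\<close>

lemma model_functional:
  assumes c: "\<And>k. k \<in> {1..n} \<Longrightarrow> c k \<le> a k"
  defines "\<omega> \<equiv> \<lambda>x. fock (to_model x) (model_vec n a c)"
  shows "invariant_functional n scale V \<rho> \<Lambda> v a \<omega>"
    and "\<omega> (word_act n \<rho> (last_row_word n d) v) \<noteq> 0 \<longleftrightarrow> (\<forall>k\<in>{1..n}. d k = c k)"
proof -
  have low: "lower_word n (last_row_word n d)" for d
    using last_row_word_set[of n d] by (auto simp: lower_word_def)
  have val: "\<omega> (word_act n \<rho> (last_row_word n d) v) =
    fock (word_act n (gl_act n) (last_row_word n d) model_top) (model_vec n a c)" for d
    by (simp add: \<omega>_def to_model_word[OF low])
  have ne: "\<omega> (word_act n \<rho> (last_row_word n c) v) \<noteq> 0"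
    unfolding val using c by (rule fock_last_row_word)
  show "\<omega> (word_act n \<rho> (last_row_word n d) v) \<noteq> 0 \<longleftrightarrow> (\<forall>k\<in>{1..n}. d k = c k)"
  proof
    assume "\<omega> (word_act n \<rho> (last_row_word n d) v) \<noteq> 0"
    hence "d k = c k" if "k \<in> {1..n}" for k
      unfolding val using c that by (intro fock_last_row_word_eq[where c = c and a = a]) auto
    thus "\<forall>k\<in>{1..n}. d k = c k" by blast
  next
    assume "\<forall>k\<in>{1..n}. d k = c k"
    hence "last_row_word n d = last_row_word n c"
      unfolding last_row_word_def by (intro arg_cong[of _ _ concat] map_cong) auto
    thus "\<omega> (word_act n \<rho> (last_row_word n d) v) \<noteq> 0" using ne by simp
  qed
  show "invariant_functional n scale V \<rho> \<Lambda> v a \<omega>"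
  proof (intro invariant_functional.intro irr_hw_mod_axioms invariant_functional_axioms.intro)
    show "\<omega> \<in> dual scale V"
      by (simp add: dual_def \<omega>_def to_model_add to_model_scale fock_add_left fock_Const_left)
    show "kills_lower_block \<omega>"
      unfolding kills_lower_block_def
    proof (intro allI impI ballI)
      fix i j x assume ij: "j < i" "i < n" and x: "x \<in> V"
      have "\<omega> (\<rho> (munit n i j) x) = fock (to_model x) (gl_act n (munit n j i) (model_vec n a c))"
        unfolding \<omega>_def using ij x by (simp add: to_model_act munit_sl fock_munit)
      thus "\<omega> (\<rho> (munit n i j) x) = 0" using raise_model_vec[OF ij] by simp
    qed
    show "\<exists>x\<in>V. \<omega> x \<noteq> 0" 
      by (rule bexI[where x = "word_act n \<rho> (last_row_word n c) v"])
         (rule ne, rule word_act_closed[OF low hw_V])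
  qed
qed

lemma dual_invariant_iff:
  "\<omega> \<in> dual_invariants n scale V \<rho> \<and> (\<exists>x\<in>V. \<omega> x \<noteq> 0) \<longleftrightarrow> invariant_functional n scale V \<rho> \<Lambda> v a \<omega>"
proof
  assume *: "\<omega> \<in> dual_invariants n scale V \<rho> \<and> (\<exists>x\<in>V. \<omega> x \<noteq> 0)"
  hence "\<omega> \<in> dual scale V" by (simp add: dual_invariants_def)
  with * dual_invariants_imp_kills show "invariant_functional n scale V \<rho> \<Lambda> v a \<omega>"
    by unfold_locales auto
next
  assume "invariant_functional n scale V \<rho> \<Lambda> v a \<omega>"
  then interpret invariant_functional n scale V \<rho> \<Lambda> v a \<omega> .
  show "\<omega> \<in> dual_invariants n scale V \<rho> \<and> (\<exists>x\<in>V. \<omega> x \<noteq> 0)"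
    using kills_imp_dual_invariants[OF dual kills] nonzero by blast
qed

lemma signs_of_invariants:
  assumes e: "\<And>\<alpha>. \<alpha> \<in> pos_roots n \<Longrightarrow> e (- \<alpha>) \<in> root_space n (- \<alpha>) - {0\<^sub>m (n + 1) (n + 1)}"
    and rs: "distinct rs" "set rs = pos_roots n"
    and r: "monomial_order n r" "homogeneous_order n r"
  shows "{sign n rs e r \<rho> \<Lambda> v \<omega> | \<omega>. \<omega> \<in> dual_invariants n scale V \<rho> \<and> (\<exists>x\<in>V. \<omega> x \<noteq> 0)} =
    {(\<Lambda>, last_row_exponents n c) | c. \<forall>k\<in>{1..n}. c k \<le> a k}"
proof (intro equalityI subsetI)
  fix s assume "s \<in> {sign n rs e r \<rho> \<Lambda> v \<omega> | \<omega>. \<omega> \<in> dual_invariants n scale V \<rho> \<and> (\<exists>x\<in>V. \<omega> x \<noteq> 0)}"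
  then obtain \<omega> where s: "s = sign n rs e r \<rho> \<Lambda> v \<omega>" "invariant_functional n scale V \<rho> \<Lambda> v a \<omega>"
    unfolding dual_invariant_iff by blast
  then interpret invariant_functional n scale V \<rho> \<Lambda> v a \<omega> by simp
  show "s \<in> {(\<Lambda>, last_row_exponents n c) | c. \<forall>k\<in>{1..n}. c k \<le> a k}"
    using sign_last_row[OF e rs r] s(1) by auto
next
  fix s assume "s \<in> {(\<Lambda>, last_row_exponents n c) | c. \<forall>k\<in>{1..n}. c k \<le> a k}"
  then obtain c where s: "s = (\<Lambda>, last_row_exponents n c)" and c: "\<And>k. k \<in> {1..n} \<Longrightarrow> c k \<le> a k"
    by blast
  define \<omega> where "\<omega> x = fock (to_model x) (model_vec n a c)" for x
  have \<omega>: "\<omega> = (\<lambda>x. fock (to_model x) (model_vec n a c))" by (simp add: \<omega>_def fun_eq_iff)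
  interpret invariant_functional n scale V \<rho> \<Lambda> v a \<omega>
    unfolding \<omega> using c by (rule model_functional(1))
  obtain d where d: "sign n rs e r \<rho> \<Lambda> v \<omega> = (\<Lambda>, last_row_exponents n d)"
    "word_value (last_row_word n d) \<noteq> 0"
    using sign_last_row[OF e rs r] by auto
  have "(\<omega> (word_act n \<rho> (last_row_word n d) v) \<noteq> 0) = (\<forall>k\<in>{1..n}. d k = c k)"
    unfolding \<omega> using c by (rule model_functional(2))
  hence "\<forall>k\<in>{1..n}. d k = c k" using d(2) by (simp add: word_value_def)
  hence "last_row_exponents n d = last_row_exponents n c"
    unfolding last_row_exponents_def by (intro ext sum.cong) auto
  hence "s = sign n rs e r \<rho> \<Lambda> v \<omega>" using d s by simp
  thus "s \<in> {sign n rs e r \<rho> \<Lambda> v \<omega> | \<omega>. \<omega> \<in> dual_invariants n scale V \<rho> \<and> (\<exists>x\<in>V. \<omega> x \<noteq> 0)}"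
    using dual_invariant_iff[of \<omega>] invariant_functional_axioms by blast
qed

end

section \<open>Dominant weights\<close>

definition fund_sum :: "nat \<Rightarrow> (nat \<Rightarrow> nat) \<Rightarrow> weight" where
  "fund_sum n a = (\<lambda>h. \<Sum>k=1..n. of_nat (a k) * fund_weight n k h)"

lemma fund_weight_eval:
  "fund_weight n k h = (if h \<in> cartan n then \<Sum>i<k. h $$ (i, i) else 0)"
proof -
  have "fund_weight n k h = (\<Sum>i=1..k. eps n i h)"
    unfolding fund_weight_def by (induction k) auto
  also have "\<dots> = (if h \<in> cartan n then \<Sum>i<k. h $$ (i, i) else 0)"
    by (auto simp: eps_def sum.atLeast1_atMost_eq)
  finally show ?thesis .
qed

lemma simple_coroot_cartan: "k \<in> {1..n} \<Longrightarrow> simple_coroot n k \<in> cartan n"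
proof -
  assume k: "k \<in> {1..n}"
  have "(\<Sum>i<n + 1. simple_coroot n k $$ (i, i)) =
    (\<Sum>i<n + 1. (if i = k - 1 then 1 else 0) - (if i = k then 1 else 0))"
    using k by (intro sum.cong) (auto simp: simple_coroot_def)
  also have "\<dots> = 0" unfolding sum_subtractf using k by auto
  finally show ?thesis by (simp add: cartan_def sl_def diagonal_mat_def simple_coroot_def)
qed

lemma fund_weight_coroot:
  assumes "j \<in> {1..n}" "k \<in> {1..n}"
  shows "fund_weight n j (simple_coroot n k) = (if j = k then 1 else 0)"
proof -
  have "(\<Sum>i<j. simple_coroot n k $$ (i, i)) =
    (\<Sum>i<j. (if i = k - 1 then 1 else 0) - (if i = k then 1 else 0))"
    using assms by (intro sum.cong) (auto simp: simple_coroot_def)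
  also have "\<dots> = (if j = k then 1 else 0)" unfolding sum_subtractf using assms by auto
  finally show ?thesis using assms simple_coroot_cartan by (simp add: fund_weight_eval)
qed

lemma fund_sum_coroot: "k \<in> {1..n} \<Longrightarrow> fund_sum n a (simple_coroot n k) = of_nat (a k)"
proof -
  assume k: "k \<in> {1..n}"
  have "fund_sum n a (simple_coroot n k) = (\<Sum>j=1..n. if j = k then of_nat (a k) else 0)"
    unfolding fund_sum_def using k by (intro sum.cong) (auto simp: fund_weight_coroot)
  thus ?thesis using k by simp
qed

lemma cartan_add: "h \<in> cartan n \<Longrightarrow> h' \<in> cartan n \<Longrightarrow> h + h' \<in> cartan n"
  and cartan_smult: "h \<in> cartan n \<Longrightarrow> c \<cdot>\<^sub>m h \<in> cartan n"
proof -
  assume h: "h \<in> cartan n"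
  show "c \<cdot>\<^sub>m h \<in> cartan n"
    using h sl_smult[of h n c] by (auto simp: cartan_def diagonal_mat_def)
  assume h': "h' \<in> cartan n"
  have "(\<Sum>i<n + 1. (h + h') $$ (i, i)) = (\<Sum>i<n + 1. h $$ (i, i)) + (\<Sum>i<n + 1. h' $$ (i, i))"
    unfolding sum.distrib[symmetric] using h h' by (intro sum.cong) (auto simp: cartan_def sl_def)
  thus "h + h' \<in> cartan n"
    using h h' by (auto simp: cartan_def sl_def diagonal_mat_def)
qed

lemma cartan_dual_add:
  "\<Lambda> \<in> cartan_dual n \<Longrightarrow> h \<in> cartan n \<Longrightarrow> h' \<in> cartan n \<Longrightarrow> \<Lambda> (h + h') = \<Lambda> h + \<Lambda> h'"
  and cartan_dual_smult: "\<Lambda> \<in> cartan_dual n \<Longrightarrow> h \<in> cartan n \<Longrightarrow> \<Lambda> (c \<cdot>\<^sub>m h) = c * \<Lambda> h"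
  unfolding cartan_dual_def by blast+

text \<open>The simple coroots span the Cartan subalgebra. The induction removes the last nonzero diagonal entry
  by adding a multiple of a coroot; in the end the vanishing trace leaves the zero matrix.\<close>

lemma cartan_dual_eqI:
  assumes \<Lambda>: "\<Lambda> \<in> cartan_dual n" and M: "M \<in> cartan_dual n"
    and eq: "\<And>k. k \<in> {1..n} \<Longrightarrow> \<Lambda> (simple_coroot n k) = M (simple_coroot n k)"
  shows "\<Lambda> = M"
proof
  fix h
  have "\<Lambda> h = M h" if "h \<in> cartan n" "m \<le> n" "\<And>i. m < i \<Longrightarrow> i \<le> n \<Longrightarrow> h $$ (i, i) = 0" for m h
    using that
  proof (induction m arbitrary: h)
    case 0
    have "(\<Sum>i<n + 1. h $$ (i, i)) = h $$ (0, 0)"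
      using 0 by (subst sum.remove[of _ 0]) auto
    hence "h $$ (0, 0) = 0" using 0 by (simp add: cartan_def sl_def)
    hence diag: "h $$ (i, i) = 0" if "i \<le> n" for i using 0 that by (cases i) auto
    have h0: "h = 0 \<cdot>\<^sub>m h"
    proof (rule eq_matI)
      fix i j assume "i < dim_row (0 \<cdot>\<^sub>m h)" "j < dim_col (0 \<cdot>\<^sub>m h)"
      thus "h $$ (i, j) = (0 \<cdot>\<^sub>m h) $$ (i, j)"
        using 0(1) diag[of i] by (cases "i = j") (auto simp: cartan_def sl_def diagonal_mat_def)
    qed auto
    have "\<Lambda> (0 \<cdot>\<^sub>m h) = 0" "M (0 \<cdot>\<^sub>m h) = 0"
      unfolding cartan_dual_smult[OF \<Lambda> 0(1)] cartan_dual_smult[OF M 0(1)] by simp_all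
    with arg_cong[OF h0, of \<Lambda>] arg_cong[OF h0, of M] show ?case by (simp only:)
  next
    case (Suc m)
    let ?H = "simple_coroot n (Suc m)" and ?c = "h $$ (Suc m, Suc m)"
    have H: "?H \<in> cartan n" using Suc by (intro simple_coroot_cartan) auto
    define g where "g = h + ?c \<cdot>\<^sub>m ?H"
    have gc: "g \<in> cartan n" unfolding g_def by (intro cartan_add cartan_smult H Suc.prems)
    have hc: "h \<in> carrier_mat (n + 1) (n + 1)" using Suc by (simp add: cartan_def sl_def)
    have "g $$ (i, i) = 0" if "m < i" "i \<le> n" for i
      using that Suc.prems hc by (cases "i = Suc m") (auto simp: g_def simple_coroot_def)
    hence "\<Lambda> g = M g" using Suc gc by (intro Suc.IH) auto
    moreover have "\<Lambda> g = \<Lambda> h + ?c * \<Lambda> ?H" "M g = M h + ?c * M ?H"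
      unfolding g_def cartan_dual_add[OF \<Lambda> Suc.prems(1) cartan_smult[OF H]] cartan_dual_smult[OF \<Lambda> H]
        cartan_dual_add[OF M Suc.prems(1) cartan_smult[OF H]] cartan_dual_smult[OF M H] by (rule refl)+
    ultimately show ?case using eq[of "Suc m"] Suc by simp
  qed
  from this[of h n] show "\<Lambda> h = M h"
    using \<Lambda> M by (cases "h \<in> cartan n") (auto simp: cartan_dual_def)
qed

lemma eps_cartan_dual: "i \<in> {1..n + 1} \<Longrightarrow> eps n i \<in> cartan_dual n"
  unfolding cartan_dual_def
proof (intro CollectI conjI ballI allI impI)
  assume i: "i \<in> {1..n + 1}"
  show "eps n i (h + h') = eps n i h + eps n i h'" if "h \<in> cartan n" "h' \<in> cartan n" for h h'
    using that i cartan_add[OF that] by (auto simp: eps_def cartan_def sl_def)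
  show "eps n i (c \<cdot>\<^sub>m h) = c * eps n i h" if "h \<in> cartan n" for c h
    using that i cartan_smult[OF that, of c] by (auto simp: eps_def cartan_def sl_def)
qed (simp add: eps_def)

lemma fund_sum_cartan_dual: "fund_sum n a \<in> cartan_dual n"
proof -
  have fw: "fund_weight n k h = (\<Sum>i=1..k. eps n i h)" for k h
    unfolding fund_weight_def by (induction k) auto
  show ?thesis
    unfolding cartan_dual_def
  proof (intro CollectI conjI ballI allI impI)
    fix h h' assume h: "h \<in> cartan n" "h' \<in> cartan n"
    have "fund_weight n k (h + h') = fund_weight n k h + fund_weight n k h'" if "k \<in> {1..n}" for k
      unfolding fw sum.distrib[symmetric] using eps_cartan_dual that h
      by (intro sum.cong) (auto simp: cartan_dual_def)
    thus "fund_sum n a (h + h') = fund_sum n a h + fund_sum n a h'"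
      unfolding fund_sum_def sum.distrib[symmetric] by (intro sum.cong) (auto simp: algebra_simps)
  next
    fix c h assume h: "h \<in> cartan n"
    have "fund_weight n k (c \<cdot>\<^sub>m h) = c * fund_weight n k h" if "k \<in> {1..n}" for k
      unfolding fw sum_distrib_left using eps_cartan_dual that h
      by (intro sum.cong) (auto simp: cartan_dual_def)
    thus "fund_sum n a (c \<cdot>\<^sub>m h) = c * fund_sum n a h"
      unfolding fund_sum_def sum_distrib_left by (intro sum.cong) (auto simp: algebra_simps)
  qed (simp add: fund_sum_def fund_weight_eval)
qed

lemma dominant_iff: "dominant n \<Lambda> \<longleftrightarrow> (\<exists>a. \<Lambda> = fund_sum n a)"
proof
  assume d: "dominant n \<Lambda>"
  have "\<forall>k\<in>{1..n}. \<exists>m. \<Lambda> (simple_coroot n k) = of_nat m"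
    using d by (auto simp: dominant_def elim: Nats_cases)
  then obtain a where "\<And>k. k \<in> {1..n} \<Longrightarrow> \<Lambda> (simple_coroot n k) = of_nat (a k)"
    by metis
  hence "\<Lambda> = fund_sum n a"
    using d by (intro cartan_dual_eqI[OF _ fund_sum_cartan_dual]) (auto simp: dominant_def fund_sum_coroot)
  thus "\<exists>a. \<Lambda> = fund_sum n a" by blast
next
  assume "\<exists>a. \<Lambda> = fund_sum n a"
  thus "dominant n \<Lambda>" using fund_sum_cartan_dual fund_sum_coroot by (auto simp: dominant_def)
qed

lemma fund_sum_inj: "fund_sum n a = fund_sum n b \<Longrightarrow> k \<in> {1..n} \<Longrightarrow> a k = b k"
  using fund_sum_coroot[of k n a] fund_sum_coroot[of k n b] by simp

lemma last_row_exponents_inj: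
  assumes "last_row_exponents n c = last_row_exponents n d" "k \<in> {1..n}"
  shows "c k = d k"
  using last_row_exponents_root[of "(n, k - 1)" n c] last_row_exponents_root[of "(n, k - 1)" n d]
    last_row_root[OF assms(2)] assms by simp

section \<open>The branching semigroup and its generators\<close>

lemma branching_semigroup_eq:
  fixes scale :: "complex \<Rightarrow> 'v::ab_group_add \<Rightarrow> 'v"
  assumes "vector_space scale"
    and irr: "\<And>\<Lambda>. dominant n \<Lambda> \<Longrightarrow> irreducible_module n scale (V \<Lambda>) (\<rho> \<Lambda>)"
    and hw: "\<And>\<Lambda>. dominant n \<Lambda> \<Longrightarrow> highest_weight_vector n scale (V \<Lambda>) (\<rho> \<Lambda>) \<Lambda> (v \<Lambda>)"
    and e: "\<And>\<alpha>. \<alpha> \<in> pos_roots n \<Longrightarrow> e (- \<alpha>) \<in> root_space n (- \<alpha>) - {0\<^sub>m (n + 1) (n + 1)}"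
    and rs: "distinct rs" "set rs = pos_roots n"
    and r: "monomial_order n r" "homogeneous_order n r"
  shows "branching_semigroup n rs e r scale V \<rho> v =
    {(fund_sum n a, last_row_exponents n c) | a c. \<forall>k\<in>{1..n}. c k \<le> a k}"
proof -
  have *: "{sign n rs e r (\<rho> \<Lambda>) \<Lambda> (v \<Lambda>) \<omega> | \<omega>.
      \<omega> \<in> dual_invariants n scale (V \<Lambda>) (\<rho> \<Lambda>) \<and> (\<exists>x\<in>V \<Lambda>. \<omega> x \<noteq> 0)} =
    {(\<Lambda>, last_row_exponents n c) | c. \<forall>k\<in>{1..n}. c k \<le> a k}" if \<Lambda>: "\<Lambda> = fund_sum n a" for \<Lambda> a
  proof -
    have d: "dominant n \<Lambda>" using \<Lambda> dominant_iff by blast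
    interpret irr_hw_mod n scale "V \<Lambda>" "\<rho> \<Lambda>" \<Lambda> "v \<Lambda>" a
    proof (intro irr_hw_mod.intro hw_mod.intro sl_mod.intro hw_mod_axioms.intro irr_hw_mod_axioms.intro)
      show "sl_module n scale (V \<Lambda>) (\<rho> \<Lambda>)" using irr[OF d] by (simp add: irreducible_module_def)
      show "\<Lambda> h = (\<Sum>k=1..n. of_nat (a k) * (\<Sum>i<k. h $$ (i, i)))" if "h \<in> cartan n" for h
        using that by (simp add: \<Lambda> fund_sum_def fund_weight_eval)
    qed (use assms d in auto)
    show ?thesis by (rule signs_of_invariants[OF e rs r])
  qed
  have "branching_semigroup n rs e r scale V \<rho> v =
    (\<Union>a. {sign n rs e r (\<rho> (fund_sum n a)) (fund_sum n a) (v (fund_sum n a)) \<omega> | \<omega>.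
      \<omega> \<in> dual_invariants n scale (V (fund_sum n a)) (\<rho> (fund_sum n a)) \<and> (\<exists>x\<in>V (fund_sum n a). \<omega> x \<noteq> 0)})"
    unfolding branching_semigroup_def dominant_iff by blast
  also have "\<dots> = (\<Union>a. {(fund_sum n a, last_row_exponents n c) | c. \<forall>k\<in>{1..n}. c k \<le> a k})"
    by (intro SUP_cong refl *)
  finally show ?thesis by blast
qed

text \<open>Both kinds of generators contribute to the weight, and those with even index to the exponents.\<close>

lemma sum_generators:
  assumes odd: "\<And>k. k \<in> {1..n} \<Longrightarrow> \<sigma> (2 * k - 1) = (fund_weight n k, 0)"
    and even: "\<And>k. k \<in> {1..n} \<Longrightarrow> \<sigma> (2 * k) = (fund_weight n k, unit_exponent (eps n k - eps n (n + 1)))"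
    and M: "set_mset M \<subseteq> {1..2 * n}"
  shows "(\<Sum>i\<in>#M. \<sigma> i) = (fund_sum n (\<lambda>k. count M (2 * k - 1) + count M (2 * k)),
    last_row_exponents n (\<lambda>k. count M (2 * k)))"
  using M
proof (induction M)
  case empty
  show ?case by (simp add: fund_sum_def last_row_exponents_def zero_prod_def zero_fun_def)
next
  case (add i M)
  let ?a = "\<lambda>M k. count M (2 * k - 1) + count M (2 * k)" and ?c = "\<lambda>M k. count M (2 * k)"
  from add have IH: "(\<Sum>i\<in>#M. \<sigma> i) = (fund_sum n (?a M), last_row_exponents n (?c M))" by simp
  define k where "k = (i + 1) div 2"
  have k: "k \<in> {1..n}" and i: "i = 2 * k - 1 \<or> i = 2 * k"
    using add.prems by (auto simp: k_def)
  have count: "?a (add_mset i M) l = ?a M l + (if l = k then 1 else 0)" if "l \<in> {1..n}" for l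
    using i
  proof
    assume "i = 2 * k - 1"
    moreover have "1 \<le> k" "1 \<le> l" using k that by auto
    ultimately have "(i = 2 * l - 1) = (l = k)" "i \<noteq> 2 * l" by presburger+
    thus ?thesis by (simp del: One_nat_def)
  next
    assume "i = 2 * k"
    moreover have "1 \<le> k" "1 \<le> l" using k that by auto
    ultimately have "(i = 2 * l) = (l = k)" "i \<noteq> 2 * l - 1" by presburger+
    thus ?thesis by (simp del: One_nat_def)
  qed
  have fund: "fund_sum n (?a (add_mset i M)) = fund_weight n k + fund_sum n (?a M)"
  proof
    fix h
    have "fund_sum n (?a (add_mset i M)) h =
      (\<Sum>l=1..n. of_nat (?a M l) * fund_weight n l h + (if l = k then fund_weight n k h else 0))"
      unfolding fund_sum_def
    proof (rule sum.cong[OF refl])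
      fix l assume l: "l \<in> {1..n}"
      show "of_nat (?a (add_mset i M) l) * fund_weight n l h =
        of_nat (?a M l) * fund_weight n l h + (if l = k then fund_weight n k h else 0)"
        unfolding count[OF l] by (cases "l = k") (simp_all add: distrib_right)
    qed
    also have "\<dots> = fund_sum n (?a M) h + (\<Sum>l=1..n. if l = k then fund_weight n k h else 0)"
      unfolding fund_sum_def by (rule sum.distrib)
    also have "(\<Sum>l=1..n. if l = k then fund_weight n k h else 0) = fund_weight n k h"
      using k by simp
    finally show "fund_sum n (?a (add_mset i M)) h = (fund_weight n k + fund_sum n (?a M)) h"
      by (simp only: plus_fun_def add.commute)
  qed
  have \<sigma>: "fst (\<sigma> i) = fund_weight n k" using i odd[OF k] even[OF k] by auto
  have last: "last_row_exponents n (?c (add_mset i M)) = snd (\<sigma> i) + last_row_exponents n (?c M)"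
  proof (cases "i = 2 * k")
    case True
    have c: "?c (add_mset i M) l = ?c M l + (if l = k then 1 else 0)" for l
      using True by auto
    show ?thesis
    proof
      fix \<beta>
      have "last_row_exponents n (?c (add_mset i M)) \<beta> =
        (\<Sum>l=1..n. ?c M l * unit_exponent (eps n l - eps n (n + 1)) \<beta> +
          (if l = k then unit_exponent (eps n k - eps n (n + 1)) \<beta> else 0))"
        unfolding last_row_exponents_def c by (intro sum.cong) (auto simp: algebra_simps)
      also have "\<dots> = last_row_exponents n (?c M) \<beta> +
          (\<Sum>l=1..n. if l = k then unit_exponent (eps n k - eps n (n + 1)) \<beta> else 0)"
        unfolding last_row_exponents_def by (rule sum.distrib)
      also have "(\<Sum>l=1..n. if l = k then unit_exponent (eps n k - eps n (n + 1)) \<beta> else 0) = snd (\<sigma> i) \<beta>"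
        using k True even[OF k] by simp
      finally show "last_row_exponents n (?c (add_mset i M)) \<beta> = (snd (\<sigma> i) + last_row_exponents n (?c M)) \<beta>"
        by (simp only: plus_fun_def add.commute)
    qed
  next
    case False
    hence i': "i = 2 * k - 1" using i by simp
    have "?c (add_mset i M) = ?c M"
    proof
      fix l
      have "Suc i = 2 * k" using i' k by simp
      hence "i \<noteq> 2 * l" by presburger
      thus "?c (add_mset i M) l = ?c M l" by (simp only: count_add_mset if_False)
    qed
    moreover have "snd (\<sigma> i) = 0" using i' odd[OF k] by simp
    ultimately show ?thesis by (simp only: add_0)
  qed
  show ?case
    unfolding fund last
    by (rule prod_eqI)
       (simp_all only: image_mset_add_mset sum_mset.add_mset IH fst_add snd_add fst_conv snd_conv \<sigma>)
qed

theorem theorem3: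
  fixes n :: nat
    and scale :: "complex \<Rightarrow> 'v::ab_group_add \<Rightarrow> 'v"
    and V :: "weight \<Rightarrow> 'v set"
    and \<rho> :: "weight \<Rightarrow> complex mat \<Rightarrow> 'v \<Rightarrow> 'v"
    and v :: "weight \<Rightarrow> 'v"
    and e :: "weight \<Rightarrow> complex mat"
    and rs :: "weight list"
    and r :: "exponents rel"
    and \<sigma> :: "nat \<Rightarrow> signature"
  assumes "n \<ge> 2"
    and "vector_space scale"
    and "\<And>\<Lambda>. dominant n \<Lambda> \<Longrightarrow> irreducible_module n scale (V \<Lambda>) (\<rho> \<Lambda>)"
    and "\<And>\<Lambda>. dominant n \<Lambda> \<Longrightarrow> highest_weight_vector n scale (V \<Lambda>) (\<rho> \<Lambda>) \<Lambda> (v \<Lambda>)"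
    and "\<And>\<alpha>. \<alpha> \<in> pos_roots n \<Longrightarrow> e (- \<alpha>) \<in> root_space n (- \<alpha>) - {0\<^sub>m (n + 1) (n + 1)}"
    and "distinct rs" and "set rs = pos_roots n"
    and "monomial_order n r" and "homogeneous_order n r"
    and "\<And>k. k \<in> {1..n} \<Longrightarrow> \<sigma> (2 * k - 1) = (fund_weight n k, 0)"
    and "\<And>k. k \<in> {1..n} \<Longrightarrow> \<sigma> (2 * k) = (fund_weight n k, unit_exponent (eps n k - eps n (n + 1)))"
  shows "free_comm_semigroup_on (branching_semigroup n rs e r scale V \<rho> v) {1..2 * n} \<sigma>"
proof -
  have eq: "branching_semigroup n rs e r scale V \<rho> v =
    {(fund_sum n a, last_row_exponents n c) | a c. \<forall>k\<in>{1..n}. c k \<le> a k}"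
    by (rule branching_semigroup_eq) (fact assms)+
  show ?thesis
    unfolding free_comm_semigroup_on_def eq
  proof (rule bij_betw_imageI)
    let ?A = "\<lambda>M k. count M (2 * k - 1) + count M (2 * k)" and ?C = "\<lambda>M k. count M (2 * k)"
    have sum_gen: "(\<Sum>i\<in>#M. \<sigma> i) = (fund_sum n (?A M), last_row_exponents n (?C M))"
      if "set_mset M \<subseteq> {1..2 * n}" for M
      by (rule sum_generators) (fact assms that)+
    show "inj_on (\<lambda>M. \<Sum>i\<in>#M. \<sigma> i) {M. set_mset M \<subseteq> {1..2 * n}}"
    proof (rule inj_onI)
      fix M N assume "M \<in> {M. set_mset M \<subseteq> {1..2 * n}}" "N \<in> {M. set_mset M \<subseteq> {1..2 * n}}"
        and eq: "(\<Sum>i\<in>#M. \<sigma> i) = (\<Sum>i\<in>#N. \<sigma> i)"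
      hence MN: "set_mset M \<subseteq> {1..2 * n}" "set_mset N \<subseteq> {1..2 * n}" by auto
      have A: "fund_sum n (?A M) = fund_sum n (?A N)"
        and C: "last_row_exponents n (?C M) = last_row_exponents n (?C N)"
        using eq unfolding sum_gen[OF MN(1)] sum_gen[OF MN(2)] by (simp_all only: prod.inject)
      have a: "?A M k = ?A N k" if "k \<in> {1..n}" for k
        using A that by (rule fund_sum_inj)
      have c: "?C M k = ?C N k" if "k \<in> {1..n}" for k
        using C that by (rule last_row_exponents_inj)
      show "M = N"
      proof (rule multiset_eqI)
        fix i
        show "count M i = count N i"
        proof (cases "i \<in> {1..2 * n}")
          case True
          define k where "k = (i + 1) div 2"
          have k: "k \<in> {1..n}" and i: "i = 2 * k - 1 \<or> i = 2 * k" using True by (auto simp: k_def)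
          show ?thesis using i a[OF k] c[OF k] by auto
        next
          case False
          hence "i \<notin># M" "i \<notin># N" using MN by blast+
          thus ?thesis by (simp add: not_in_iff)
        qed
      qed
    qed
    show "(\<lambda>M. \<Sum>i\<in>#M. \<sigma> i) ` {M. set_mset M \<subseteq> {1..2 * n}} =
      {(fund_sum n a, last_row_exponents n c) | a c. \<forall>k\<in>{1..n}. c k \<le> a k}"
    proof (intro equalityI subsetI)
      fix s assume "s \<in> (\<lambda>M. \<Sum>i\<in>#M. \<sigma> i) ` {M. set_mset M \<subseteq> {1..2 * n}}"
      then obtain M where M: "set_mset M \<subseteq> {1..2 * n}" "s = (\<Sum>i\<in>#M. \<sigma> i)" by blast
      show "s \<in> {(fund_sum n a, last_row_exponents n c) | a c. \<forall>k\<in>{1..n}. c k \<le> a k}"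
        unfolding M(2) sum_gen[OF M(1)]
        by (intro CollectI exI[of _ "?A M"] exI[of _ "?C M"]) simp
    next
      fix s assume "s \<in> {(fund_sum n a, last_row_exponents n c) | a c. \<forall>k\<in>{1..n}. c k \<le> a k}"
      then obtain a c where s: "s = (fund_sum n a, last_row_exponents n c)" and ca: "\<And>k. k \<in> {1..n} \<Longrightarrow> c k \<le> a k"
        by blast
      \<comment> \<open>The multiplicities are \<open>c k\<close> at the index \<open>2 * k\<close> and \<open>a k - c k\<close> at \<open>2 * k - 1\<close>.\<close>
      define f where "f i = (if even i then c (i div 2) else a ((i + 1) div 2) - c ((i + 1) div 2))" for i
      define M where "M = (\<Sum>i=1..2 * n. replicate_mset (f i) i)"
      have count: "count M i = (if i \<in> {1..2 * n} then f i else 0)" for i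
        by (simp add: M_def count_sum)
      have M: "set_mset M \<subseteq> {1..2 * n}"
      proof
        fix i assume "i \<in># M"
        thus "i \<in> {1..2 * n}" using count[of i] by (metis count_eq_zero_iff)
      qed
      have C: "?C M k = c k" and A: "?A M k = a k" if k: "k \<in> {1..n}" for k
      proof -
        have o: "odd (2 * k - 1)" "(2 * k - 1 + 1) div 2 = k" "2 * k - 1 \<in> {1..2 * n}" using k by auto
        show "?C M k = c k" using k by (simp add: count f_def)
        moreover have "count M (2 * k - 1) = a k - c k"
          unfolding count using o by (simp add: f_def del: One_nat_def)
        ultimately show "?A M k = a k" using ca[OF k] by simp
      qed
      have "(\<Sum>i\<in>#M. \<sigma> i) = s"
        unfolding s sum_gen[OF M] using A C
        by (auto simp: fund_sum_def last_row_exponents_def intro!: sum.cong ext)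
      thus "s \<in> (\<lambda>M. \<Sum>i\<in>#M. \<sigma> i) ` {M. set_mset M \<subseteq> {1..2 * n}}" using M by blast
    qed
  qed
qed

end
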